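(* Let $\Omega\subseteq\mathbb{R}^d$ be a bounded domain of class $C^{1,\alpha}$ for some $\alpha\in(0,1)$, and let $\varphi\in C^{1,\alpha}(\overline\Omega)$ with $\min\varphi>0$. Let $W$ be a finite-dimensional subspace of $L^\infty(\Omega)$, let $\Lambda>0$, and set $K=\{\mu\in W:\Lambda^{-1}\le\mu\le\Lambda\text{ in }\Omega\}$. Let $A=\{\mu\in W:\lambda^{-1}<\mu<\lambda\text{ in }\Omega\text{ for some }\lambda>0\}$ and let $F\colon A\to L^2(\Omega)$, $F(\mu)=\mu\,u(\mu)$, where $u(\mu)\in H^1(\Omega)$ is the unique weak solution of $$-\Delta u+\mu u=0\ \text{in }\Omega,\qquad u=\varphi\ \text{on }\partial\Omega.$$ Let $Q_N\colon L^2(\Omega)\to L^2(\Omega)$, $N\in\mathbb{N}$, be bounded linear maps such that $Q_N=Q_N^*$ and $Q_N\to I_{L^2(\Omega)}$ strongly as $N\to+\infty$. Let $C>0$ be a constant, depending only on $\Omega$, $W$, $\Lambda$ and $\varphi$, such that $$\|\mu_1-\mu_2\|_\infty\le C\,\|\mu_1u_1-\mu_2u_2\|_2,\qquad\mu_1,\mu_2\in K,$$ where $u_i=u(\mu_i)$. Then there exists $N\in\mathbb{N}$ such that $$\|\mu_1-\mu_2\|_\infty\le 2C\,\|Q_N(\mu_1u_1)-Q_N(\mu_2u_2)\|_2,\qquad\mu_1,\mu_2\in K;$$ explicitly, there exists $N$ satisfying $$\sup_{\xi\in K}\|(I_{L^2(\Omega)}-Q_N)F'(\xi)\|_{W\to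 L^2(\Omega)}\le\frac{1}{2C},$$ and any such $N$ has this property.
   Context: $W$ is normed by $\|\cdot\|_\infty=\|\cdot\|_{L^\infty(\Omega)}$, $\|\cdot\|_2$ is the $L^2(\Omega)$ norm, and $F'(\xi)\colon W\to L^2(\Omega)$ is the Fréchet derivative of $F$ at $\xi$. Strong convergence means pointwise convergence in norm. A constant $C$ as in the statement exists. *)

theory Defs
  imports "HOL-Analysis.Analysis" "HOL-Probability.Essential_Supremum"
begin

text \<open>
  Elements of the Lebesgue and Sobolev spaces on \<open>\<Omega>\<close> are represented by functions on the whole
  space; only their values on \<open>\<Omega>\<close> matter, and equality in these spaces is equality almost
  everywhere with respect to \<open>lebesgue_on \<Omega>\<close>. All functions are real-valued.
\<close>

section \<open>Hoelder classes and domains\<close>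

text \<open>
  The space \<open>C\<^sup>1\<^sup>,\<^sup>\<alpha>\<close> on the closure of \<open>S\<close>, for open \<open>S\<close>. The gradient \<open>G\<close> is uniformly continuous
  on \<open>S\<close>, so its continuous extension to the closure is automatic.
\<close>

definition C1_holder :: "real \<Rightarrow> 'a::euclidean_space set \<Rightarrow> ('a \<Rightarrow> real) \<Rightarrow> bool" where
  "C1_holder \<alpha> S f \<longleftrightarrow> continuous_on (closure S) f \<and>
     (\<exists>G :: 'a \<Rightarrow> 'a. (\<forall>x\<in>S. (f has_derivative (\<lambda>h. G x \<bullet> h)) (at x)) \<and>
        (\<exists>M. \<forall>x\<in>S. \<forall>y\<in>S. norm (G x - G y) \<le> M * norm (x - y) powr \<alpha>))"

text \<open>
  Near each boundary point, \<open>\<Omega>\<close> is the part of a ball above a \<open>C\<^sup>1\<^sup>,\<^sup>\<alpha>\<close> graph in the direction of a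
  unit vector \<open>\<nu>\<close>. The vector \<open>x - (x \<bullet> \<nu>) *\<^sub>R \<nu>\<close> is the projection of \<open>x\<close> to the hyperplane
  orthogonal to \<open>\<nu>\<close>, so only the values of \<open>\<gamma>\<close> on this hyperplane are used.
\<close>

definition C1_holder_domain :: "real \<Rightarrow> 'a::euclidean_space set \<Rightarrow> bool" where
  "C1_holder_domain \<alpha> \<Omega> \<longleftrightarrow> open \<Omega> \<and> connected \<Omega> \<and> \<Omega> \<noteq> {} \<and>
     (\<forall>x0\<in>frontier \<Omega>. \<exists>r>0. \<exists>\<nu> \<gamma>. norm \<nu> = 1 \<and> C1_holder \<alpha> UNIV \<gamma> \<and>
        \<Omega> \<inter> ball x0 r = {x \<in> ball x0 r. \<gamma> (x - (x \<bullet> \<nu>) *\<^sub>R \<nu>) < x \<bullet> \<nu>})"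

section \<open>Lebesgue spaces and linear operators\<close>

definition L2 :: "'a::euclidean_space set \<Rightarrow> ('a \<Rightarrow> real) set" where
  "L2 \<Omega> = {f \<in> borel_measurable (lebesgue_on \<Omega>). integrable (lebesgue_on \<Omega>) (\<lambda>x. (f x)\<^sup>2)}"

definition L2_inner :: "'a::euclidean_space set \<Rightarrow> ('a \<Rightarrow> real) \<Rightarrow> ('a \<Rightarrow> real) \<Rightarrow> real" where
  "L2_inner \<Omega> f g = (LINT x|lebesgue_on \<Omega>. f x * g x)"

definition L2_norm :: "'a::euclidean_space set \<Rightarrow> ('a \<Rightarrow> real) \<Rightarrow> real" where
  "L2_norm \<Omega> f = sqrt (LINT x|lebesgue_on \<Omega>. (f x)\<^sup>2)"

definition Linf :: "'a::euclidean_space set \<Rightarrow> ('a \<Rightarrow> real) set" where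
  "Linf \<Omega> = {f \<in> borel_measurable (lebesgue_on \<Omega>).
     esssup (lebesgue_on \<Omega>) (\<lambda>x. ereal \<bar>f x\<bar>) < \<infinity>}"

definition Linf_norm :: "'a::euclidean_space set \<Rightarrow> ('a \<Rightarrow> real) \<Rightarrow> real" where
  "Linf_norm \<Omega> f = real_of_ereal (esssup (lebesgue_on \<Omega>) (\<lambda>x. ereal \<bar>f x\<bar>))"

text \<open>
  \<open>W\<close> is the set of all representatives of the elements of the linear span, in \<open>L\<^sup>\<infinity>(\<Omega>)\<close>, of a
  finite set \<open>B\<close>.
\<close>

definition finite_dim_subspace_Linf ::
  "'a::euclidean_space set \<Rightarrow> ('a \<Rightarrow> real) set \<Rightarrow> bool" where
  "finite_dim_subspace_Linf \<Omega> W \<longleftrightarrow> (\<exists>B. finite B \<and> B \<subseteq> Linf \<Omega> \<and>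
     W = {f \<in> Linf \<Omega>. \<exists>c. AE x in lebesgue_on \<Omega>. f x = (\<Sum>b\<in>B. c b * b x)})"

text \<open>
  Bounded linear maps into \<open>L\<^sup>2(\<Omega>)\<close> from a space \<open>V\<close> (the set of all representatives) normed by
  \<open>nrm\<close>. Such a map respects equality almost everywhere, since it is bounded and additive.
\<close>

definition bounded_linear_L2 ::
  "'a::euclidean_space set \<Rightarrow> ('a \<Rightarrow> real) set \<Rightarrow> (('a \<Rightarrow> real) \<Rightarrow> real) \<Rightarrow>
     (('a \<Rightarrow> real) \<Rightarrow> ('a \<Rightarrow> real)) \<Rightarrow> bool" where
  "bounded_linear_L2 \<Omega> V nrm T \<longleftrightarrow>
     (\<forall>f\<in>V. T f \<in> L2 \<Omega>) \<and>
     (\<forall>f\<in>V. \<forall>g\<in>V. AE x in lebesgue_on \<Omega>. T (\<lambda>y. f y + g y) x = T f x + T g x) \<and>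
     (\<forall>c. \<forall>f\<in>V. AE x in lebesgue_on \<Omega>. T (\<lambda>y. c * f y) x = c * T f x) \<and>
     (\<exists>M. \<forall>f\<in>V. L2_norm \<Omega> (T f) \<le> M * nrm f)"

definition selfadjoint_L2 ::
  "'a::euclidean_space set \<Rightarrow> (('a \<Rightarrow> real) \<Rightarrow> ('a \<Rightarrow> real)) \<Rightarrow> bool" where
  "selfadjoint_L2 \<Omega> T \<longleftrightarrow> (\<forall>f\<in>L2 \<Omega>. \<forall>g\<in>L2 \<Omega>. L2_inner \<Omega> (T f) g = L2_inner \<Omega> f (T g))"

text \<open>
  The operator norm of a map from \<open>W \<subseteq> L\<^sup>\<infinity>(\<Omega>)\<close> to \<open>L\<^sup>2(\<Omega>)\<close>. It takes values in \<open>ereal\<close> so that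
  suprema over arbitrary (also empty or unbounded) families are meaningful.
\<close>

definition op_norm_Linf_L2 ::
  "'a::euclidean_space set \<Rightarrow> ('a \<Rightarrow> real) set \<Rightarrow> (('a \<Rightarrow> real) \<Rightarrow> ('a \<Rightarrow> real)) \<Rightarrow> ereal" where
  "op_norm_Linf_L2 \<Omega> W T = (SUP h\<in>{h \<in> W. Linf_norm \<Omega> h \<le> 1}. ereal (L2_norm \<Omega> (T h)))"

section \<open>Sobolev spaces\<close>

primrec Ck :: "nat \<Rightarrow> ('a::euclidean_space \<Rightarrow> real) \<Rightarrow> bool" where
  "Ck 0 f \<longleftrightarrow> continuous_on UNIV f"
| "Ck (Suc k) f \<longleftrightarrow> (\<forall>x. f differentiable (at x)) \<and>
     (\<forall>i\<in>Basis. Ck k (\<lambda>x. frechet_derivative f (at x) i))"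

text \<open>The space \<open>C\<^sub>c\<^sup>\<infinity>(\<Omega>)\<close>, its elements being extended by zero.\<close>

definition test_functions :: "'a::euclidean_space set \<Rightarrow> ('a \<Rightarrow> real) set" where
  "test_functions \<Omega> = {\<eta>. (\<forall>k. Ck k \<eta>) \<and>
     compact (closure {x. \<eta> x \<noteq> 0}) \<and> closure {x. \<eta> x \<noteq> 0} \<subseteq> \<Omega>}"

definition is_weak_gradient ::
  "'a::euclidean_space set \<Rightarrow> ('a \<Rightarrow> real) \<Rightarrow> ('a \<Rightarrow> 'a) \<Rightarrow> bool" where
  "is_weak_gradient \<Omega> u g \<longleftrightarrow> (\<forall>i\<in>Basis. (\<lambda>x. g x \<bullet> i) \<in> L2 \<Omega> \<and>
     (\<forall>\<eta>\<in>test_functions \<Omega>.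
        (LINT x|lebesgue_on \<Omega>. u x * frechet_derivative \<eta> (at x) i) =
        - (LINT x|lebesgue_on \<Omega>. (g x \<bullet> i) * \<eta> x)))"

definition H1 :: "'a::euclidean_space set \<Rightarrow> ('a \<Rightarrow> real) set" where
  "H1 \<Omega> = {u \<in> L2 \<Omega>. \<exists>g. is_weak_gradient \<Omega> u g}"

text \<open>For \<open>u \<in> H\<^sup>1(\<Omega>)\<close>, a representative of the (almost everywhere unique) weak gradient.\<close>

definition weak_gradient :: "'a::euclidean_space set \<Rightarrow> ('a \<Rightarrow> real) \<Rightarrow> ('a \<Rightarrow> 'a)" where
  "weak_gradient \<Omega> u = (SOME g. is_weak_gradient \<Omega> u g)"

definition H1_norm :: "'a::euclidean_space set \<Rightarrow> ('a \<Rightarrow> real) \<Rightarrow> real" where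
  "H1_norm \<Omega> u = sqrt ((L2_norm \<Omega> u)\<^sup>2 + (LINT x|lebesgue_on \<Omega>. (norm (weak_gradient \<Omega> u x))\<^sup>2))"

definition H10 :: "'a::euclidean_space set \<Rightarrow> ('a \<Rightarrow> real) set" where
  "H10 \<Omega> = {u \<in> H1 \<Omega>. \<exists>\<eta> :: nat \<Rightarrow> 'a \<Rightarrow> real. (\<forall>n. \<eta> n \<in> test_functions \<Omega>) \<and>
     (\<lambda>n. H1_norm \<Omega> (\<lambda>x. \<eta> n x - u x)) \<longlonglongrightarrow> 0}"

section \<open>The boundary value problem and the data map\<close>

text \<open>
  Weak solutions of \<open>- \<Delta> u + \<mu> u = 0\<close> in \<open>\<Omega>\<close> with \<open>u = \<phi>\<close> on the boundary; the boundary
  condition is understood as \<open>u - \<phi> \<in> H\<^sup>1\<^sub>0(\<Omega>)\<close>.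
\<close>

definition is_weak_solution ::
  "'a::euclidean_space set \<Rightarrow> ('a \<Rightarrow> real) \<Rightarrow> ('a \<Rightarrow> real) \<Rightarrow> ('a \<Rightarrow> real) \<Rightarrow> bool" where
  "is_weak_solution \<Omega> \<phi> \<mu> u \<longleftrightarrow> u \<in> H1 \<Omega> \<and> (\<lambda>x. u x - \<phi> x) \<in> H10 \<Omega> \<and>
     (\<forall>v\<in>H10 \<Omega>. (LINT x|lebesgue_on \<Omega>.
        weak_gradient \<Omega> u x \<bullet> weak_gradient \<Omega> v x + \<mu> x * u x * v x) = 0)"

definition weak_solution ::
  "'a::euclidean_space set \<Rightarrow> ('a \<Rightarrow> real) \<Rightarrow> ('a \<Rightarrow> real) \<Rightarrow> ('a \<Rightarrow> real)" where
  "weak_solution \<Omega> \<phi> \<mu> = (SOME u. is_weak_solution \<Omega> \<phi> \<mu> u)"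

definition data_map ::
  "'a::euclidean_space set \<Rightarrow> ('a \<Rightarrow> real) \<Rightarrow> ('a \<Rightarrow> real) \<Rightarrow> ('a \<Rightarrow> real)" where
  "data_map \<Omega> \<phi> \<mu> = (\<lambda>x. \<mu> x * weak_solution \<Omega> \<phi> \<mu> x)"

definition admissible_K ::
  "'a::euclidean_space set \<Rightarrow> ('a \<Rightarrow> real) set \<Rightarrow> real \<Rightarrow> ('a \<Rightarrow> real) set" where
  "admissible_K \<Omega> W \<Lambda> = {\<mu> \<in> W. AE x in lebesgue_on \<Omega>. inverse \<Lambda> \<le> \<mu> x \<and> \<mu> x \<le> \<Lambda>}"

definition admissible_A ::
  "'a::euclidean_space set \<Rightarrow> ('a \<Rightarrow> real) set \<Rightarrow> ('a \<Rightarrow> real) set" where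
  "admissible_A \<Omega> W =
     {\<mu> \<in> W. \<exists>l>0. AE x in lebesgue_on \<Omega>. inverse l < \<mu> x \<and> \<mu> x < l}"

text \<open>
  \<open>D\<close> is a Frechet derivative at \<open>\<xi>\<close> of \<open>F : A \<rightarrow> L\<^sup>2(\<Omega>)\<close>, where \<open>A\<close> is a subset of the space \<open>W\<close>
  normed by \<open>L\<^sup>\<infinity>(\<Omega>)\<close>.
\<close>

definition has_frechet_derivative_Linf_L2 ::
  "'a::euclidean_space set \<Rightarrow> ('a \<Rightarrow> real) set \<Rightarrow> ('a \<Rightarrow> real) set \<Rightarrow>
     (('a \<Rightarrow> real) \<Rightarrow> ('a \<Rightarrow> real)) \<Rightarrow> ('a \<Rightarrow> real) \<Rightarrow>
     (('a \<Rightarrow> real) \<Rightarrow> ('a \<Rightarrow> real)) \<Rightarrow> bool" where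
  "has_frechet_derivative_Linf_L2 \<Omega> W A F \<xi> D \<longleftrightarrow>
     bounded_linear_L2 \<Omega> W (Linf_norm \<Omega>) D \<and>
     (\<forall>e>0. \<exists>\<delta>>0. \<forall>h\<in>W. Linf_norm \<Omega> h < \<delta> \<and> (\<lambda>x. \<xi> x + h x) \<in> A \<longrightarrow>
        L2_norm \<Omega> (\<lambda>x. F (\<lambda>y. \<xi> y + h y) x - F \<xi> x - D h x) \<le> e * Linf_norm \<Omega> h)"

definition frechet_derivative_Linf_L2 ::
  "'a::euclidean_space set \<Rightarrow> ('a \<Rightarrow> real) set \<Rightarrow> ('a \<Rightarrow> real) set \<Rightarrow>
     (('a \<Rightarrow> real) \<Rightarrow> ('a \<Rightarrow> real)) \<Rightarrow> ('a \<Rightarrow> real) \<Rightarrow>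
     (('a \<Rightarrow> real) \<Rightarrow> ('a \<Rightarrow> real))" where
  "frechet_derivative_Linf_L2 \<Omega> W A F \<xi> = (SOME D. has_frechet_derivative_Linf_L2 \<Omega> W A F \<xi> D)"

text \<open>The supremum over \<open>\<xi> \<in> K\<close> of the operator norms of \<open>(I - T) F'(\<xi>)\<close>.\<close>

definition sup_defect ::
  "'a::euclidean_space set \<Rightarrow> ('a \<Rightarrow> real) \<Rightarrow> ('a \<Rightarrow> real) set \<Rightarrow> real \<Rightarrow>
     (('a \<Rightarrow> real) \<Rightarrow> ('a \<Rightarrow> real)) \<Rightarrow> ereal" where
  "sup_defect \<Omega> \<phi> W \<Lambda> T = (SUP \<xi>\<in>admissible_K \<Omega> W \<Lambda>.
     op_norm_Linf_L2 \<Omega> W (\<lambda>h.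
       let g = frechet_derivative_Linf_L2 \<Omega> W (admissible_A \<Omega> W) (data_map \<Omega> \<phi>) \<xi> h
       in (\<lambda>x. g x - T g x)))"

end

theory Submission
  imports Defs
begin

text \<open>
  The problem lives in the Hilbert space \<open>H\<close> of pairs of a square-integrable function and a
  square-integrable vector field on \<open>\<real>\<^sup>d\<close>. A function \<open>u \<in> H\<^sup>1(\<Omega>)\<close> is the pair of \<open>u\<close> and its
  gradient, extended by zero, and \<open>H\<^sup>1\<^sub>0(\<Omega>)\<close> becomes a closed subspace \<open>V\<close> of \<open>H\<close>. A coefficient \<open>\<mu>\<close>
  enters only through the operator of multiplication by \<open>\<mu>\<close> on \<open>L\<^sup>2\<close>, whose norm is at most
  \<open>\<parallel>\<mu>\<parallel>\<^sub>\<infinity>\<close>. A weak solution for \<open>\<mu>\<close> is then an element of the affine space \<open>\<phi> + V\<close> that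
  is orthogonal to \<open>V\<close> for a symmetric form. The form is coercive on \<open>V\<close> because \<open>\<mu>\<close> is bounded
  below by a positive constant, and \<open>symmetric_Lax_Milgram\<close> gives existence and uniqueness. The
  translation needs the uniqueness of weak gradients, that is the fundamental lemma of the calculus of
  variations (\<open>AE_zero_of_test_integrals_zero\<close>), and integration by parts
  (\<open>integral_directional_derivative_zero\<close>).

  Differentiating the equation in \<open>\<mu>\<close> suggests \<open>F'(\<xi>) h = h u(\<xi>) - \<xi> R(h u(\<xi>))\<close>, where \<open>R\<close>
  solves the equation with coefficient \<open>\<xi>\<close>, a given right-hand side and zero boundary values. The
  remainder of this linearization is exactly \<open>h (u(\<xi> + h) - u(\<xi>))\<close> minus \<open>\<xi>\<close> times \<open>R\<close>
  of the same function, hence quadratic in \<open>h\<close> (\<open>data_op_remainder\<close>). The same formula shows that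
  \<open>F'(\<xi>) h\<close> depends continuously on \<open>\<xi>\<close> and \<open>h\<close> (\<open>data_op'_tendsto\<close>).

  Existence of \<open>N\<close>: as \<open>W\<close> has finite dimension, sequences in \<open>K\<close> and in the unit ball of \<open>W\<close>
  have subsequences whose multiplication operators converge in norm. Along them \<open>F'(\<xi>) h\<close> converges
  to some \<open>s\<close>, and \<open>Q\<^sub>N s\<close> tends to \<open>s\<close>. The \<open>Q\<^sub>N\<close> are uniformly bounded by the
  Banach--Steinhaus theorem, so \<open>(I - Q\<^sub>N) F'(\<xi>) h\<close> cannot stay away from zero
  (\<open>defect_eventually_small\<close>).

  The estimate for any such \<open>N\<close>: the set \<open>K\<close> is convex, and the mean value inequality for
  \<open>(I - Q\<^sub>N) F\<close> on the segment from \<open>\<mu>\<^sub>2\<close> to \<open>\<mu>\<^sub>1\<close> bounds \<open>(I - Q\<^sub>N)(F(\<mu>\<^sub>1) - F(\<mu>\<^sub>2))\<close>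
  by \<open>\<parallel>\<mu>\<^sub>1 - \<mu>\<^sub>2\<parallel>\<^sub>\<infinity> / (2 C)\<close>. Inserted into the given stability estimate this gives
  \<open>\<parallel>\<mu>\<^sub>1 - \<mu>\<^sub>2\<parallel>\<^sub>\<infinity> \<le> C \<parallel>Q\<^sub>N(F(\<mu>\<^sub>1) - F(\<mu>\<^sub>2))\<parallel>\<^sub>2 + \<parallel>\<mu>\<^sub>1 - \<mu>\<^sub>2\<parallel>\<^sub>\<infinity> / 2\<close>, and the last
  term is absorbed on the left (\<open>stability_from_defect\<close>).
\<close>

section \<open>Hilbert and Banach spaces\<close>

lemma quadratic_nonneg_imp_linear_zero:
  fixes a b :: real
  assumes "\<And>t. 0 \<le> t\<^sup>2 * a + 2 * t * b"
  shows "b = 0"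
proof (rule ccontr)
  assume "b \<noteq> 0"
  have a: "0 \<le> a" using assms[of 1] assms[of "-1"] by simp
  \<comment> \<open>Close to the minimiser \<open>- b / a\<close>, but also defined for \<open>a = 0\<close>.\<close>
  define t where "t = - b / (a + 1)"
  have tb: "t * (a + 1) = - b" using a by (simp add: t_def)
  have "t\<^sup>2 * a + 2 * t * b = t * (t * (a + 1)) - t\<^sup>2 + 2 * t * b"
    by (simp add: algebra_simps power2_eq_square)
  also have "\<dots> = t * b - t\<^sup>2" unfolding tb by simp
  also have "\<dots> < 0"
  proof -
    have "t * b = - (b\<^sup>2 / (a + 1))" by (simp add: t_def power2_eq_square)
    moreover have "b\<^sup>2 / (a + 1) > 0" using a \<open>b \<noteq> 0\<close> by simp
    ultimately show ?thesis using zero_le_power2[of t] by linarith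
  qed
  finally show False using assms[of t] by simp
qed

text \<open>
  The solution minimises \<open>J z = B z z - 2 * l z\<close> over \<open>V\<close>. Since \<open>l\<close> is linear, the
  identity \<open>B (x - y) (x - y) = 2 * J x + 2 * J y - 4 * J ((x + y) / 2)\<close> makes every minimising
  sequence a Cauchy sequence, and the first variation of \<open>J\<close> at its limit is the equation.
\<close>
lemma symmetric_Lax_Milgram:
  fixes B :: "'h::{real_inner,complete_space} \<Rightarrow> 'h \<Rightarrow> real"
  assumes B: "bounded_bilinear B" and sym: "\<And>x y. B x y = B y x"
    and coer: "\<And>x. x \<in> V \<Longrightarrow> c * (norm x)\<^sup>2 \<le> B x x" and c: "c > 0"
    and V: "subspace V" "closed V" and l: "bounded_linear l"
  obtains z where "z \<in> V" "\<And>v. v \<in> V \<Longrightarrow> B z v = l v"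
proof -
  interpret B: bounded_bilinear B by (rule B)
  interpret l: bounded_linear l by (rule l)
  define J where "J z = B z z - 2 * l z" for z
  obtain M where M: "\<And>x. \<bar>l x\<bar> \<le> norm x * M" using l.bounded by (auto simp: mult.commute)
  have lower: "- M\<^sup>2 / c \<le> J z" if "z \<in> V" for z
  proof -
    have "0 \<le> c * (norm z - M / c)\<^sup>2" using c by simp
    also have "c * (norm z - M / c)\<^sup>2 = c * (norm z)\<^sup>2 - 2 * (norm z * M) + M\<^sup>2 / c"
      using c by (simp add: field_simps power2_eq_square)
    finally show ?thesis using coer[OF that] M[of z] by (simp add: J_def)
  qed
  have V0: "0 \<in> V" using V by (simp add: subspace_0)
  define m where "m = Inf (J ` V)"
  have bdd: "bdd_below (J ` V)" using lower by (auto intro!: bdd_belowI)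
  have m: "m \<le> J z" if "z \<in> V" for z unfolding m_def using bdd that by (auto intro: cInf_lower)
  have "\<exists>z\<in>V. J z < m + 1 / real (Suc n)" for n
  proof -
    have "Inf (J ` V) < m + 1 / real (Suc n)" by (simp add: m_def)
    then show ?thesis using cInf_lessD[of "J ` V"] V0 by blast
  qed
  then obtain z where z: "\<And>n. z n \<in> V" "\<And>n. J (z n) < m + 1 / real (Suc n)" by metis
  have par: "c * (norm (x - y))\<^sup>2 \<le> 2 * J x + 2 * J y - 4 * m" if "x \<in> V" "y \<in> V" for x y
  proof -
    have "(1/2) *\<^sub>R (x + y) \<in> V" using V that by (simp add: subspace_add subspace_scale)
    from m[OF this] have "4 * m \<le> 4 * J ((1/2) *\<^sub>R (x + y))" by simp
    moreover have "B (x - y) (x - y) = 2 * J x + 2 * J y - 4 * J ((1/2) *\<^sub>R (x + y))"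
      by (simp add: J_def B.scaleR_left B.scaleR_right B.add_left B.add_right B.diff_left
          B.diff_right l.add l.scaleR sym[of y x] algebra_simps)
    moreover have "x - y \<in> V" using V that by (simp add: subspace_diff)
    ultimately show ?thesis using coer[of "x - y"] by linarith
  qed
  have "Cauchy z"
  proof (rule metric_CauchyI)
    fix e :: real assume e: "e > 0"
    obtain k where k: "4 / (c * e\<^sup>2) < real k" using reals_Archimedean2 by blast
    have *: "dist (z i) (z j) < e" if ij: "i \<ge> k" "j \<ge> k" for i j
    proof -
      have kpos: "real k > 0" using k c e by (smt (verit) divide_pos_pos mult_pos_pos zero_less_power)
      have i: "1 / real (Suc n) < 1 / real k" if "n \<ge> k" for n
        using that kpos by (intro divide_strict_left_mono) auto
      have "c * (norm (z i - z j))\<^sup>2 \<le> 2 * J (z i) + 2 * J (z j) - 4 * m" using par z by blast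
      also have "\<dots> \<le> 4 * (1 / real k)"
        using z(2)[of i] z(2)[of j] i[of i] i[of j] ij by linarith
      also have "\<dots> < c * e\<^sup>2" using k kpos c e by (simp add: field_simps)
      finally have "(norm (z i - z j))\<^sup>2 < e\<^sup>2" using c by simp
      then show ?thesis using e by (simp add: dist_norm power_less_imp_less_base)
    qed
    then show "\<exists>M. \<forall>m\<ge>M. \<forall>n\<ge>M. dist (z m) (z n) < e" by blast
  qed
  then obtain y where y: "z \<longlonglongrightarrow> y" using Cauchy_convergent_iff convergentD by blast
  have yV: "y \<in> V" using V(2) z(1) y closed_sequentially by blast
  have "(\<lambda>n. J (z n)) \<longlonglongrightarrow> J y" unfolding J_def
    by (intro tendsto_intros B.tendsto y l.tendsto)
  moreover have "(\<lambda>n. m + 1 / real (Suc n)) \<longlonglongrightarrow> m + 0"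
    by (intro tendsto_intros LIMSEQ_Suc[OF lim_inverse_n'])
  ultimately have "J y \<le> m + 0" using z(2) by (intro LIMSEQ_le[of "\<lambda>n. J (z n)" _ "\<lambda>n. m + 1 / real (Suc n)"]) (auto intro: less_imp_le)
  then have min: "J y \<le> J v" if "v \<in> V" for v using m[OF that] by simp
  have "B y v = l v" if v: "v \<in> V" for v
  proof -
    have "0 \<le> t\<^sup>2 * B v v + 2 * t * (B y v - l v)" for t
    proof -
      have "y + t *\<^sub>R v \<in> V" using V yV v by (simp add: subspace_add subspace_scale)
      then have "J y \<le> J (y + t *\<^sub>R v)" by (rule min)
      also have "\<dots> = J y + (t\<^sup>2 * B v v + 2 * t * (B y v - l v))"
        by (simp add: J_def B.scaleR_left B.scaleR_right B.add_left B.add_right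
            l.add l.scaleR sym[of v y] algebra_simps power2_eq_square)
      finally show ?thesis by simp
    qed
    then show ?thesis using quadratic_nonneg_imp_linear_zero by fastforce
  qed
  then show ?thesis using that yV by blast
qed

text \<open>
  Bolzano--Weierstrass without coordinates. By induction the span of the smaller set is closed, so a new
  vector has positive distance from it, and along a bounded sequence its coefficients stay bounded.
\<close>
lemma bounded_sequence_in_finite_span:
  fixes x :: "nat \<Rightarrow> 'x::real_normed_vector"
  assumes "finite B" "\<And>n. x n \<in> span B" "\<And>n. norm (x n) \<le> M"
  obtains l r where "l \<in> span B" "strict_mono (r :: nat \<Rightarrow> nat)" "(x \<circ> r) \<longlonglongrightarrow> l"
proof -
  have "\<exists>l\<in>span B. \<exists>r::nat \<Rightarrow> nat. strict_mono r \<and> (x \<circ> r) \<longlonglongrightarrow> l"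
    using assms
  proof (induction B arbitrary: x M rule: finite_induct)
    case empty
    then have "x \<circ> id = (\<lambda>n. 0)" by (auto simp: fun_eq_iff)
    then have "(x \<circ> id) \<longlonglongrightarrow> 0" by simp
    then show ?case by (intro bexI[of _ 0] exI[of _ id]) (auto intro: strict_monoI)
  next
    case (insert b B)
    show ?case
    proof (cases "b \<in> span B")
      case True
      then have "span (insert b B) = span B" by (rule span_redundant)
      then show ?thesis using insert.IH[OF _ insert.prems(2)] insert.prems(1) by simp
    next
      case False
      have clo: "closed (span B)"
        unfolding closed_sequential_limits
      proof (intro allI impI)
        fix y l assume y: "(\<forall>n. y n \<in> span B) \<and> y \<longlonglongrightarrow> l"
        then obtain K where "\<And>n. norm (y n) \<le> K"
          using convergent_imp_Bseq[of y] by (auto simp: convergent_def Bseq_def)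
        with insert.IH[of y K] y obtain l' r where "l' \<in> span B" "strict_mono (r :: nat \<Rightarrow> nat)" "(y \<circ> r) \<longlonglongrightarrow> l'"
          by blast
        then show "l \<in> span B"
          using y LIMSEQ_subseq_LIMSEQ LIMSEQ_unique by blast
      qed
      define d where "d = infdist b (span B)"
      have dpos: "d > 0"
        unfolding d_def using False clo by (simp add: infdist_pos_not_in_closed span_zero ex_in_conv[symmetric] exI[of _ 0])
      have "\<exists>c. x n - c *\<^sub>R b \<in> span B" for n
        using insert.prems(1)[of n] by (simp add: span_insert)
      then obtain c where c: "\<And>n. x n - c n *\<^sub>R b \<in> span B" by metis
      have cb: "\<bar>c n\<bar> * d \<le> M" for n
      proof (cases "c n = 0")
        case True
        then show ?thesis using order_trans[OF norm_ge_zero insert.prems(2)] by simp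
      next
        case nz: False
        have "(- 1 / c n) *\<^sub>R (x n - c n *\<^sub>R b) \<in> span B" using c by (rule span_scale)
        then have "d \<le> dist b ((- 1 / c n) *\<^sub>R (x n - c n *\<^sub>R b))"
          unfolding d_def by (rule infdist_le)
        also have "\<dots> = norm ((1 / c n) *\<^sub>R x n)" using nz by (simp add: dist_norm algebra_simps)
        finally have "\<bar>c n\<bar> * d \<le> norm (x n)" using nz by (simp add: field_simps)
        then show ?thesis using insert.prems(2)[of n] by simp
      qed
      then have cb': "\<bar>c n\<bar> \<le> M / d" for n using dpos by (simp add: field_simps)
      then obtain c0 r1 where r1: "strict_mono (r1 :: nat \<Rightarrow> nat)" "(c \<circ> r1) \<longlonglongrightarrow> c0"
        using bounded_imp_convergent_subsequence[of c] by (auto simp: bounded_iff)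
      define y where "y = (\<lambda>n. x (r1 n) - c (r1 n) *\<^sub>R b)"
      have "norm (y n) \<le> M + M / d * norm b" for n
      proof -
        have "norm (y n) \<le> norm (x (r1 n)) + \<bar>c (r1 n)\<bar> * norm b"
          unfolding y_def using norm_triangle_ineq4[of "x (r1 n)" "c (r1 n) *\<^sub>R b"] by simp
        also have "\<dots> \<le> M + M / d * norm b"
          using insert.prems(2) cb' by (intro add_mono mult_right_mono) auto
        finally show ?thesis .
      qed
      then obtain l r2 where l: "l \<in> span B" and r2: "strict_mono (r2 :: nat \<Rightarrow> nat)" "(y \<circ> r2) \<longlonglongrightarrow> l"
        using insert.IH[of y "M + M / d * norm b"] c unfolding y_def by blast
      have "(\<lambda>n. y (r2 n) + c (r1 (r2 n)) *\<^sub>R b) \<longlonglongrightarrow> l + c0 *\<^sub>R b"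
        using r2 LIMSEQ_subseq_LIMSEQ[OF r1(2) r2(1)] by (intro tendsto_intros) (auto simp: o_def)
      then have "(x \<circ> (r1 \<circ> r2)) \<longlonglongrightarrow> l + c0 *\<^sub>R b" by (simp add: y_def o_def)
      moreover have "l + c0 *\<^sub>R b \<in> span (insert b B)"
        using l by (auto simp: span_insert intro: exI[of _ c0])
      ultimately show ?thesis using r1 r2 strict_mono_o by blast
    qed
  qed
  then show ?thesis using that by blast
qed

text \<open>
  By Baire's theorem, one of the closed sets on which all \<open>T n\<close> are bounded by \<open>k\<close> contains a ball.
  Subtracting the values at its centre gives a bound on a ball around the origin.
\<close>
lemma uniform_boundedness:
  fixes T :: "nat \<Rightarrow> 'x::banach \<Rightarrow> 'y::real_normed_vector"
  assumes T: "\<And>n. bounded_linear (T n)" and ptw: "\<And>x. \<exists>K. \<forall>n. norm (T n x) \<le> K"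
  obtains K where "\<And>n x. norm (T n x) \<le> K * norm x"
proof -
  interpret T: bounded_linear "T n" for n by (rule T)
  define E where "E k = {x. \<forall>n. norm (T n x) \<le> real k}" for k :: nat
  have clo: "closed (E k)" for k
  proof -
    have eq: "E k = (\<Inter>n. {x. norm (T n x) \<le> real k})" by (auto simp: E_def)
    have "closed {x. norm (T n x) \<le> real k}" for n
      by (intro closed_Collect_le continuous_on_norm T.continuous_on continuous_on_id continuous_on_const)
    then show ?thesis unfolding eq by blast
  qed
  have "x \<in> (\<Union>k. E k)" for x
  proof -
    obtain K where "\<forall>n. norm (T n x) \<le> K" using ptw by blast
    moreover obtain k :: nat where "K \<le> real k" using real_arch_simple by blast
    ultimately have "x \<in> E k" unfolding E_def using order_trans by blast
    then show ?thesis by blast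
  qed
  then have UN: "(\<Union>k. E k) = UNIV" by blast
  have "\<exists>k. interior (E k) \<noteq> {}"
  proof (rule ccontr)
    assume "\<nexists>k. interior (E k) \<noteq> {}"
    then have "\<And>k. interior (E k) = {}" by simp
    then have "Met_TC.mtopology interior_of \<Union> (range E) = {}"
      using clo by (intro Met_TC.metric_Baire_category_alt) (auto simp: complete_UNIV)
    then show False by (simp add: UN)
  qed
  then obtain k x0 where "x0 \<in> interior (E k)" by blast
  then obtain r where r: "r > 0" "cball x0 r \<subseteq> E k" by (meson mem_interior_cball)
  have small: "norm (T n h) \<le> 2 * real k" if h: "norm h \<le> r" for n h
  proof -
    have "x0 + h \<in> E k" "x0 \<in> E k" using r h by (auto simp: dist_norm)
    then have "norm (T n (x0 + h)) \<le> real k" "norm (T n x0) \<le> real k" by (auto simp: E_def)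
    moreover have "T n h = T n (x0 + h) - T n x0" by (simp add: T.add)
    ultimately show ?thesis using norm_triangle_ineq4[of "T n (x0 + h)" "T n x0"] by simp
  qed
  have "norm (T n x) \<le> (2 * real k / r) * norm x" for n x
  proof (cases "x = 0")
    case False
    have "norm (T n ((r / norm x) *\<^sub>R x)) \<le> 2 * real k" using False r by (intro small) auto
    then show ?thesis using False r by (simp add: T.scaleR field_simps)
  qed (simp add: T.zero)
  then show ?thesis using that by blast
qed

section \<open>Coercive forms and the dependence of their solutions on the coefficient\<close>

lemma norm_fst_le_norm: "norm (fst z) \<le> norm z"
  using norm_fst_le[of "fst z" "snd z"] by simp

text \<open>
  The boundary value problem in abstract form. A vector \<open>z\<close> stands for a function and its gradient,
  \<open>V\<close> for the space with zero boundary values, and \<open>zb\<close> for an extension of the boundary values. The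
  coefficient is a bounded operator \<open>m\<close> on the first component. Coefficients thus form a normed space, in
  which the calculus of \<open>has_derivative\<close> is available.
\<close>
locale dirichlet_form =
  fixes V :: "('u::{real_inner,complete_space} \<times> 'p::{real_inner,complete_space}) set"
    and zb :: "'u \<times> 'p"
  assumes subspace_V: "subspace V" and closed_V: "closed V"
begin

text \<open>
  The form \<open>snd z \<bullet> snd w + m (fst z) \<bullet> fst w\<close>, written as one inner product so that its
  bilinearity and boundedness follow by composition.
\<close>
definition energy :: "('u \<Rightarrow>\<^sub>L 'u) \<Rightarrow> 'u \<times> 'p \<Rightarrow> 'u \<times> 'p \<Rightarrow> real" where
  "energy m z w = (blinfun_apply m (fst z), snd z) \<bullet> w"

text \<open>
  The constant is a parameter because limits of coefficients and compactness arguments need it to be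
  uniform.
\<close>
definition coercive :: "real \<Rightarrow> ('u \<Rightarrow>\<^sub>L 'u) \<Rightarrow> bool" where
  "coercive c m \<longleftrightarrow> (\<forall>f g. blinfun_apply m f \<bullet> g = f \<bullet> blinfun_apply m g) \<and>
     (\<forall>z\<in>V. c * (norm z)\<^sup>2 \<le> energy m z z)"

definition resolvent :: "('u \<Rightarrow>\<^sub>L 'u) \<Rightarrow> 'u \<Rightarrow> 'u \<times> 'p" where
  "resolvent m f = (THE z. z \<in> V \<and> (\<forall>v\<in>V. energy m z v = f \<bullet> fst v))"

definition state :: "('u \<Rightarrow>\<^sub>L 'u) \<Rightarrow> 'u \<times> 'p" where
  "state m = (THE z. z - zb \<in> V \<and> (\<forall>v\<in>V. energy m z v = 0))"

definition data_op :: "('u \<Rightarrow>\<^sub>L 'u) \<Rightarrow> 'u" where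
  "data_op m = blinfun_apply m (fst (state m))"

text \<open>
  The product rule for \<open>m u(m)\<close> in direction \<open>k\<close>. Differentiating \<open>energy m (state m) v = 0\<close> in \<open>m\<close>
  shows that the derivative of the state is \<open>- resolvent m (k (fst (state m)))\<close>.
\<close>
definition data_op' :: "('u \<Rightarrow>\<^sub>L 'u) \<Rightarrow> ('u \<Rightarrow>\<^sub>L 'u) \<Rightarrow> 'u" where
  "data_op' m k = blinfun_apply k (fst (state m)) -
     blinfun_apply m (fst (resolvent m (blinfun_apply k (fst (state m)))))"

lemma bounded_bilinear_energy: "bounded_bilinear (energy m)"
proof -
  have "bounded_linear (\<lambda>z :: 'u \<times> 'p. (blinfun_apply m (fst z), snd z))"
    by (intro bounded_linear_Pair bounded_linear_compose[OF blinfun.bounded_linear_right]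
        bounded_linear_fst bounded_linear_snd)
  from bounded_bilinear.comp[OF bounded_bilinear_inner this bounded_linear_ident]
  show ?thesis by (simp add: energy_def[abs_def])
qed

lemmas energy_simps =
  bounded_bilinear.add_left[OF bounded_bilinear_energy] bounded_bilinear.add_right[OF bounded_bilinear_energy]
  bounded_bilinear.diff_left[OF bounded_bilinear_energy] bounded_bilinear.diff_right[OF bounded_bilinear_energy]
  bounded_bilinear.scaleR_left[OF bounded_bilinear_energy] bounded_bilinear.scaleR_right[OF bounded_bilinear_energy]
  bounded_bilinear.minus_left[OF bounded_bilinear_energy] bounded_bilinear.minus_right[OF bounded_bilinear_energy]

lemma energy_diff_operator:
  "energy m' z w = energy m z w + blinfun_apply (m' - m) (fst z) \<bullet> fst w"
  by (simp add: energy_def blinfun.diff_left inner_diff_left inner_prod_def)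

lemma energy_commute: "coercive c m \<Longrightarrow> energy m z w = energy m w z"
  by (simp add: coercive_def energy_def inner_prod_def inner_commute)

lemma energy_zero_imp_zero:
  assumes "coercive c m" "c > 0" "z \<in> V" "\<And>v. v \<in> V \<Longrightarrow> energy m z v = 0"
  shows "z = 0"
proof -
  have "c * (norm z)\<^sup>2 \<le> energy m z z" using assms(1,3) by (simp add: coercive_def)
  also have "\<dots> = 0" using assms by simp
  finally have "(norm z)\<^sup>2 \<le> 0" using \<open>c > 0\<close> by (simp add: mult_le_0_iff)
  then show ?thesis by simp
qed

lemma energy_solvable:
  assumes "coercive c m" "c > 0" "bounded_linear l"
  obtains z where "z \<in> V" "\<And>v. v \<in> V \<Longrightarrow> energy m z v = l v"
proof (rule symmetric_Lax_Milgram[OF bounded_bilinear_energy[of m], of V c l])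
  show "energy m x y = energy m y x" for x y by (rule energy_commute[OF assms(1)])
  show "c * (norm x)\<^sup>2 \<le> energy m x x" if "x \<in> V" for x using assms(1) that by (simp add: coercive_def)
qed (use assms subspace_V closed_V that in auto)

context
  fixes m c assumes m: "coercive c m" and c: "c > 0"
begin

lemma resolvent_ex1: "\<exists>!z. z \<in> V \<and> (\<forall>v\<in>V. energy m z v = f \<bullet> fst v)"
proof (rule ex_ex1I)
  have "bounded_linear (\<lambda>v :: 'u \<times> 'p. f \<bullet> fst v)"
    by (intro bounded_linear_compose[OF bounded_linear_inner_right] bounded_linear_fst)
  from energy_solvable[OF m c this] show "\<exists>z. z \<in> V \<and> (\<forall>v\<in>V. energy m z v = f \<bullet> fst v)" by metis
  fix z w
  assume "z \<in> V \<and> (\<forall>v\<in>V. energy m z v = f \<bullet> fst v)" "w \<in> V \<and> (\<forall>v\<in>V. energy m w v = f \<bullet> fst v)"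
  then have "z - w = 0"
    by (intro energy_zero_imp_zero[OF m c]) (auto simp: energy_simps subspace_V subspace_diff)
  then show "z = w" by simp
qed

lemma resolvent_in: "resolvent m f \<in> V"
  and energy_resolvent: "v \<in> V \<Longrightarrow> energy m (resolvent m f) v = f \<bullet> fst v"
  using theI'[OF resolvent_ex1, of f] unfolding resolvent_def by auto

lemma resolvent_eqI:
  assumes "z \<in> V" "\<And>v. v \<in> V \<Longrightarrow> energy m z v = f \<bullet> fst v"
  shows "resolvent m f = z"
  unfolding resolvent_def using assms by (intro the1_equality resolvent_ex1) auto

lemma resolvent_add: "resolvent m (f + g) = resolvent m f + resolvent m g"
  by (rule resolvent_eqI)
    (auto simp: energy_simps energy_resolvent resolvent_in subspace_V subspace_add inner_add_left)

lemma resolvent_scaleR: "resolvent m (a *\<^sub>R f) = a *\<^sub>R resolvent m f"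
  by (rule resolvent_eqI)
    (auto simp: energy_simps energy_resolvent resolvent_in subspace_V subspace_scale)

lemma norm_resolvent: "norm (resolvent m f) \<le> norm f / c"
proof -
  let ?z = "resolvent m f"
  have "c * (norm ?z)\<^sup>2 \<le> energy m ?z ?z" using m resolvent_in by (simp add: coercive_def)
  also have "\<dots> = f \<bullet> fst ?z" by (rule energy_resolvent[OF resolvent_in])
  also have "\<dots> \<le> norm f * norm (fst ?z)" by (rule norm_cauchy_schwarz)
  also have "\<dots> \<le> norm f * norm ?z" by (intro mult_left_mono norm_fst_le_norm) auto
  finally have "(c * norm ?z) * norm ?z \<le> norm f * norm ?z" by (simp add: power2_eq_square mult.assoc)
  then have "c * norm ?z \<le> norm f \<or> ?z = 0" by (metis mult_right_le_imp_le norm_le_zero_iff not_le)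
  then show ?thesis using c by (auto simp: field_simps)
qed

lemma bounded_linear_resolvent: "bounded_linear (resolvent m)"
  by (rule bounded_linear_intro[where K = "1 / c"])
    (auto simp: resolvent_add resolvent_scaleR norm_resolvent)

lemma state_ex1: "\<exists>!z. z - zb \<in> V \<and> (\<forall>v\<in>V. energy m z v = 0)"
proof (rule ex_ex1I)
  have "bounded_linear (\<lambda>v. - energy m zb v)"
    by (intro bounded_linear_minus bounded_bilinear.bounded_linear_right[OF bounded_bilinear_energy])
  from energy_solvable[OF m c this] obtain w where w: "w \<in> V" "\<And>v. v \<in> V \<Longrightarrow> energy m w v = - energy m zb v"
    by blast
  then show "\<exists>z. z - zb \<in> V \<and> (\<forall>v\<in>V. energy m z v = 0)"
    by (intro exI[of _ "zb + w"]) (auto simp: energy_simps)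
  fix z w
  assume z: "z - zb \<in> V \<and> (\<forall>v\<in>V. energy m z v = 0)" and w: "w - zb \<in> V \<and> (\<forall>v\<in>V. energy m w v = 0)"
  have "z - w \<in> V" using subspace_diff[OF subspace_V, of "z - zb" "w - zb"] z w by simp
  then have "z - w = 0" using z w by (intro energy_zero_imp_zero[OF m c]) (auto simp: energy_simps)
  then show "z = w" by simp
qed

lemma state_diff_in: "state m - zb \<in> V"
  and energy_state: "v \<in> V \<Longrightarrow> energy m (state m) v = 0"
  using theI'[OF state_ex1] unfolding state_def by auto

lemma state_eqI: "z - zb \<in> V \<Longrightarrow> (\<And>v. v \<in> V \<Longrightarrow> energy m z v = 0) \<Longrightarrow> state m = z"
  unfolding state_def by (intro the1_equality state_ex1) auto

lemma bounded_linear_data_op': "bounded_linear (data_op' m)"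
proof -
  have *: "bounded_linear (\<lambda>k. blinfun_apply k (fst (state m)))"
    by (rule blinfun.bounded_linear_left)
  show ?thesis unfolding data_op'_def
    by (intro bounded_linear_sub * bounded_linear_compose[OF blinfun.bounded_linear_right]
        bounded_linear_compose[OF bounded_linear_fst] bounded_linear_compose[OF bounded_linear_resolvent])
qed

text \<open>
  Both states are orthogonal to \<open>V\<close>, each for its own form, so the difference of the forms at
  \<open>state m'\<close> is the right-hand side of an equation for the difference of the states.
\<close>
lemma state_perturbation:
  assumes m': "coercive c' m'" and c': "c' > 0"
  shows "state m' - state m = - resolvent m (blinfun_apply (m' - m) (fst (state m')))"
proof -
  have V: "state m - state m' \<in> V"
    using subspace_diff[OF subspace_V state_diff_in dirichlet_form.state_diff_in[OF dirichlet_form_axioms m' c', of zb]] by simp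
  have "resolvent m (blinfun_apply (m' - m) (fst (state m'))) = state m - state m'"
  proof (rule resolvent_eqI[OF V])
    fix v assume v: "v \<in> V"
    have "energy m' (state m') v = 0"
      by (rule dirichlet_form.energy_state[OF dirichlet_form_axioms m' c' v])
    then show "energy m (state m - state m') v = blinfun_apply (m' - m) (fst (state m')) \<bullet> fst v"
      using energy_state[OF v] energy_diff_operator[of m' "state m'" v m] by (simp add: energy_simps)
  qed
  then show ?thesis by simp
qed

lemma state_diff_bound:
  assumes m': "coercive c' m'" and c': "c' > 0"
  shows "norm (state m' - state m) \<le> norm (m' - m) * norm (fst (state m')) / c"
proof -
  have "norm (state m' - state m) \<le> norm (blinfun_apply (m' - m) (fst (state m'))) / c"
    unfolding state_perturbation[OF m' c'] by (simp add: norm_resolvent)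
  also have "\<dots> \<le> norm (m' - m) * norm (fst (state m')) / c"
    using c by (intro divide_right_mono norm_blinfun) auto
  finally show ?thesis .
qed

end

text \<open>
  With \<open>k = m' - m\<close>, states \<open>u\<close>, \<open>u'\<close> and resolvent \<open>R\<close>, the relation \<open>u' - u = - R (k u')\<close> turns
  the remainder into \<open>k (u' - u) - m (R (k (u' - u)))\<close>. It is quadratic in \<open>k\<close> because \<open>u' - u\<close> is of
  the order of \<open>k\<close>. For \<open>\<parallel>k\<parallel> \<le> c / 2\<close> the norm of \<open>u'\<close> on the right-hand side can be absorbed, which
  leaves a constant that depends on \<open>m\<close> and \<open>c\<close> only.
\<close>
lemma data_op_remainder:
  assumes m: "coercive c m" "c > 0" and m': "coercive c' m'" "c' > 0"
    and small: "norm (m' - m) \<le> c / 2"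
  shows "norm (data_op m' - data_op m - data_op' m (m' - m)) \<le>
    (1 + norm m / c) * (2 * norm (fst (state m)) / c) * (norm (m' - m))\<^sup>2"
proof -
  define k u u' where "k = m' - m" and "u = fst (state m)" and "u' = fst (state m')"
  have m'k: "blinfun_apply m' x = blinfun_apply m x + blinfun_apply k x" for x
    by (simp add: k_def blinfun.diff_left)
  have lin: "linear (resolvent m)" using bounded_linear_resolvent[OF m] by (rule bounded_linear.linear)
  have diff: "u' - u = - fst (resolvent m (blinfun_apply k u'))"
    using arg_cong[OF state_perturbation[OF m m'], of fst] by (simp add: k_def u_def u'_def)
  have "norm (u' - u) \<le> norm (state m' - state m)"
    using norm_fst_le_norm[of "state m' - state m"] by (simp add: u_def u'_def)
  then have du: "norm (u' - u) \<le> norm k * norm u' / c"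
    using state_diff_bound[OF m m'] by (simp add: k_def u_def u'_def)
  have "norm k * norm u' / c \<le> (c / 2) * norm u' / c"
    using small m by (intro divide_right_mono mult_right_mono) (auto simp: k_def)
  moreover have "(c / 2) * norm u' / c = norm u' / 2" using m by simp
  ultimately have "norm (u' - u) \<le> norm u' / 2" using du by linarith
  moreover have "norm u' \<le> norm u + norm (u' - u)" using norm_triangle_ineq[of u "u' - u"] by simp
  ultimately have u': "norm u' \<le> 2 * norm u" by simp
  have "norm (u' - u) \<le> norm k * (2 * norm u) / c"
    by (rule order_trans[OF du]) (use u' m in \<open>intro divide_right_mono mult_left_mono, auto\<close>)
  then have ku: "norm (blinfun_apply k (u' - u)) \<le> norm k * (norm k * (2 * norm u) / c)"
    by (intro order_trans[OF norm_blinfun] mult_left_mono) auto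
  have m_diff: "blinfun_apply m (u' - u) = - blinfun_apply m (fst (resolvent m (blinfun_apply k u')))"
    unfolding diff by (rule blinfun.minus_right)
  have res_diff: "fst (resolvent m (blinfun_apply k (u' - u))) =
      fst (resolvent m (blinfun_apply k u')) - fst (resolvent m (blinfun_apply k u))"
    by (simp add: blinfun.diff_right linear_diff[OF lin])
  have "data_op m' - data_op m - data_op' m k =
      blinfun_apply k (u' - u) + blinfun_apply m (u' - u) + blinfun_apply m (fst (resolvent m (blinfun_apply k u)))"
    by (simp add: data_op_def data_op'_def m'k u_def[symmetric] u'_def[symmetric] blinfun.diff_right)
  also have "\<dots> = blinfun_apply k (u' - u) - blinfun_apply m (fst (resolvent m (blinfun_apply k (u' - u))))"
    unfolding res_diff m_diff by (simp add: blinfun.diff_right)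
  finally have "norm (data_op m' - data_op m - data_op' m k) \<le>
      norm (blinfun_apply k (u' - u)) + norm (blinfun_apply m (fst (resolvent m (blinfun_apply k (u' - u)))))"
    by (simp add: norm_triangle_ineq4)
  also have "\<dots> \<le> norm (blinfun_apply k (u' - u)) + norm m * (norm (blinfun_apply k (u' - u)) / c)"
    by (intro add_left_mono order_trans[OF norm_blinfun] mult_left_mono
        order_trans[OF norm_fst_le_norm] norm_resolvent[OF m]) auto
  also have "\<dots> = (1 + norm m / c) * norm (blinfun_apply k (u' - u))" by (simp add: algebra_simps)
  also have "\<dots> \<le> (1 + norm m / c) * (norm k * (norm k * (2 * norm u) / c))"
    using m by (intro mult_left_mono ku) auto
  finally show ?thesis by (simp add: k_def u_def power2_eq_square algebra_simps)
qed

lemma data_op_has_derivative: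
  assumes m: "coercive c m" "c > 0"
  shows "(data_op has_derivative data_op' m) (at m within {m. \<exists>c>0. coercive c m})"
  unfolding has_derivative_within_alt
proof (intro conjI allI impI)
  show "bounded_linear (data_op' m)" by (rule bounded_linear_data_op'[OF m])
  fix e :: real assume e: "e > 0"
  \<comment> \<open>The remainder is at most \<open>K\<close> times the square of the increment, which must also satisfy the smallness
    condition \<open>c / 2\<close>; dividing by \<open>K + 1\<close> covers \<open>K = 0\<close>.\<close>
  define K where "K = (1 + norm m / c) * (2 * norm (fst (state m)) / c)"
  have K: "K \<ge> 0" unfolding K_def using m by auto
  define d where "d = min (c / 2) (e / (K + 1))"
  have "d > 0" unfolding d_def using m e K by auto
  moreover have "norm (data_op y - data_op m - data_op' m (y - m)) \<le> e * norm (y - m)"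
    if y: "y \<in> {m. \<exists>c>0. coercive c m}" "norm (y - m) < d" for y
  proof -
    have "norm (data_op y - data_op m - data_op' m (y - m)) \<le> K * (norm (y - m))\<^sup>2"
    proof -
      obtain c' where "coercive c' y" "c' > 0" using y by blast
      then show ?thesis unfolding K_def using y(2) by (intro data_op_remainder[OF m]) (auto simp: d_def)
    qed
    also have "\<dots> = (K * norm (y - m)) * norm (y - m)" by (simp add: power2_eq_square)
    also have "\<dots> \<le> e * norm (y - m)"
    proof (rule mult_right_mono)
      have "K * norm (y - m) \<le> (K + 1) * norm (y - m)" by (simp add: algebra_simps)
      also have "\<dots> \<le> e" using y(2) K by (simp add: d_def field_simps)
      finally show "K * norm (y - m) \<le> e" .
    qed auto
    finally show ?thesis .
  qed
  ultimately show "\<exists>d>0. \<forall>y\<in>{m. \<exists>c>0. coercive c m}. norm (y - m) < d \<longrightarrow>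
      norm (data_op y - data_op m - data_op' m (y - m)) \<le> e * norm (y - m)" by blast
qed

lemma coercive_limit:
  assumes "\<And>n. coercive c (m n)" "m \<longlonglongrightarrow> l"
  shows "coercive c l"
  unfolding coercive_def
proof (intro conjI allI ballI)
  have app: "(\<lambda>n. blinfun_apply (m n) f) \<longlonglongrightarrow> blinfun_apply l f" for f
    using assms(2) by (intro blinfun.tendsto tendsto_const)
  show "blinfun_apply l f \<bullet> g = f \<bullet> blinfun_apply l g" for f g
  proof (rule LIMSEQ_unique)
    show "(\<lambda>n. blinfun_apply (m n) f \<bullet> g) \<longlonglongrightarrow> blinfun_apply l f \<bullet> g" by (intro tendsto_intros app)
    have "(\<lambda>n. f \<bullet> blinfun_apply (m n) g) \<longlonglongrightarrow> f \<bullet> blinfun_apply l g" by (intro tendsto_intros app)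
    then show "(\<lambda>n. blinfun_apply (m n) f \<bullet> g) \<longlonglongrightarrow> f \<bullet> blinfun_apply l g"
      using assms(1) by (simp add: coercive_def)
  qed
  fix z assume z: "z \<in> V"
  show "c * (norm z)\<^sup>2 \<le> energy l z z"
  proof (rule LIMSEQ_le_const)
    show "(\<lambda>n. energy (m n) z z) \<longlonglongrightarrow> energy l z z"
      unfolding energy_def by (intro tendsto_intros app)
    show "\<exists>N. \<forall>n\<ge>N. c * (norm z)\<^sup>2 \<le> energy (m n) z z" using assms(1) z by (auto simp: coercive_def)
  qed
qed

text \<open>
  Joint continuity of the derivative in coefficient and direction. Each resolvent difference solves an
  equation with coefficient \<open>m n\<close>, for which the bound \<open>1 / c\<close> is uniform in \<open>n\<close>.
\<close>
lemma data_op'_tendsto: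
  assumes m: "\<And>n. coercive c (m n)" "c > 0" and lim: "m \<longlonglongrightarrow> l" "k \<longlonglongrightarrow> h"
  shows "(\<lambda>n. data_op' (m n) (k n)) \<longlonglongrightarrow> data_op' l h"
proof -
  have l: "coercive c l" using m(1) lim(1) by (rule coercive_limit)
  have nz: "(\<lambda>n. norm (m n - l)) \<longlonglongrightarrow> 0" using lim(1) by (simp add: LIM_zero tendsto_norm_zero)
  have state: "(\<lambda>n. state (m n)) \<longlonglongrightarrow> state l"
  proof (rule LIM_zero_cancel, rule Lim_null_comparison)
    have "norm (state l - state (m n)) \<le> norm (l - m n) * norm (fst (state l)) / c" for n
      by (rule state_diff_bound[OF m(1) m(2) l m(2)])
    then show "\<forall>\<^sub>F n in sequentially. norm (state (m n) - state l) \<le> norm (m n - l) * norm (fst (state l)) / c"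
      by (simp add: norm_minus_commute)
    show "(\<lambda>n. norm (m n - l) * norm (fst (state l)) / c) \<longlonglongrightarrow> 0"
      using tendsto_mult_left_zero[OF nz, of "norm (fst (state l)) / c"] by simp
  qed
  have res: "(\<lambda>n. resolvent (m n) (f n)) \<longlonglongrightarrow> resolvent l g" if f: "f \<longlonglongrightarrow> g" for f g
  proof (rule LIM_zero_cancel, rule Lim_null_comparison)
    have "norm (resolvent (m n) (f n) - resolvent l g) \<le>
        (norm (f n - g) + norm (m n - l) * norm (resolvent l g)) / c" for n
    proof -
      have "resolvent (m n) ((f n - g) - blinfun_apply (m n - l) (fst (resolvent l g))) =
          resolvent (m n) (f n) - resolvent l g"
      proof (rule resolvent_eqI[OF m])
        show "resolvent (m n) (f n) - resolvent l g \<in> V"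
          using resolvent_in[OF m] resolvent_in[OF l m(2)] subspace_V by (simp add: subspace_diff)
        fix v assume v: "v \<in> V"
        show "energy (m n) (resolvent (m n) (f n) - resolvent l g) v =
            (f n - g - blinfun_apply (m n - l) (fst (resolvent l g))) \<bullet> fst v"
          using energy_resolvent[OF m v] energy_resolvent[OF l m(2) v, of g]
            energy_diff_operator[of "m n" "resolvent l g" v l]
          by (simp add: energy_simps inner_diff_left)
      qed
      then have "norm (resolvent (m n) (f n) - resolvent l g) \<le>
          norm ((f n - g) - blinfun_apply (m n - l) (fst (resolvent l g))) / c"
        using norm_resolvent[OF m] by metis
      also have "\<dots> \<le> (norm (f n - g) + norm (m n - l) * norm (resolvent l g)) / c"
      proof (rule divide_right_mono)
        have "norm (blinfun_apply (m n - l) (fst (resolvent l g))) \<le> norm (m n - l) * norm (resolvent l g)"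
          by (intro order_trans[OF norm_blinfun] mult_left_mono norm_fst_le_norm) auto
        then show "norm ((f n - g) - blinfun_apply (m n - l) (fst (resolvent l g))) \<le>
            norm (f n - g) + norm (m n - l) * norm (resolvent l g)"
          using norm_triangle_ineq4[of "f n - g" "blinfun_apply (m n - l) (fst (resolvent l g))"] by linarith
      qed (use m in auto)
      finally show ?thesis .
    qed
    then show "\<forall>\<^sub>F n in sequentially. norm (resolvent (m n) (f n) - resolvent l g) \<le>
        (norm (f n - g) + norm (m n - l) * norm (resolvent l g)) / c" by simp
    have "(\<lambda>n. norm (f n - g)) \<longlonglongrightarrow> 0" using f by (simp add: LIM_zero tendsto_norm_zero)
    then have "(\<lambda>n. (norm (f n - g) + norm (m n - l) * norm (resolvent l g)) / c) \<longlonglongrightarrow> (0 + 0 * norm (resolvent l g)) / c"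
      using m(2) by (intro tendsto_intros nz) auto
    then show "(\<lambda>n. (norm (f n - g) + norm (m n - l) * norm (resolvent l g)) / c) \<longlonglongrightarrow> 0" by simp
  qed
  have ks: "(\<lambda>n. blinfun_apply (k n) (fst (state (m n)))) \<longlonglongrightarrow> blinfun_apply h (fst (state l))"
    by (intro blinfun.tendsto lim tendsto_fst state)
  show ?thesis unfolding data_op'_def
    by (intro tendsto_diff ks blinfun.tendsto lim tendsto_fst res)
qed

end

section \<open>Smooth test functions\<close>

lemma frechet_derivative_eq: "(f has_derivative D) (at x) \<Longrightarrow> frechet_derivative f (at x) = D"
  using frechet_derivative_at by metis

lemma Ck_SucI:
  assumes "\<And>x. (f has_derivative D x) (at x)" "\<And>i. i \<in> Basis \<Longrightarrow> Ck k (\<lambda>x. D x i)"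
  shows "Ck (Suc k) f"
  using assms by (auto simp: frechet_derivative_eq[OF assms(1)] differentiable_def)

lemma Ck_Suc_has_derivative:
  "Ck (Suc k) f \<Longrightarrow> (f has_derivative frechet_derivative f (at x)) (at x)"
  by (simp add: frechet_derivative_works[symmetric])

lemma Ck_Suc_imp_Ck: "Ck (Suc k) f \<Longrightarrow> Ck k f"
proof (induction k arbitrary: f)
  case 0
  then show ?case
    by (auto intro!: differentiable_imp_continuous_on simp: differentiable_on_def)
next
  case (Suc k)
  then show ?case using Ck.simps(2) by blast
qed

lemma Ck_const: "Ck k (\<lambda>x. c)"
proof (induction k arbitrary: c)
  case (Suc k)
  show ?case by (rule Ck_SucI[where D = "\<lambda>x h. 0"]) (auto intro: Suc)
qed auto

lemma Ck_add: "Ck k f \<Longrightarrow> Ck k g \<Longrightarrow> Ck k (\<lambda>x. f x + g x)"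
proof (induction k arbitrary: f g)
  case 0
  then show ?case by (auto intro: continuous_intros)
next
  case (Suc k)
  note fg = Suc.prems[THEN Ck_Suc_has_derivative]
  show ?case
    by (rule Ck_SucI[OF has_derivative_add[OF fg]]) (use Suc in auto)
qed

lemma Ck_mult: "Ck k f \<Longrightarrow> Ck k g \<Longrightarrow> Ck k (\<lambda>x. f x * g x)"
proof (induction k arbitrary: f g)
  case 0
  then show ?case by (auto intro: continuous_intros)
next
  case (Suc k)
  note fg = Suc.prems[THEN Ck_Suc_has_derivative]
  show ?case
    by (rule Ck_SucI[OF has_derivative_mult[OF fg]])
      (use Suc Suc.prems[THEN Ck_Suc_imp_Ck] in \<open>auto intro!: Ck_add\<close>)
qed

lemma Ck_prod: "(\<And>i. i \<in> I \<Longrightarrow> Ck k (f i)) \<Longrightarrow> Ck k (\<lambda>x. \<Prod>i\<in>I. f i x)"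
  by (induction I rule: infinite_finite_induct) (auto intro: Ck_const Ck_mult)

text \<open>
  The functions \<open>p (1 / t) * exp (- 1 / t)\<close> for polynomials \<open>p\<close>. This class is closed under
  differentiation, so all derivatives are treated at once.
\<close>
definition flat :: "real poly \<Rightarrow> real \<Rightarrow> real" where
  "flat p t = (if t > 0 then poly p (1 / t) * exp (- 1 / t) else 0)"

lemma poly_over_exp_tendsto_0: "((\<lambda>s. poly p s / exp s) \<longlongrightarrow> (0::real)) at_top"
proof -
  have "((\<lambda>s. \<Sum>i\<le>degree p. coeff p i * (s ^ i / exp s)) \<longlongrightarrow> (\<Sum>i\<le>degree p. coeff p i * 0)) at_top"
    by (intro tendsto_intros tendsto_power_div_exp_0)
  then show ?thesis by (simp add: poly_altdef sum_divide_distrib)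
qed

lemma flat_has_real_derivative:
  "(flat p has_real_derivative flat ([:0, 0, 1:] * (p - pderiv p)) t) (at t)"
proof -
  consider "t > 0" | "t < 0" | "t = 0" by linarith
  then show ?thesis
  proof cases
    case 1
    have "((\<lambda>t. poly p (1 / t) * exp (- 1 / t)) has_real_derivative
        flat ([:0, 0, 1:] * (p - pderiv p)) t) (at t)"
      using 1 by (auto intro!: derivative_eq_intros poly_DERIV[THEN DERIV_chain2] simp: flat_def field_simps power2_eq_square)
    then show ?thesis
      by (rule has_field_derivative_transform_within_open[of _ _ _ "{0<..}"]) (use 1 in \<open>auto simp: flat_def\<close>)
  next
    case 2
    have "((\<lambda>t. 0) has_real_derivative flat ([:0, 0, 1:] * (p - pderiv p)) t) (at t)"
      using 2 by (auto simp: flat_def)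
    then show ?thesis
      by (rule has_field_derivative_transform_within_open[of _ _ _ "{..<0}"]) (use 2 in \<open>auto simp: flat_def\<close>)
  next
    case 3
    have "((\<lambda>h. flat p h / h) \<longlongrightarrow> 0) (at 0)"
    proof (rule filterlim_split_at)
      have "((\<lambda>h. flat p h / h) \<longlongrightarrow> 0) (at_left 0) \<longleftrightarrow> ((\<lambda>h. 0 :: real) \<longlongrightarrow> 0) (at_left (0::real))"
        by (rule tendsto_cong) (auto simp: eventually_at_filter flat_def)
      then show "((\<lambda>h. flat p h / h) \<longlongrightarrow> 0) (at_left 0)" by simp
      have "((\<lambda>h. poly ([:0, 1:] * p) (inverse h) / exp (inverse h)) \<longlongrightarrow> 0) (at_right (0::real))"
        by (rule filterlim_compose[OF poly_over_exp_tendsto_0 filterlim_inverse_at_top_right])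
      moreover have "((\<lambda>h. flat p h / h) \<longlongrightarrow> 0) (at_right 0) \<longleftrightarrow>
        ((\<lambda>h. poly ([:0, 1:] * p) (inverse h) / exp (inverse h)) \<longlongrightarrow> 0) (at_right (0::real))"
        by (rule tendsto_cong) (auto simp: eventually_at_filter flat_def exp_minus field_simps)
      ultimately show "((\<lambda>h. flat p h / h) \<longlongrightarrow> 0) (at_right 0)" by simp
    qed
    then show ?thesis using 3 by (simp add: DERIV_def flat_def)
  qed
qed

lemma Ck_flat_affine: "Ck k (\<lambda>x. flat p (x \<bullet> v + c))"
proof (induction k arbitrary: p)
  case 0
  have "isCont (flat p) t" for t using flat_has_real_derivative by (rule DERIV_isCont)
  then have "continuous_on UNIV (flat p)" by (simp add: continuous_at_imp_continuous_on)
  then show ?case by (auto intro!: continuous_intros continuous_on_compose2[of UNIV "flat p"])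
next
  case (Suc k)
  have "((\<lambda>x. flat p (x \<bullet> v + c)) has_derivative
      (\<lambda>h. flat ([:0, 0, 1:] * (p - pderiv p)) (x \<bullet> v + c) * (h \<bullet> v))) (at x)" for x
    by (rule has_derivative_compose[OF _ flat_has_real_derivative[unfolded has_field_derivative_def], THEN has_derivative_eq_rhs])
       (auto intro!: derivative_eq_intros)
  then show ?case by (rule Ck_SucI) (intro Ck_mult Suc Ck_const)
qed

text \<open>
  Smooth approximations of the indicator function of a box: \<open>flat 1 (s * t) = exp (- 1 / (s * t))\<close>
  tends to \<open>1\<close> as \<open>s\<close> grows, for every \<open>t > 0\<close>. The scale is \<open>Suc n\<close> to be positive.
\<close>
definition box_bump :: "nat \<Rightarrow> 'a::euclidean_space \<Rightarrow> 'a \<Rightarrow> 'a \<Rightarrow> real" where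
  "box_bump n a b x = (\<Prod>i\<in>Basis. flat 1 (x \<bullet> (real (Suc n) *\<^sub>R i) + - real (Suc n) * (a \<bullet> i)) *
     flat 1 (x \<bullet> (- real (Suc n) *\<^sub>R i) + real (Suc n) * (b \<bullet> i)))"

lemma flat_one: "0 \<le> flat 1 t" "flat 1 t \<le> 1" "t \<le> 0 \<Longrightarrow> flat 1 t = 0"
  by (auto simp: flat_def)

lemma box_bump_bounds: "0 \<le> box_bump n a b x" "box_bump n a b x \<le> 1"
  unfolding box_bump_def by (auto intro!: prod_nonneg prod_le_1 mult_nonneg_nonneg mult_le_one flat_one)

lemma box_bump_outside:
  assumes "x \<notin> box a b"
  shows "box_bump n a b x = 0"
proof -
  obtain i where i: "i \<in> Basis" "x \<bullet> i \<le> a \<bullet> i \<or> b \<bullet> i \<le> x \<bullet> i"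
    using assms by (auto simp: mem_box not_less)
  then have "flat 1 (x \<bullet> (real (Suc n) *\<^sub>R i) + - real (Suc n) * (a \<bullet> i)) *
     flat 1 (x \<bullet> (- real (Suc n) *\<^sub>R i) + real (Suc n) * (b \<bullet> i)) = 0"
  proof (elim disjE)
    assume "x \<bullet> i \<le> a \<bullet> i"
    then have "real (Suc n) * (x \<bullet> i) \<le> real (Suc n) * (a \<bullet> i)" by (intro mult_left_mono) auto
    then show ?thesis by (subst flat_one(3)) (auto simp: algebra_simps)
  next
    assume "b \<bullet> i \<le> x \<bullet> i"
    then have "real (Suc n) * (b \<bullet> i) \<le> real (Suc n) * (x \<bullet> i)" by (intro mult_left_mono) auto
    then show ?thesis by (subst (2) flat_one(3)) (auto simp: algebra_simps)
  qed
  then show ?thesis unfolding box_bump_def using i by (intro prod_zero) auto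
qed

lemma box_bump_tendsto: "(\<lambda>n. box_bump n a b x) \<longlonglongrightarrow> indicator (box a b) x"
proof (cases "x \<in> box a b")
  case True
  have flat: "(\<lambda>n. flat 1 (real (Suc n) * s)) \<longlonglongrightarrow> 1" if "s > 0" for s :: real
  proof -
    have "(\<lambda>n. exp (- (1 / s) * (1 / real (Suc n)))) \<longlonglongrightarrow> exp (- (1 / s) * 0)"
      by (intro tendsto_intros LIMSEQ_Suc[OF lim_inverse_n'])
    then show ?thesis using that by (simp add: flat_def mult.commute)
  qed
  have "(\<lambda>n. \<Prod>i\<in>Basis. flat 1 (real (Suc n) * (x \<bullet> i - a \<bullet> i)) * flat 1 (real (Suc n) * (b \<bullet> i - x \<bullet> i)))
     \<longlonglongrightarrow> (\<Prod>i\<in>(Basis::'a set). 1 * 1)"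
    using True by (intro tendsto_intros flat) (auto simp: mem_box)
  then show ?thesis using True by (simp add: box_bump_def algebra_simps)
qed (simp add: box_bump_outside)

lemma box_bump_test_function:
  assumes "cbox a b \<subseteq> \<Omega>"
  shows "box_bump n a b \<in> test_functions \<Omega>"
proof -
  have "{x. box_bump n a b x \<noteq> 0} \<subseteq> cbox a b" using box_bump_outside box_subset_cbox by blast
  then have "closure {x. box_bump n a b x \<noteq> 0} \<subseteq> cbox a b" by (intro closure_minimal closed_cbox)
  moreover have "Ck k (box_bump n a b)" for k
    unfolding box_bump_def[abs_def] by (intro Ck_prod Ck_mult Ck_flat_affine)
  ultimately show ?thesis using assms compact_cbox[of a b]
    by (auto simp: test_functions_def compact_eq_bounded_closed intro: bounded_subset[of "cbox a b"])
qed

text \<open>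
  Boxes generate the Borel sets and are stable under intersection, and the Borel sets over which \<open>g\<close> has
  integral zero form a Dynkin system, since the whole space is one of them.
\<close>
lemma AE_zero_of_box_integrals_zero:
  fixes g :: "'a::euclidean_space \<Rightarrow> real"
  assumes g: "integrable lebesgue g" and total: "(LINT x|lebesgue. g x) = 0"
    and box: "\<And>a b. (LINT x|lebesgue. indicator (box a b) x * g x) = 0"
  shows "AE x in lebesgue. g x = 0"
proof -
  obtain g' where g': "g' \<in> borel_measurable lborel" and gg': "AE x in lborel. g x = g' x"
    using completion_ex_borel_measurable_real[of g lborel] g by auto
  have gg'': "AE x in lebesgue. g x = g' x" using gg' by (rule AE_completion)
  have "integrable lebesgue g'"
    using g g' gg'' by (subst integrable_cong_AE[where g = g]) (auto simp: measurable_completion)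
  then have int: "integrable lborel g'" using g' by (simp add: integrable_completion)
  have conv: "(LINT x|lborel. indicator A x * g' x) = (LINT x|lebesgue. indicator A x * g x)"
    if "A \<in> sets borel" for A
  proof -
    have [measurable]: "A \<in> sets lborel" "A \<in> sets lebesgue" "g' \<in> borel_measurable lborel"
      "g' \<in> borel_measurable lebesgue" "g \<in> borel_measurable lebesgue"
      using that g' g by (auto simp: measurable_completion)
    have "(LINT x|lborel. indicator A x * g' x) = (LINT x|lebesgue. indicator A x * g' x)"
      by (rule integral_completion[symmetric]) measurable
    also have "\<dots> = (LINT x|lebesgue. indicator A x * g x)"
      by (rule integral_cong_AE) (use gg'' in auto)
    finally show ?thesis .
  qed
  have int': "integrable lborel (\<lambda>x. indicator A x * g' x)" if "A \<in> sets borel" for A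
    using integrable_mult_indicator[of A lborel g'] int that by simp
  have "(LINT x|lborel. indicator A x * g' x) = 0" if "A \<in> sigma_sets UNIV (range (\<lambda>(a, b). box a b))" for A
  proof -
    have borelI: "A \<in> sets borel" if "A \<in> sigma_sets UNIV (range (\<lambda>(a, b). box a b))" for A :: "'a set"
      using that by (simp add: borel_eq_box)
    have "Int_stable (range (\<lambda>(a, b). box a b :: 'a set))"
      by (auto simp: Int_stable_def box_Int_box)
    moreover have "range (\<lambda>(a, b). box a b :: 'a set) \<subseteq> Pow UNIV" by simp
    ultimately show ?thesis
using that
    proof (induction rule: sigma_sets_induct_disjoint)
      case (basic A)
      then show ?case using box conv by auto
    next
      case (compl A)
      have "(LINT x|lborel. indicator (UNIV - A) x * g' x) = (LINT x|lborel. indicator UNIV x * g' x - indicator A x * g' x)"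
        by (intro Bochner_Integration.integral_cong) (auto simp: indicator_def)
      also have "\<dots> = (LINT x|lborel. indicator UNIV x * g' x) - (LINT x|lborel. indicator A x * g' x)"
        using borelI[OF compl(1)] by (intro Bochner_Integration.integral_diff int') auto
      also have "\<dots> = 0" using compl total conv[of UNIV] by simp
      finally show ?case .
    next
      case (union A)
      have A: "A i \<in> sets borel" for i using union by (auto intro: borelI)
      have "(LINT x:(\<Union>i. A i)|lborel. g' x) = (\<Sum>i. (LINT x:(A i)|lborel. g' x))"
        using A union int' by (intro lebesgue_integral_countable_add)
          (auto simp: disjoint_family_on_def set_integrable_def)
      then show ?case using union by (simp add: set_lebesgue_integral_def)
    qed auto
  qed
  then have "set_lebesgue_integral lborel A g' = 0" if "A \<in> sets lborel" for A
    using that by (simp add: borel_eq_box set_lebesgue_integral_def)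
  with int have "AE x in lborel. g' x = 0" by (rule sigma_finite_measure.density_zero[OF sigma_finite_lborel])
  then have "AE x in lebesgue. g' x = 0" by (rule AE_completion)
  with gg'' show ?thesis by eventually_elim simp
qed

text \<open>
  The fundamental lemma of the calculus of variations. Bumps with support in a closed box contained in
  \<open>\<Omega>\<close> converge boundedly to its indicator function, so \<open>f\<close> has integral zero over each open box whose
  closure lies in \<open>\<Omega>\<close>. Countably many such closed boxes cover \<open>\<Omega>\<close>.
\<close>
lemma AE_zero_of_test_integrals_zero:
  fixes f :: "'a::euclidean_space \<Rightarrow> real"
  assumes \<Omega>: "open \<Omega>" and f: "integrable lebesgue f"
    and test: "\<And>\<eta>. \<eta> \<in> test_functions \<Omega> \<Longrightarrow> (LINT x|lebesgue. f x * \<eta> x) = 0"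
  shows "AE x in lebesgue. x \<in> \<Omega> \<longrightarrow> f x = 0"
proof -
  have [measurable]: "f \<in> borel_measurable lebesgue" using f by simp
  have box: "(LINT x|lebesgue. indicator (box a b) x * f x) = 0" if ab: "cbox a b \<subseteq> \<Omega>" for a b
  proof -
    have bm: "box_bump n a b \<in> borel_measurable lebesgue" for n
    proof -
      have "continuous_on UNIV (box_bump n a b)"
        using box_bump_test_function[OF ab] by (metis (mono_tags, lifting) Ck.simps(1) mem_Collect_eq test_functions_def)
      then show ?thesis by (simp add: borel_measurable_continuous_onI measurable_completion)
    qed
    have "(\<lambda>n. LINT x|lebesgue. f x * box_bump n a b x) \<longlonglongrightarrow> (LINT x|lebesgue. indicator (box a b) x * f x)"
    proof (rule integral_dominated_convergence[where w = "\<lambda>x. norm (f x)"])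
      show "AE x in lebesgue. (\<lambda>n. f x * box_bump n a b x) \<longlonglongrightarrow> indicator (box a b) x * f x"
        by (intro AE_I2) (subst mult.commute, intro tendsto_intros box_bump_tendsto)
      show "AE x in lebesgue. norm (f x * box_bump n a b x) \<le> norm (f x)" for n
        using box_bump_bounds[of n a b] by (auto simp: abs_mult intro!: mult_left_le)
      show "(\<lambda>x. indicator (box a b) x * f x) \<in> borel_measurable lebesgue"
        by (intro borel_measurable_times borel_measurable_indicator) auto
    qed (use f bm in auto)
    moreover have "(LINT x|lebesgue. f x * box_bump n a b x) = 0" for n
      by (rule test[OF box_bump_test_function[OF ab]])
    ultimately show ?thesis by (simp add: LIMSEQ_const_iff)
  qed
  have cb: "AE x in lebesgue. x \<in> cbox a b \<longrightarrow> f x = 0" if ab: "cbox a b \<subseteq> \<Omega>" for a b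
  proof -
    define g where "g x = indicator (box a b) x * f x" for x
    have "integrable lebesgue g" unfolding g_def
      using integrable_mult_indicator[of "box a b" lebesgue f] f by simp
    moreover have "(LINT x|lebesgue. g x) = 0" unfolding g_def by (rule box[OF ab])
    moreover have "(LINT x|lebesgue. indicator (box c d) x * g x) = 0" for c d
    proof -
      obtain c' d' where cd: "box c d \<inter> box a b = box c' d'" using that[OF box_Int_box] .
      have "indicator (box c d) x * g x = indicator (box c' d') x * f x" for x
        by (simp add: g_def cd[symmetric] indicator_inter_arith)
      moreover have "(LINT x|lebesgue. indicator (box c' d') x * f x) = 0"
      proof (cases "box c' d' = {}")
        case False
        have "cbox c' d' = closure (box c' d')" using False by (simp add: closure_box)
        also have "\<dots> \<subseteq> cbox a b"
          using cd box_subset_cbox[of a b] by (intro closure_minimal closed_cbox) auto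
        finally have "cbox c' d' \<subseteq> cbox a b" .
        then show ?thesis using ab box by blast
      qed simp
      ultimately show ?thesis by simp
    qed
    ultimately have "AE x in lebesgue. g x = 0" by (rule AE_zero_of_box_integrals_zero)
    moreover have "AE x in lebesgue. x \<notin> cbox a b - box a b"
      using negligible_frontier_interval[of a b] by (intro AE_not_in) (simp add: negligible_iff_null_sets)
    ultimately show ?thesis by eventually_elim (auto simp: g_def)
  qed
  obtain D where D: "countable D" "D \<subseteq> Pow \<Omega>" "\<And>X. X \<in> D \<Longrightarrow> \<exists>a b. X = cbox a b" "\<Union>D = \<Omega>"
    by (rule open_countable_Union_open_cbox[OF \<Omega>]) blast
  have "AE x in lebesgue. \<forall>X\<in>D. x \<in> X \<longrightarrow> f x = 0"
    unfolding AE_ball_countable[OF D(1)]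
  proof
    fix X assume X: "X \<in> D"
    obtain a b where "X = cbox a b" using D(3)[OF X] by blast
    moreover have "X \<subseteq> \<Omega>" using D(2) X by blast
    ultimately show "AE x in lebesgue. x \<in> X \<longrightarrow> f x = 0" using cb by blast
  qed
  then show ?thesis by eventually_elim (use D(4) in auto)
qed

text \<open>
  Difference quotients have integral zero by translation invariance of the Lebesgue measure. By the mean
  value theorem they are bounded by \<open>M\<close>, and they vanish off a fixed ball, so the limit may be taken
  under the integral. Applied to products, this is integration by parts.
\<close>
lemma integral_directional_derivative_zero:
  fixes f :: "'a::euclidean_space \<Rightarrow> real"
  assumes f: "\<And>x. (f has_derivative D x) (at x)" and bd: "\<And>x. \<bar>D x i\<bar> \<le> M"
    and supp: "bounded {x. f x \<noteq> 0}"
  shows "(LINT x|lebesgue. D x i) = 0"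
proof -
  obtain R where R: "\<And>x. f x \<noteq> 0 \<Longrightarrow> norm x \<le> R" using supp by (auto simp: bounded_iff)
  have cont: "continuous_on UNIV f"
    by (intro continuous_at_imp_continuous_on ballI has_derivative_continuous[OF f])
  then have [measurable]: "f \<in> borel_measurable borel" by (rule borel_measurable_continuous_onI)
  have D1: "((\<lambda>t. f (x + t *\<^sub>R i)) has_real_derivative D (x + t *\<^sub>R i) i) (at t)" for x t
  proof -
    have "((\<lambda>t. f (x + t *\<^sub>R i)) has_derivative (\<lambda>h. D (x + t *\<^sub>R i) (h *\<^sub>R i))) (at t)"
      by (rule has_derivative_compose[OF _ f]) (auto intro!: derivative_eq_intros)
    moreover have "D (x + t *\<^sub>R i) (h *\<^sub>R i) = D (x + t *\<^sub>R i) i * h" for h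
      using has_derivative_linear[OF f[of "x + t *\<^sub>R i"]] by (simp add: linear_cmul)
    ultimately show ?thesis by (simp add: has_field_derivative_def)
  qed
  define t where "t n = 1 / real (Suc n)" for n
  have t: "t n > 0" "t n \<le> 1" for n by (auto simp: t_def)
  have t0: "t \<longlonglongrightarrow> 0" unfolding t_def by (rule LIMSEQ_Suc[OF lim_inverse_n'])
  define s where "s n x = (f (x + t n *\<^sub>R i) - f x) / t n" for n x
  have [measurable]: "s n \<in> borel_measurable borel" for n unfolding s_def by measurable
  have lim: "(\<lambda>n. s n x) \<longlonglongrightarrow> D x i" for x
  proof -
    have "((\<lambda>h. (f (x + h *\<^sub>R i) - f x) / h) \<longlongrightarrow> D x i) (at 0)"
      using D1[of x 0] by (simp add: DERIV_def)
    moreover have "filterlim t (at 0) sequentially"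
      using t0 t by (auto simp: filterlim_at less_imp_neq[symmetric] intro!: always_eventually)
    ultimately show ?thesis unfolding s_def by (rule filterlim_compose)
  qed
  have Dm [measurable]: "(\<lambda>x. D x i) \<in> borel_measurable borel"
    by (rule borel_measurable_LIMSEQ_real[OF lim]) measurable
  have M: "M \<ge> 0" using bd[of 0] by simp
  define w where "w x = M * indicator (cball (0::'a) (R + norm i)) x" for x
  have bound: "\<bar>s n x\<bar> \<le> w x" for n x
  proof (cases "norm x \<le> R + norm i")
    case True
    obtain z where "f (x + t n *\<^sub>R i) - f (x + 0 *\<^sub>R i) = (t n - 0) * D (x + z *\<^sub>R i) i"
      using MVT2[OF t(1)[of n], where f = "\<lambda>t. f (x + t *\<^sub>R i)" and f' = "\<lambda>t. D (x + t *\<^sub>R i) i"] D1 by blast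
    then have "s n x = D (x + z *\<^sub>R i) i" using t[of n] by (simp add: s_def)
    then show ?thesis using True bd by (simp add: w_def)
  next
    case False
    have "norm (t n *\<^sub>R i) \<le> norm i" using t[of n] by (simp add: mult_left_le_one_le)
    moreover have "norm x \<le> norm (x + t n *\<^sub>R i) + norm (t n *\<^sub>R i)"
      using norm_triangle_ineq4[of "x + t n *\<^sub>R i" "t n *\<^sub>R i"] by simp
    ultimately have "f (x + t n *\<^sub>R i) = 0" using R[of "x + t n *\<^sub>R i"] False by force
    moreover have "f x = 0" using R[of x] False norm_ge_zero[of i] by force
    ultimately show ?thesis using False by (simp add: s_def w_def)
  qed
  have w: "integrable lborel w" unfolding w_def
    by (intro integrable_mult_right integrable_real_indicator) (use emeasure_lborel_cball_finite in simp_all)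
  have trans: "(LINT x|lborel. f (x + c)) = (LINT x|lborel. f x)" for c
  proof -
    have "(LINT x|lborel. f x) = (LINT x|distr lborel borel ((+) c). f x)" by (simp add: lborel_distr_plus)
    also have "\<dots> = (LINT x|lborel. f (c + x))" by (rule integral_distr) auto
    finally show ?thesis by (simp add: add.commute)
  qed
  have fint: "integrable lborel f"
  proof -
    have "{x. f x \<noteq> 0} \<subseteq> cball 0 R" using R by auto
    then have eq: "(\<lambda>x. indicator (cball 0 R) x *\<^sub>R f x) = f" by (auto simp: indicator_def fun_eq_iff)
    have "integrable lborel (\<lambda>x. indicator (cball 0 R) x *\<^sub>R f x)"
      using borel_integrable_compact[of "cball 0 R" f] cont by (simp add: continuous_on_subset)
    then show ?thesis unfolding eq .
  qed
  have ftint: "integrable lborel (\<lambda>x. f (x + c))" for c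
  proof -
    have "integrable (distr lborel borel ((+) c)) f" using fint by (simp add: lborel_distr_plus)
    then have "integrable lborel (\<lambda>x. f (c + x))" by (subst (asm) integrable_distr_eq) auto
    then show ?thesis by (simp add: add.commute)
  qed
  have "(LINT x|lborel. s n x) = 0" for n
    unfolding s_def using fint ftint trans by simp
  moreover have "(\<lambda>n. LINT x|lborel. s n x) \<longlonglongrightarrow> (LINT x|lborel. D x i)"
    by (rule integral_dominated_convergence[where w = w]) (use w lim bound in auto)
  ultimately have "(LINT x|lborel. D x i) = 0" by (simp add: LIMSEQ_const_iff)
  moreover have "(LINT x|lebesgue. D x i) = (LINT x|lborel. D x i)" using Dm by (intro integral_completion) measurable
  ultimately show ?thesis by (simp only:)
qed

section \<open>Square-integrable functions as a Hilbert space\<close>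

definition square_integrable :: "('a::euclidean_space \<Rightarrow> 'b::euclidean_space) \<Rightarrow> bool" where
  "square_integrable f \<longleftrightarrow> f \<in> borel_measurable lebesgue \<and> integrable lebesgue (\<lambda>x. (norm (f x))\<^sup>2)"

lemma square_integrable_measurable [measurable_dest]:
  "square_integrable f \<Longrightarrow> f \<in> borel_measurable lebesgue"
  by (simp add: square_integrable_def)

lemma square_integrable_zero: "square_integrable (\<lambda>x. 0)"
  by (simp add: square_integrable_def)

lemma square_integrable_scaleR: "square_integrable f \<Longrightarrow> square_integrable (\<lambda>x. c *\<^sub>R f x)"
  by (auto simp: square_integrable_def power_mult_distrib)

lemma square_integrable_bound:
  assumes f: "square_integrable f" and g: "g \<in> borel_measurable lebesgue"
    and le: "AE x in lebesgue. norm (g x) \<le> c * norm (f x)"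
  shows "square_integrable g"
  unfolding square_integrable_def
proof
  have "integrable lebesgue (\<lambda>x. c\<^sup>2 * (norm (f x))\<^sup>2)" using f by (simp add: square_integrable_def)
  moreover have "AE x in lebesgue. norm ((norm (g x))\<^sup>2) \<le> norm (c\<^sup>2 * (norm (f x))\<^sup>2)"
    using le
  proof eventually_elim
    case (elim x)
    then have "(norm (g x))\<^sup>2 \<le> (c * norm (f x))\<^sup>2" by (intro power_mono) auto
    then show ?case by (simp add: power_mult_distrib)
  qed
  moreover have "(\<lambda>x. (norm (g x))\<^sup>2) \<in> borel_measurable lebesgue" using g by measurable
  ultimately show "integrable lebesgue (\<lambda>x. (norm (g x))\<^sup>2)"
    using Bochner_Integration.integrable_bound by blast
qed (rule g)

lemma square_integrable_add:
  assumes f: "square_integrable f" and g: "square_integrable g"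
  shows "square_integrable (\<lambda>x. f x + g x)"
  unfolding square_integrable_def
proof
  note [measurable] = f[THEN square_integrable_measurable] g[THEN square_integrable_measurable]
  show "(\<lambda>x. f x + g x) \<in> borel_measurable lebesgue" by measurable
  have "integrable lebesgue (\<lambda>x. 2 * (norm (f x))\<^sup>2 + 2 * (norm (g x))\<^sup>2)"
    using f g by (simp add: square_integrable_def)
  moreover have "(norm (f x + g x))\<^sup>2 \<le> 2 * (norm (f x))\<^sup>2 + 2 * (norm (g x))\<^sup>2" for x
  proof -
    have "(norm (f x + g x))\<^sup>2 \<le> (norm (f x) + norm (g x))\<^sup>2" by (intro power_mono norm_triangle_ineq) auto
    also have "\<dots> \<le> 2 * (norm (f x))\<^sup>2 + 2 * (norm (g x))\<^sup>2"
      using zero_le_power2[of "norm (f x) - norm (g x)"] by (simp add: power2_eq_square algebra_simps)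
    finally show ?thesis .
  qed
  moreover have "(\<lambda>x. (norm (f x + g x))\<^sup>2) \<in> borel_measurable lebesgue" by measurable
  ultimately show "integrable lebesgue (\<lambda>x. (norm (f x + g x))\<^sup>2)"
    by (elim Bochner_Integration.integrable_bound) auto
qed

lemma square_integrable_inner:
  assumes f: "square_integrable f" and g: "square_integrable g"
  shows "integrable lebesgue (\<lambda>x. f x \<bullet> g x)"
proof -
  note [measurable] = f[THEN square_integrable_measurable] g[THEN square_integrable_measurable]
  have "integrable lebesgue (\<lambda>x. (norm (f x))\<^sup>2 + (norm (g x))\<^sup>2)"
    using f g by (simp add: square_integrable_def)
  moreover have "(\<lambda>x. f x \<bullet> g x) \<in> borel_measurable lebesgue" by measurable
  moreover have "norm (f x \<bullet> g x) \<le> norm ((norm (f x))\<^sup>2 + (norm (g x))\<^sup>2)" for x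
  proof -
    have "2 * (norm (f x) * norm (g x)) \<le> (norm (f x))\<^sup>2 + (norm (g x))\<^sup>2"
      using zero_le_power2[of "norm (f x) - norm (g x)"] by (simp add: power2_eq_square algebra_simps)
    moreover have "\<bar>f x \<bullet> g x\<bar> \<le> norm (f x) * norm (g x)" by (rule Cauchy_Schwarz_ineq2)
    moreover have "0 \<le> norm (f x) * norm (g x)" by simp
    ultimately show ?thesis by simp
  qed
  ultimately show ?thesis
    by (elim Bochner_Integration.integrable_bound) auto
qed

text \<open>
  Square-integrable functions on the whole space modulo equality almost everywhere. As a type, this space
  can be an instance of the classes of Hilbert and Banach spaces; functions on \<open>\<Omega>\<close> enter
  by extension with zero.
\<close>
quotient_type (overloaded) ('a, 'b) l2 = "'a::euclidean_space \<Rightarrow> 'b::euclidean_space" /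
  partial: "\<lambda>f g. square_integrable f \<and> square_integrable g \<and> (AE x in lebesgue. f x = g x)"
  morphisms rep_l2 abs_l2
proof (rule part_equivpI)
  show "\<exists>f::'a \<Rightarrow> 'b. square_integrable f \<and> square_integrable f \<and> (AE x in lebesgue. f x = f x)"
    using square_integrable_zero by blast
  show "symp (\<lambda>f g::'a \<Rightarrow> 'b. square_integrable f \<and> square_integrable g \<and> (AE x in lebesgue. f x = g x))"
    by (auto simp: symp_def)
  show "transp (\<lambda>f g::'a \<Rightarrow> 'b. square_integrable f \<and> square_integrable g \<and> (AE x in lebesgue. f x = g x))"
    by (auto simp: transp_def elim: AE_mp)
qed

instantiation l2 :: (euclidean_space, euclidean_space) real_inner
begin

lift_definition zero_l2 :: "('a, 'b) l2" is "\<lambda>x. 0"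
  by (simp add: square_integrable_zero)

lift_definition plus_l2 :: "('a, 'b) l2 \<Rightarrow> ('a, 'b) l2 \<Rightarrow> ('a, 'b) l2" is "\<lambda>f g x. f x + g x"
  by (auto intro: square_integrable_add)

lift_definition scaleR_l2 :: "real \<Rightarrow> ('a, 'b) l2 \<Rightarrow> ('a, 'b) l2" is "\<lambda>c f x. c *\<^sub>R f x"
  by (auto intro: square_integrable_scaleR)

definition uminus_l2 :: "('a, 'b) l2 \<Rightarrow> ('a, 'b) l2" where "- (X :: ('a, 'b) l2) = (-1) *\<^sub>R X"

definition minus_l2 :: "('a, 'b) l2 \<Rightarrow> ('a, 'b) l2 \<Rightarrow> ('a, 'b) l2" where "X - Y = (X :: ('a, 'b) l2) + (-1) *\<^sub>R Y"

lift_definition inner_l2 :: "('a, 'b) l2 \<Rightarrow> ('a, 'b) l2 \<Rightarrow> real" is "\<lambda>f g. LINT x|lebesgue. f x \<bullet> g x"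
proof -
  fix f1 f2 g1 g2 :: "'a \<Rightarrow> 'b"
  assume f: "square_integrable f1 \<and> square_integrable f2 \<and> (AE x in lebesgue. f1 x = f2 x)"
    and g: "square_integrable g1 \<and> square_integrable g2 \<and> (AE x in lebesgue. g1 x = g2 x)"
  then show "(LINT x|lebesgue. f1 x \<bullet> g1 x) = (LINT x|lebesgue. f2 x \<bullet> g2 x)"
    by (intro integral_cong_AE) (auto simp: square_integrable_def)
qed

definition norm_l2 :: "('a, 'b) l2 \<Rightarrow> real" where "norm (X :: ('a, 'b) l2) = sqrt (X \<bullet> X)"

definition dist_l2 :: "('a, 'b) l2 \<Rightarrow> ('a, 'b) l2 \<Rightarrow> real" where "dist (X :: ('a, 'b) l2) Y = norm (X - Y)"

definition sgn_l2 :: "('a, 'b) l2 \<Rightarrow> ('a, 'b) l2" where "sgn (X :: ('a, 'b) l2) = inverse (norm X) *\<^sub>R X"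

definition uniformity_l2 :: "(('a, 'b) l2 \<times> ('a, 'b) l2) filter" where
  "uniformity_l2 = (INF e\<in>{0 <..}. principal {(X, Y). dist X Y < e})"

definition open_l2 :: "('a, 'b) l2 set \<Rightarrow> bool" where
  "open_l2 S = (\<forall>X\<in>S. \<forall>\<^sub>F (X', Y) in uniformity. X' = X \<longrightarrow> Y \<in> S)"

instance
proof
  fix X Y Z :: "('a, 'b) l2" and a b :: real and U :: "('a, 'b) l2 set"
  show "X + Y + Z = X + (Y + Z)"
    by transfer (auto simp: add.assoc intro: square_integrable_add)
  show "X + Y = Y + X"
    by transfer (auto simp: add.commute intro: square_integrable_add)
  show "0 + X = X"
    by transfer (auto intro: square_integrable_add)
  show "- X + X = 0"
    unfolding uminus_l2_def
    by transfer (auto intro: square_integrable_add square_integrable_scaleR simp: square_integrable_zero)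
  show "X - Y = X + - Y" by (simp add: minus_l2_def uminus_l2_def)
  show "a *\<^sub>R (X + Y) = a *\<^sub>R X + a *\<^sub>R Y"
    by transfer (auto simp: scaleR_add_right intro: square_integrable_add square_integrable_scaleR)
  show "(a + b) *\<^sub>R X = a *\<^sub>R X + b *\<^sub>R X"
    by transfer (auto simp: scaleR_add_left intro: square_integrable_add square_integrable_scaleR)
  show "a *\<^sub>R b *\<^sub>R X = (a * b) *\<^sub>R X"
    by transfer (auto intro: square_integrable_scaleR)
  show "1 *\<^sub>R X = X"
    by transfer auto
  show "dist X Y = norm (X - Y)" by (simp add: dist_l2_def)
  show "sgn X = inverse (norm X) *\<^sub>R X" by (simp add: sgn_l2_def)
  show "uniformity = (INF e\<in>{0 <..}. principal {(X, Y :: ('a, 'b) l2). dist X Y < e})"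
    by (simp add: uniformity_l2_def)
  show "open U = (\<forall>X\<in>U. \<forall>\<^sub>F (X', Y) in uniformity. X' = X \<longrightarrow> Y \<in> U)"
    by (simp add: open_l2_def)
  show "X \<bullet> Y = Y \<bullet> X"
    by transfer (simp add: inner_commute)
  show "(X + Y) \<bullet> Z = X \<bullet> Z + Y \<bullet> Z"
    by transfer (simp add: inner_add_left square_integrable_inner)
  show "(a *\<^sub>R X) \<bullet> Y = a * (X \<bullet> Y)"
    by transfer (simp add: square_integrable_inner)
  show "0 \<le> X \<bullet> X"
    by transfer simp
  show "X \<bullet> X = 0 \<longleftrightarrow> X = 0"
  proof transfer
    fix f :: "'a \<Rightarrow> 'b"
    assume f: "square_integrable f \<and> square_integrable f \<and> (AE x in lebesgue. f x = f x)"
    then have "integrable lebesgue (\<lambda>x. f x \<bullet> f x)" by (simp add: square_integrable_inner)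
    then have "(LINT x|lebesgue. f x \<bullet> f x) = 0 \<longleftrightarrow> (AE x in lebesgue. f x \<bullet> f x = 0)"
      by (rule integral_nonneg_eq_0_iff_AE) auto
    then show "(LINT x|lebesgue. f x \<bullet> f x) = 0 \<longleftrightarrow>
      square_integrable f \<and> square_integrable (\<lambda>x. 0 :: 'b) \<and> (AE x in lebesgue. f x = 0)"
      using f by (simp add: square_integrable_zero)
  qed
  show "norm X = sqrt (X \<bullet> X)" by (simp add: norm_l2_def)
qed

end

lemma square_integrable_rep: "square_integrable (rep_l2 X)"
  by (metis (mono_tags, lifting) Quotient3_l2 Quotient3_rep_reflp)

lemma abs_rep_l2 [simp]: "abs_l2 (rep_l2 X) = X"
  using Quotient3_l2 by (rule Quotient3_abs_rep)

lemma abs_l2_eq_iff: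
  assumes "square_integrable f" "square_integrable g"
  shows "abs_l2 f = abs_l2 g \<longleftrightarrow> (AE x in lebesgue. f x = g x)"
  using Quotient3_rel[OF Quotient3_l2, of f g] assms by auto

lemma rep_abs_l2: "square_integrable f \<Longrightarrow> AE x in lebesgue. rep_l2 (abs_l2 f) x = f x"
  using abs_l2_eq_iff[of "rep_l2 (abs_l2 f)" f] square_integrable_rep by auto

lemma abs_l2_add:
  "square_integrable f \<Longrightarrow> square_integrable g \<Longrightarrow> abs_l2 (\<lambda>x. f x + g x) = abs_l2 f + abs_l2 g"
  by (subst plus_l2.abs_eq) auto

lemma abs_l2_scaleR: "square_integrable f \<Longrightarrow> abs_l2 (\<lambda>x. c *\<^sub>R f x) = c *\<^sub>R abs_l2 f"
  by (subst scaleR_l2.abs_eq) auto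

lemma abs_l2_diff:
  "square_integrable f \<Longrightarrow> square_integrable g \<Longrightarrow> abs_l2 (\<lambda>x. f x - g x) = abs_l2 f - abs_l2 g"
  using abs_l2_add[of f "\<lambda>x. (-1) *\<^sub>R g x"] abs_l2_scaleR[of g "-1"] square_integrable_scaleR[of g "-1"]
  by simp

lemma abs_l2_inner:
  "square_integrable f \<Longrightarrow> square_integrable g \<Longrightarrow> abs_l2 f \<bullet> abs_l2 g = (LINT x|lebesgue. f x \<bullet> g x)"
  by (subst inner_l2.abs_eq) auto

lemma abs_l2_norm:
  "square_integrable f \<Longrightarrow> norm (abs_l2 f) = sqrt (LINT x|lebesgue. (norm (f x))\<^sup>2)"
  by (simp add: norm_eq_sqrt_inner[of "abs_l2 f"] abs_l2_inner power2_norm_eq_inner)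

text \<open>
  Riesz--Fischer: a rapidly converging subsequence converges almost everywhere, and Fatou's lemma shows
  that the pointwise limit is the limit in norm.
\<close>
instance l2 :: (euclidean_space, euclidean_space) complete_space
proof
  fix X :: "nat \<Rightarrow> ('a, 'b) l2"
  assume X: "Cauchy X"
  have "\<exists>N. \<forall>m\<ge>N. \<forall>n\<ge>N. dist (X m) (X n) < (1/4)^k" for k
    using X by (simp add: Cauchy_def)
  then obtain N where N: "\<And>k m n. m \<ge> N k \<Longrightarrow> n \<ge> N k \<Longrightarrow> dist (X m) (X n) < (1/4)^k" by metis
  define r where "r k = (\<Sum>i\<le>k. N i) + k" for k
  have rN: "r k \<ge> N k" for k unfolding r_def using member_le_sum[of k "{..k}" N] by simp
  have rmono: "r k \<le> r (Suc k)" "r k < r (Suc k)" for k by (simp_all add: r_def)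
  then have r: "strict_mono r" by (simp add: strict_mono_Suc_iff)
  define f where "f k = rep_l2 (X (r k))" for k
  have f: "square_integrable (f k)" for k by (simp add: f_def square_integrable_rep)
  note [measurable] = f[THEN square_integrable_measurable]
  have fd: "square_integrable (\<lambda>x. f i x - f j x)" for i j
    using square_integrable_add[OF f square_integrable_scaleR[OF f], of i "-1" j] by simp
  have nd: "(\<integral>\<^sup>+x. ennreal ((norm (f i x - f j x))\<^sup>2) \<partial>lebesgue) = ennreal ((norm (X (r i) - X (r j)))\<^sup>2)" for i j
  proof -
    have "X (r i) - X (r j) = abs_l2 (\<lambda>x. f i x - f j x)"
      using f by (simp add: abs_l2_diff f_def square_integrable_rep)
    then have "(norm (X (r i) - X (r j)))\<^sup>2 = (LINT x|lebesgue. (norm (f i x - f j x))\<^sup>2)"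
      using fd[of i j] by (simp add: abs_l2_norm)
    then show ?thesis using fd[of i j]
      by (subst nn_integral_eq_integral) (auto simp: square_integrable_def)
  qed
  have step: "norm (X (r (Suc k)) - X (r k)) < (1/4)^k" for k
    using N[of k "r (Suc k)" "r k"] rN[of k] rmono(1)[of k] by (simp add: dist_norm)
  \<comment> \<open>The weight \<open>4^k\<close> keeps the series of integrals convergent, while a finite value of \<open>s x\<close> forces the
    increments at \<open>x\<close> to be of order \<open>(1/2)^k\<close>, hence summable.\<close>
  define s where "s x = (\<Sum>k. ennreal (4^k * (norm (f (Suc k) x - f k x))\<^sup>2))" for x
  have "(\<integral>\<^sup>+x. s x \<partial>lebesgue) = (\<Sum>k. \<integral>\<^sup>+x. ennreal (4^k * (norm (f (Suc k) x - f k x))\<^sup>2) \<partial>lebesgue)"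
    unfolding s_def by (rule nn_integral_suminf) measurable
  also have "\<dots> = (\<Sum>k. ennreal (4^k * (norm (X (r (Suc k)) - X (r k)))\<^sup>2))"
    by (simp add: ennreal_mult nn_integral_cmult nd)
  also have "\<dots> \<le> (\<Sum>k. ennreal ((1/4)^k))"
  proof (intro suminf_le ennreal_leI)
    fix k
    have "(norm (X (r (Suc k)) - X (r k)))\<^sup>2 \<le> ((1/4)^k)\<^sup>2"
      using step[of k] by (intro power_mono) auto
    then have "4^k * (norm (X (r (Suc k)) - X (r k)))\<^sup>2 \<le> 4^k * ((1/4)^k)\<^sup>2" by simp
    also have "\<dots> = (1/4::real)^k" by (simp add: power2_eq_square field_simps)
    finally show "4^k * (norm (X (r (Suc k)) - X (r k)))\<^sup>2 \<le> (1/4::real)^k" .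
  qed auto
  also have "\<dots> = ennreal (\<Sum>k. (1/4)^k)"
    by (rule suminf_ennreal2) (auto intro: summable_geometric)
  finally have "(\<integral>\<^sup>+x. s x \<partial>lebesgue) < \<infinity>" by (simp add: order_le_less_trans)
  moreover have "s \<in> borel_measurable lebesgue" unfolding s_def by measurable
  ultimately have "AE x in lebesgue. s x \<noteq> \<infinity>" by (intro nn_integral_PInf_AE) auto
  then have conv: "AE x in lebesgue. convergent (\<lambda>k. f k x)"
  proof eventually_elim
    case (elim x)
    define a where "a k = norm (f (Suc k) x - f k x)" for k
    have "summable (\<lambda>k. 4^k * (a k)\<^sup>2)"
      using elim by (intro summable_suminf_not_top) (auto simp: s_def a_def top.not_eq_extremum)
    then have "Bseq (\<lambda>k. 4^k * (a k)\<^sup>2)" using summable_LIMSEQ_zero convergent_imp_Bseq convergentI by blast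
    then obtain K where K: "K > 0" "\<And>k. 4^k * (a k)\<^sup>2 \<le> K" unfolding Bseq_def by fastforce
    have four: "(4::real)^k = (2^k)\<^sup>2" for k by (simp add: power2_eq_square flip: power_mult_distrib)
    have "a k \<le> sqrt K * (1/2)^k" for k
    proof (rule power2_le_imp_le)
      show "(a k)\<^sup>2 \<le> (sqrt K * (1/2)^k)\<^sup>2"
        using K(2)[of k] K(1) unfolding four by (simp add: power_mult_distrib field_simps)
    qed (use K in auto)
    then have "summable a"
      by (intro summable_comparison_test'[of "\<lambda>k. sqrt K * (1/2)^k" 0 a])
         (auto simp: a_def intro!: summable_mult summable_geometric)
    then have "summable (\<lambda>k. f (Suc k) x - f k x)" unfolding a_def by (rule summable_norm_cancel)
    then have "convergent (\<lambda>n. \<Sum>k<n. f (Suc k) x - f k x)" by (simp add: summable_iff_convergent)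
    then have "convergent (\<lambda>n. f n x - f 0 x)" unfolding sum_lessThan_telescope[of "\<lambda>k. f k x"] .
    then have "convergent (\<lambda>n. (f n x - f 0 x) + f 0 x)"
      by (rule convergent_add) (rule convergent_const)
    then show "convergent (\<lambda>k. f k x)" by simp
  qed
  define g where "g x = lim (\<lambda>k. f k x)" for x
  have [measurable]: "g \<in> borel_measurable lebesgue"
    unfolding g_def by (rule borel_measurable_lim_metric) measurable
  have lim: "AE x in lebesgue. (\<lambda>k. f k x) \<longlonglongrightarrow> g x"
    using conv by eventually_elim (simp add: g_def convergent_LIMSEQ_iff)
  have fatou: "(\<integral>\<^sup>+x. ennreal ((norm (f i x - g x))\<^sup>2) \<partial>lebesgue) \<le> ennreal (((1/4)^i)\<^sup>2)" for i
  proof -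
    have "AE x in lebesgue. ennreal ((norm (f i x - g x))\<^sup>2) = liminf (\<lambda>j. ennreal ((norm (f i x - f j x))\<^sup>2))"
      using lim
    proof eventually_elim
      case (elim x)
      then have "(\<lambda>j. ennreal ((norm (f i x - f j x))\<^sup>2)) \<longlonglongrightarrow> ennreal ((norm (f i x - g x))\<^sup>2)"
        by (intro tendsto_ennrealI tendsto_intros)
      then show ?case by (intro lim_imp_Liminf[symmetric]) auto
    qed
    then have "(\<integral>\<^sup>+x. ennreal ((norm (f i x - g x))\<^sup>2) \<partial>lebesgue) =
        (\<integral>\<^sup>+x. liminf (\<lambda>j. ennreal ((norm (f i x - f j x))\<^sup>2)) \<partial>lebesgue)"
      by (rule nn_integral_cong_AE)
    also have "\<dots> \<le> liminf (\<lambda>j. \<integral>\<^sup>+x. ennreal ((norm (f i x - f j x))\<^sup>2) \<partial>lebesgue)"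
      by (rule nn_integral_liminf) measurable
    also have "\<dots> \<le> ennreal (((1/4)^i)\<^sup>2)"
    proof (rule Liminf_le)
      have "(\<integral>\<^sup>+x. ennreal ((norm (f i x - f j x))\<^sup>2) \<partial>lebesgue) \<le> ennreal (((1/4)^i)\<^sup>2)" if "j \<ge> i" for j
      proof -
        have "r j \<ge> r i" using r that by (simp add: strict_mono_less_eq)
        then have "norm (X (r i) - X (r j)) \<le> (1/4)^i"
          using N[of i "r i" "r j"] rN[of i] by (simp add: dist_norm)
        then show ?thesis unfolding nd by (intro ennreal_leI power_mono) auto
      qed
      then show "\<forall>\<^sub>F j in sequentially. (\<integral>\<^sup>+x. ennreal ((norm (f i x - f j x))\<^sup>2) \<partial>lebesgue) \<le> ennreal (((1/4)^i)\<^sup>2)"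
        by (auto simp: eventually_sequentially)
    qed simp
    finally show ?thesis .
  qed
  have fg: "square_integrable (\<lambda>x. f i x - g x)" for i
    unfolding square_integrable_def
    using fatou[of i] by (auto intro!: integrableI_bounded simp: order_le_less_trans)
  have g: "square_integrable g"
    using square_integrable_add[OF f[of 0] square_integrable_scaleR[OF fg[of 0], of "-1"]] by simp
  have rate: "norm (X (r i) - abs_l2 g) \<le> (1/4)^i" for i
  proof -
    have "X (r i) - abs_l2 g = abs_l2 (\<lambda>x. f i x - g x)"
      using g by (simp add: abs_l2_diff f_def square_integrable_rep)
    then have "(norm (X (r i) - abs_l2 g))\<^sup>2 = (LINT x|lebesgue. (norm (f i x - g x))\<^sup>2)"
      using fg[of i] by (simp add: abs_l2_norm)
    moreover have "ennreal (LINT x|lebesgue. (norm (f i x - g x))\<^sup>2) \<le> ennreal (((1/4)^i)\<^sup>2)"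
      using fatou[of i] fg[of i] by (subst (asm) nn_integral_eq_integral) (auto simp: square_integrable_def)
    ultimately have "(norm (X (r i) - abs_l2 g))\<^sup>2 \<le> ((1/4)^i)\<^sup>2" by simp
    then show ?thesis by (rule power2_le_imp_le) simp
  qed
  have "(\<lambda>i. (1/4::real)^i) \<longlonglongrightarrow> 0" by (rule LIMSEQ_power_zero) simp
  then have "(\<lambda>i. X (r i) - abs_l2 g) \<longlonglongrightarrow> 0"
    by (rule Lim_null_comparison[OF always_eventually[OF allI[OF rate]]])
  then have "(X \<circ> r) \<longlonglongrightarrow> abs_l2 g" by (simp add: LIM_zero_iff o_def)
  then show "convergent X"
    using Cauchy_converges_subseq[OF X r] by (auto simp: convergent_def)
qed

instance l2 :: (euclidean_space, euclidean_space) banach ..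

section \<open>Functions and multiplication operators on a bounded open set\<close>

locale bounded_open_set =
  fixes \<Omega> :: "'a::euclidean_space set"
  assumes open_\<Omega>: "open \<Omega>" and bounded_\<Omega>: "bounded \<Omega>" and nonempty_\<Omega>: "\<Omega> \<noteq> {}"
begin

lemma sets_\<Omega> [simp, measurable]: "\<Omega> \<in> sets lebesgue"
  using open_\<Omega> by (simp add: borel_open)

text \<open>
  The predicate \<open>sq_on\<close> describes \<open>L\<^sup>2(\<Omega>)\<close> for functions with values in any Euclidean space, and \<open>cls\<close>
  embeds it isometrically. The image of \<open>cls\<close> consists of the fixed points of \<open>\<lambda>X. cls (rep_l2 X)\<close>,
  which restricts a class to \<open>\<Omega>\<close>.
\<close>
definition sq_on :: "('a \<Rightarrow> 'b::euclidean_space) \<Rightarrow> bool" where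
  "sq_on f \<longleftrightarrow> square_integrable (\<lambda>x. indicator \<Omega> x *\<^sub>R f x)"

definition cls :: "('a \<Rightarrow> 'b::euclidean_space) \<Rightarrow> ('a, 'b) l2" where
  "cls f = abs_l2 (\<lambda>x. indicator \<Omega> x *\<^sub>R f x)"

lemma AE_on_iff: "(AE x in lebesgue_on \<Omega>. P x) \<longleftrightarrow> (AE x in lebesgue. x \<in> \<Omega> \<longrightarrow> P x)"
  by (rule AE_restrict_space_iff) simp

lemma measurable_on_iff:
  fixes f :: "'a \<Rightarrow> 'b::euclidean_space"
  shows "f \<in> borel_measurable (lebesgue_on \<Omega>) \<longleftrightarrow> (\<lambda>x. indicator \<Omega> x *\<^sub>R f x) \<in> borel_measurable lebesgue"
  by (rule borel_measurable_restrict_space_iff) simp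

lemma sq_on_iff:
  fixes f :: "'a \<Rightarrow> 'b::euclidean_space"
  shows "sq_on f \<longleftrightarrow> f \<in> borel_measurable (lebesgue_on \<Omega>) \<and>
    integrable (lebesgue_on \<Omega>) (\<lambda>x. (norm (f x))\<^sup>2)"
proof -
  have "(norm (indicator \<Omega> x *\<^sub>R f x))\<^sup>2 = indicator \<Omega> x *\<^sub>R (norm (f x))\<^sup>2" for x
    by (simp add: indicator_def)
  then show ?thesis
    by (simp add: sq_on_def square_integrable_def measurable_on_iff integrable_restrict_space)
qed

lemma L2_iff: "f \<in> L2 \<Omega> \<longleftrightarrow> sq_on f"
  by (simp add: sq_on_iff L2_def)

lemma sq_on_add: "sq_on f \<Longrightarrow> sq_on g \<Longrightarrow> sq_on (\<lambda>x. f x + g x)"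
  unfolding sq_on_def scaleR_add_right by (rule square_integrable_add)

lemma sq_on_scaleR: "sq_on f \<Longrightarrow> sq_on (\<lambda>x. c *\<^sub>R f x)"
  unfolding sq_on_def using square_integrable_scaleR[of _ c] by (fastforce simp: mult.commute)

lemma sq_on_diff: "sq_on f \<Longrightarrow> sq_on g \<Longrightarrow> sq_on (\<lambda>x. f x - g x)"
  using sq_on_add[of f "\<lambda>x. (-1) *\<^sub>R g x"] sq_on_scaleR[of g "-1"] by simp

lemma cls_add: "sq_on f \<Longrightarrow> sq_on g \<Longrightarrow> cls (\<lambda>x. f x + g x) = cls f + cls g"
  unfolding sq_on_def cls_def scaleR_add_right by (rule abs_l2_add)

lemma cls_diff: "sq_on f \<Longrightarrow> sq_on g \<Longrightarrow> cls (\<lambda>x. f x - g x) = cls f - cls g"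
  unfolding sq_on_def cls_def scaleR_diff_right by (rule abs_l2_diff)

lemma cls_scaleR: "sq_on f \<Longrightarrow> cls (\<lambda>x. c *\<^sub>R f x) = c *\<^sub>R cls f"
  unfolding sq_on_def cls_def by (subst abs_l2_scaleR[symmetric]) (auto simp: mult.commute)

lemma cls_eq_iff: "sq_on f \<Longrightarrow> sq_on g \<Longrightarrow> cls f = cls g \<longleftrightarrow> (AE x in lebesgue_on \<Omega>. f x = g x)"
  unfolding sq_on_def cls_def
  by (auto simp: abs_l2_eq_iff AE_on_iff indicator_def elim!: eventually_mono)

lemma cls_inner: "sq_on f \<Longrightarrow> sq_on g \<Longrightarrow> cls f \<bullet> cls g = (LINT x|lebesgue_on \<Omega>. f x \<bullet> g x)"
  unfolding sq_on_def cls_def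
  by (auto simp: abs_l2_inner integral_restrict_space indicator_def intro!: Bochner_Integration.integral_cong)

lemma integrable_inner_on: "sq_on f \<Longrightarrow> sq_on g \<Longrightarrow> integrable (lebesgue_on \<Omega>) (\<lambda>x. f x \<bullet> g x)"
proof -
  assume "sq_on f" "sq_on g"
  then have "integrable lebesgue (\<lambda>x. (indicator \<Omega> x *\<^sub>R f x) \<bullet> (indicator \<Omega> x *\<^sub>R g x))"
    unfolding sq_on_def by (rule square_integrable_inner)
  moreover have "(indicator \<Omega> x *\<^sub>R f x) \<bullet> (indicator \<Omega> x *\<^sub>R g x) = indicator \<Omega> x *\<^sub>R (f x \<bullet> g x)" for x
    by (simp add: indicator_def)
  ultimately have "integrable lebesgue (\<lambda>x. indicator \<Omega> x *\<^sub>R (f x \<bullet> g x))" by (simp only:)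
  then show ?thesis by (simp add: integrable_restrict_space)
qed

lemma norm_cls_eq: "sq_on f \<Longrightarrow> norm (cls f) = sqrt (LINT x|lebesgue_on \<Omega>. (norm (f x))\<^sup>2)"
  by (simp add: norm_eq_sqrt_inner[of "cls f"] cls_inner power2_norm_eq_inner)

lemma norm_cls: "f \<in> L2 \<Omega> \<Longrightarrow> norm (cls f) = L2_norm \<Omega> f"
  by (simp add: norm_cls_eq L2_iff L2_norm_def)

lemma sq_on_rep: "sq_on (rep_l2 X)"
  unfolding sq_on_def
proof (rule square_integrable_bound[OF square_integrable_rep[of X], of _ 1])
  show "(\<lambda>x. indicator \<Omega> x *\<^sub>R rep_l2 X x) \<in> borel_measurable lebesgue"
    by (intro borel_measurable_scaleR borel_measurable_indicator square_integrable_measurable square_integrable_rep sets_\<Omega>)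
qed (simp add: indicator_def)

lemma cls_rep_cls: "sq_on f \<Longrightarrow> cls (rep_l2 (cls f)) = cls f"
proof -
  assume f: "sq_on f"
  have "AE x in lebesgue. rep_l2 (cls f) x = indicator \<Omega> x *\<^sub>R f x"
    unfolding cls_def using f by (intro rep_abs_l2) (simp add: sq_on_def)
  then have "AE x in lebesgue_on \<Omega>. rep_l2 (cls f) x = f x"
    unfolding AE_on_iff by eventually_elim simp
  then show "cls (rep_l2 (cls f)) = cls f" using f by (subst cls_eq_iff) (auto intro: sq_on_rep)
qed

lemma AE_rep_cls: "sq_on f \<Longrightarrow> AE x in lebesgue_on \<Omega>. rep_l2 (cls f) x = f x"
  using cls_rep_cls[of f] sq_on_rep[of "cls f"] by (simp add: cls_eq_iff)

lemma AE_rep_add: "AE x in lebesgue_on \<Omega>. rep_l2 (X + Y) x = rep_l2 X x + rep_l2 Y x"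
proof -
  have "abs_l2 (\<lambda>x. rep_l2 X x + rep_l2 Y x) = abs_l2 (rep_l2 (X + Y))"
    by (simp add: abs_l2_add square_integrable_rep)
  then have "AE x in lebesgue. rep_l2 X x + rep_l2 Y x = rep_l2 (X + Y) x"
    by (subst (asm) abs_l2_eq_iff) (auto intro: square_integrable_add square_integrable_rep)
  then show ?thesis unfolding AE_on_iff by eventually_elim simp
qed

lemma AE_rep_scaleR: "AE x in lebesgue_on \<Omega>. rep_l2 (c *\<^sub>R X) x = c *\<^sub>R rep_l2 X x"
proof -
  have "abs_l2 (\<lambda>x. c *\<^sub>R rep_l2 X x) = abs_l2 (rep_l2 (c *\<^sub>R X))"
    by (simp add: abs_l2_scaleR square_integrable_rep)
  then have "AE x in lebesgue. c *\<^sub>R rep_l2 X x = rep_l2 (c *\<^sub>R X) x"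
    by (subst (asm) abs_l2_eq_iff) (auto intro: square_integrable_scaleR square_integrable_rep)
  then show ?thesis unfolding AE_on_iff by eventually_elim simp
qed

lemma cls_rep_norm: "norm (cls (rep_l2 X)) \<le> norm X"
proof -
  have "(norm (cls (rep_l2 X)))\<^sup>2 = (LINT x|lebesgue. (norm (indicator \<Omega> x *\<^sub>R rep_l2 X x))\<^sup>2)"
    unfolding cls_def using sq_on_rep[of X] by (simp add: abs_l2_norm sq_on_def)
  also have "\<dots> \<le> (LINT x|lebesgue. (norm (rep_l2 X x))\<^sup>2)"
    using sq_on_rep[of X] square_integrable_rep[of X]
    by (intro integral_mono) (auto simp: sq_on_def square_integrable_def indicator_def)
  also have "\<dots> = (norm X)\<^sup>2"
    using abs_l2_norm[OF square_integrable_rep, of X] by simp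
  finally show ?thesis by (rule power2_le_imp_le) simp
qed

lemma bounded_linear_cls_rep: "bounded_linear (\<lambda>X :: ('a, 'b::euclidean_space) l2. cls (rep_l2 X))"
proof (rule bounded_linear_intro[where K = 1])
  fix X Y :: "('a, 'b) l2" and c :: real
  have "cls (rep_l2 (X + Y)) = cls (\<lambda>x. rep_l2 X x + rep_l2 Y x)"
    using AE_rep_add by (subst cls_eq_iff) (auto intro: sq_on_rep sq_on_add)
  then show "cls (rep_l2 (X + Y)) = cls (rep_l2 X) + cls (rep_l2 Y)"
    by (simp add: cls_add sq_on_rep)
  have "cls (rep_l2 (c *\<^sub>R X)) = cls (\<lambda>x. c *\<^sub>R rep_l2 X x)"
    using AE_rep_scaleR by (subst cls_eq_iff) (auto intro: sq_on_rep sq_on_scaleR)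
  then show "cls (rep_l2 (c *\<^sub>R X)) = c *\<^sub>R cls (rep_l2 X)"
    by (simp add: cls_scaleR sq_on_rep)
  show "norm (cls (rep_l2 X)) \<le> norm X * 1" using cls_rep_norm[of X] by simp
qed

lemma closed_cls_fixed: "closed {X :: ('a, 'b::euclidean_space) l2. cls (rep_l2 X) = X}"
  by (intro closed_Collect_eq bounded_linear.continuous_on[OF bounded_linear_cls_rep] continuous_on_id)

lemma emeasure_\<Omega>_pos: "emeasure (lebesgue_on \<Omega>) (space (lebesgue_on \<Omega>)) \<noteq> 0"
proof
  assume "emeasure (lebesgue_on \<Omega>) (space (lebesgue_on \<Omega>)) = 0"
  then have "emeasure lebesgue \<Omega> = 0" by (simp add: emeasure_restrict_space)
  then have "negligible \<Omega>" by (simp add: negligible_iff_null_sets null_sets_def)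
  then show False using open_not_negligible open_\<Omega> nonempty_\<Omega> by blast
qed

lemma Linf_bounds:
  assumes "f \<in> Linf \<Omega>"
  shows "AE x in lebesgue_on \<Omega>. \<bar>f x\<bar> \<le> Linf_norm \<Omega> f" and "0 \<le> Linf_norm \<Omega> f"
proof -
  let ?s = "esssup (lebesgue_on \<Omega>) (\<lambda>x. ereal \<bar>f x\<bar>)"
  have fin: "?s < \<infinity>" and m: "f \<in> borel_measurable (lebesgue_on \<Omega>)" using assms by (auto simp: Linf_def)
  have "esssup (lebesgue_on \<Omega>) (\<lambda>x. 0 :: ereal) \<le> ?s" by (rule esssup_mono) (use m in auto)
  then have pos: "0 \<le> ?s" using esssup_const[OF emeasure_\<Omega>_pos, of "0 :: ereal"] by simp
  have s: "?s = ereal (Linf_norm \<Omega> f)" unfolding Linf_norm_def using fin pos by (cases ?s) auto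
  show "0 \<le> Linf_norm \<Omega> f" using pos s by simp
  show "AE x in lebesgue_on \<Omega>. \<bar>f x\<bar> \<le> Linf_norm \<Omega> f"
    using esssup_AE[where M = "lebesgue_on \<Omega>" and f = "\<lambda>x. ereal \<bar>f x\<bar>"] unfolding s by simp
qed

lemma Linf_I:
  assumes "f \<in> borel_measurable (lebesgue_on \<Omega>)" "AE x in lebesgue_on \<Omega>. \<bar>f x\<bar> \<le> c"
  shows "f \<in> Linf \<Omega>" and "Linf_norm \<Omega> f \<le> c"
proof -
  have le: "esssup (lebesgue_on \<Omega>) (\<lambda>x. ereal \<bar>f x\<bar>) \<le> ereal c"
    using assms by (intro esssup_I) auto
  then show "f \<in> Linf \<Omega>" using assms(1) by (auto simp: Linf_def intro: le_less_trans)
  from Linf_bounds(2)[OF this] show "Linf_norm \<Omega> f \<le> c"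
    using le esssup_mono[where M = "lebesgue_on \<Omega>" and f = "\<lambda>x. 0::ereal" and g = "\<lambda>x. ereal \<bar>f x\<bar>"] assms(1)
      esssup_const[OF emeasure_\<Omega>_pos, of "0 :: ereal"]
    unfolding Linf_norm_def by (cases "esssup (lebesgue_on \<Omega>) (\<lambda>x. ereal \<bar>f x\<bar>)") auto
qed

lemma Linf_add: "f \<in> Linf \<Omega> \<Longrightarrow> g \<in> Linf \<Omega> \<Longrightarrow> (\<lambda>x. f x + g x) \<in> Linf \<Omega>"
proof (rule Linf_I(1)[where c = "Linf_norm \<Omega> f + Linf_norm \<Omega> g"])
  assume fg: "f \<in> Linf \<Omega>" "g \<in> Linf \<Omega>"
  then show "(\<lambda>x. f x + g x) \<in> borel_measurable (lebesgue_on \<Omega>)" by (auto simp: Linf_def)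
  show "AE x in lebesgue_on \<Omega>. \<bar>f x + g x\<bar> \<le> Linf_norm \<Omega> f + Linf_norm \<Omega> g"
    using Linf_bounds(1)[OF fg(1)] Linf_bounds(1)[OF fg(2)] by eventually_elim auto
qed

lemma Linf_scale:
  assumes f: "f \<in> Linf \<Omega>"
  shows "(\<lambda>x. c * f x) \<in> Linf \<Omega>" and "Linf_norm \<Omega> (\<lambda>x. c * f x) \<le> \<bar>c\<bar> * Linf_norm \<Omega> f"
proof -
  have m: "(\<lambda>x. c * f x) \<in> borel_measurable (lebesgue_on \<Omega>)" using f by (auto simp: Linf_def)
  have b: "AE x in lebesgue_on \<Omega>. \<bar>c * f x\<bar> \<le> \<bar>c\<bar> * Linf_norm \<Omega> f"
    using Linf_bounds(1)[OF f] by eventually_elim (simp add: abs_mult mult_left_mono)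
  show "(\<lambda>x. c * f x) \<in> Linf \<Omega>" "Linf_norm \<Omega> (\<lambda>x. c * f x) \<le> \<bar>c\<bar> * Linf_norm \<Omega> f"
    using Linf_I[OF m b] by auto
qed

lemma sq_on_mult:
  assumes m: "m \<in> Linf \<Omega>" and f: "sq_on f"
  shows "sq_on (\<lambda>x. m x * f x)"
  unfolding sq_on_def
proof (rule square_integrable_bound[where c = "Linf_norm \<Omega> m"])
  show "square_integrable (\<lambda>x. indicator \<Omega> x *\<^sub>R f x)" using f by (simp add: sq_on_def)
  have "(\<lambda>x. m x * f x) \<in> borel_measurable (lebesgue_on \<Omega>)"
    using m f by (auto simp: Linf_def sq_on_iff)
  then show "(\<lambda>x. indicator \<Omega> x *\<^sub>R (m x * f x)) \<in> borel_measurable lebesgue"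
    by (simp add: measurable_on_iff)
  show "AE x in lebesgue. norm (indicator \<Omega> x *\<^sub>R (m x * f x)) \<le> Linf_norm \<Omega> m * norm (indicator \<Omega> x *\<^sub>R f x)"
    using Linf_bounds(1)[OF m] unfolding AE_on_iff
    by eventually_elim (auto simp: indicator_def abs_mult intro: mult_right_mono)
qed

lemma norm_cls_mult:
  assumes m: "m \<in> Linf \<Omega>" and f: "sq_on f"
  shows "norm (cls (\<lambda>x. m x * f x)) \<le> Linf_norm \<Omega> m * norm (cls f)"
proof (rule power2_le_imp_le)
  have "(norm (cls (\<lambda>x. m x * f x)))\<^sup>2 = (LINT x|lebesgue_on \<Omega>. (norm (m x * f x))\<^sup>2)"
    by (simp add: norm_cls_eq sq_on_mult[OF m f])
  also have "\<dots> \<le> (LINT x|lebesgue_on \<Omega>. (Linf_norm \<Omega> m)\<^sup>2 * (norm (f x))\<^sup>2)"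
  proof (rule integral_mono_AE)
    show "integrable (lebesgue_on \<Omega>) (\<lambda>x. (norm (m x * f x))\<^sup>2)" using sq_on_mult[OF m f] by (simp add: sq_on_iff)
    show "integrable (lebesgue_on \<Omega>) (\<lambda>x. (Linf_norm \<Omega> m)\<^sup>2 * (norm (f x))\<^sup>2)" using f by (simp add: sq_on_iff)
    show "AE x in lebesgue_on \<Omega>. (norm (m x * f x))\<^sup>2 \<le> (Linf_norm \<Omega> m)\<^sup>2 * (norm (f x))\<^sup>2"
      using Linf_bounds(1)[OF m]
    proof eventually_elim
      case (elim x)
      then have "\<bar>m x\<bar>\<^sup>2 \<le> (Linf_norm \<Omega> m)\<^sup>2" by (intro power_mono) auto
      then show ?case by (simp add: power_mult_distrib mult_right_mono)
    qed
  qed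
  also have "\<dots> = (Linf_norm \<Omega> m * norm (cls f))\<^sup>2" by (simp add: norm_cls_eq f power_mult_distrib)
  finally show "(norm (cls (\<lambda>x. m x * f x)))\<^sup>2 \<le> (Linf_norm \<Omega> m * norm (cls f))\<^sup>2" .
  show "0 \<le> Linf_norm \<Omega> m * norm (cls f)" using Linf_bounds(2)[OF m] by simp
qed

definition mult_op :: "('a \<Rightarrow> real) \<Rightarrow> ('a, real) l2 \<Rightarrow>\<^sub>L ('a, real) l2" where
  "mult_op m = Blinfun (\<lambda>X. cls (\<lambda>x. m x * rep_l2 X x))"

lemma cls_mult_cong:
  assumes "m \<in> Linf \<Omega>" "sq_on f" "sq_on g" "AE x in lebesgue_on \<Omega>. f x = g x"
  shows "cls (\<lambda>x. m x * f x) = cls (\<lambda>x. m x * g x)"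
  by (subst cls_eq_iff) (use assms sq_on_mult in \<open>auto elim!: eventually_mono\<close>)

lemma bounded_linear_mult:
  assumes m: "m \<in> Linf \<Omega>"
  shows "bounded_linear (\<lambda>X. cls (\<lambda>x. m x * rep_l2 X x))"
proof (rule bounded_linear_intro[where K = "Linf_norm \<Omega> m"])
  fix X Y :: "('a, real) l2" and c :: real
  note r = sq_on_rep and mr = sq_on_mult[OF m sq_on_rep]
  have "cls (\<lambda>x. m x * rep_l2 (X + Y) x) = cls (\<lambda>x. m x * (rep_l2 X x + rep_l2 Y x))"
    by (rule cls_mult_cong[OF m]) (auto intro: r sq_on_add AE_rep_add)
  then show "cls (\<lambda>x. m x * rep_l2 (X + Y) x) = cls (\<lambda>x. m x * rep_l2 X x) + cls (\<lambda>x. m x * rep_l2 Y x)"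
    using cls_add[OF mr[of X] mr[of Y]] by (simp add: distrib_left)
  have "cls (\<lambda>x. m x * rep_l2 (c *\<^sub>R X) x) = cls (\<lambda>x. m x * (c *\<^sub>R rep_l2 X x))"
    by (intro cls_mult_cong[OF m] r sq_on_scaleR AE_rep_scaleR)
  then show "cls (\<lambda>x. m x * rep_l2 (c *\<^sub>R X) x) = c *\<^sub>R cls (\<lambda>x. m x * rep_l2 X x)"
    using cls_scaleR[OF mr[of X], of c] by (simp add: mult.left_commute)
  have "norm (cls (\<lambda>x. m x * rep_l2 X x)) \<le> Linf_norm \<Omega> m * norm (cls (rep_l2 X))"
    by (rule norm_cls_mult[OF m r])
  also have "\<dots> \<le> Linf_norm \<Omega> m * norm X"
    by (intro mult_left_mono cls_rep_norm Linf_bounds(2)[OF m])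
  finally show "norm (cls (\<lambda>x. m x * rep_l2 X x)) \<le> norm X * Linf_norm \<Omega> m" by (simp add: mult.commute)
qed

lemma mult_op_apply: "m \<in> Linf \<Omega> \<Longrightarrow> blinfun_apply (mult_op m) X = cls (\<lambda>x. m x * rep_l2 X x)"
  unfolding mult_op_def by (simp add: bounded_linear_Blinfun_apply bounded_linear_mult)

lemma mult_op_cls: "m \<in> Linf \<Omega> \<Longrightarrow> sq_on f \<Longrightarrow> blinfun_apply (mult_op m) (cls f) = cls (\<lambda>x. m x * f x)"
  by (simp add: mult_op_apply) (rule cls_mult_cong, auto intro: sq_on_rep AE_rep_cls)

lemma norm_mult_op: "m \<in> Linf \<Omega> \<Longrightarrow> norm (mult_op m) \<le> Linf_norm \<Omega> m"
proof (rule norm_blinfun_bound)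
  assume m: "m \<in> Linf \<Omega>"
  show "0 \<le> Linf_norm \<Omega> m" by (rule Linf_bounds(2)[OF m])
  fix X
  have "norm (blinfun_apply (mult_op m) X) \<le> Linf_norm \<Omega> m * norm (cls (rep_l2 X))"
    unfolding mult_op_apply[OF m] by (rule norm_cls_mult[OF m sq_on_rep])
  also have "\<dots> \<le> Linf_norm \<Omega> m * norm X"
    by (intro mult_left_mono cls_rep_norm Linf_bounds(2)[OF m])
  finally show "norm (blinfun_apply (mult_op m) X) \<le> Linf_norm \<Omega> m * norm X" .
qed

text \<open>
  Multiplication operators of functions in the span of \<open>B\<close> lie in the span of finitely many operators;
  this transfers the finite dimension of \<open>W\<close> to the space of coefficients.
\<close>
lemma mult_op_linear_combination:
  assumes "f \<in> Linf \<Omega>" "\<And>b. b \<in> B \<Longrightarrow> b \<in> Linf \<Omega>" "finite B"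
    "AE x in lebesgue_on \<Omega>. f x = (\<Sum>b\<in>B. c b * b x)"
  shows "mult_op f = (\<Sum>b\<in>B. c b *\<^sub>R mult_op b)"
proof (rule blinfun_eqI)
  fix X
  have s: "sq_on (\<lambda>x. \<Sum>b\<in>A. c b * (b x * rep_l2 X x)) \<and>
    cls (\<lambda>x. \<Sum>b\<in>A. c b * (b x * rep_l2 X x)) = (\<Sum>b\<in>A. c b *\<^sub>R cls (\<lambda>x. b x * rep_l2 X x))"
    if "A \<subseteq> B" for A
    using finite_subset[OF that assms(3)] that
  proof (induction A rule: finite_induct)
    case empty
    then show ?case using sq_on_scaleR[OF sq_on_rep[of X], of 0] cls_scaleR[OF sq_on_rep[of X], of 0] by simp
  next
    case (insert b A)
    have bx: "sq_on (\<lambda>x. b x * rep_l2 X x)" using insert assms by (intro sq_on_mult sq_on_rep) auto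
    then have cb: "sq_on (\<lambda>x. c b * (b x * rep_l2 X x))" "cls (\<lambda>x. c b * (b x * rep_l2 X x)) = c b *\<^sub>R cls (\<lambda>x. b x * rep_l2 X x)"
      using sq_on_scaleR[of _ "c b"] cls_scaleR[of _ "c b"] by fastforce+
    have IH: "sq_on (\<lambda>x. \<Sum>b\<in>A. c b * (b x * rep_l2 X x))"
      "cls (\<lambda>x. \<Sum>b\<in>A. c b * (b x * rep_l2 X x)) = (\<Sum>b\<in>A. c b *\<^sub>R cls (\<lambda>x. b x * rep_l2 X x))"
      using insert by auto
    show ?case using insert.hyps sq_on_add[OF cb(1) IH(1)] cls_add[OF cb(1) IH(1)] cb(2) IH(2) by simp
  qed
  have "blinfun_apply (mult_op f) X = cls (\<lambda>x. \<Sum>b\<in>B. c b * (b x * rep_l2 X x))"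
    unfolding mult_op_apply[OF assms(1)]
  proof (subst cls_eq_iff)
    show "AE x in lebesgue_on \<Omega>. f x * rep_l2 X x = (\<Sum>b\<in>B. c b * (b x * rep_l2 X x))"
      using assms(4) by eventually_elim (simp add: sum_distrib_right mult.assoc)
  qed (use s assms(1) sq_on_mult sq_on_rep in auto)
  also have "\<dots> = blinfun_apply (\<Sum>b\<in>B. c b *\<^sub>R mult_op b) X"
    using s[of B] assms(2) by (simp add: blinfun.sum_left blinfun.scaleR_left mult_op_apply)
  finally show "blinfun_apply (mult_op f) X = blinfun_apply (\<Sum>b\<in>B. c b *\<^sub>R mult_op b) X" .
qed

lemma mult_op_add: "f \<in> Linf \<Omega> \<Longrightarrow> g \<in> Linf \<Omega> \<Longrightarrow> mult_op (\<lambda>x. f x + g x) = mult_op f + mult_op g"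
  by (rule blinfun_eqI) (simp add: mult_op_apply Linf_add blinfun.add_left distrib_right cls_add sq_on_mult sq_on_rep)

lemma mult_op_scale: "f \<in> Linf \<Omega> \<Longrightarrow> mult_op (\<lambda>x. c * f x) = c *\<^sub>R mult_op f"
  by (rule blinfun_eqI)
    (use cls_scaleR[OF sq_on_mult[OF _ sq_on_rep], of f c] in
      \<open>simp add: mult_op_apply Linf_scale blinfun.scaleR_left mult.assoc\<close>)

lemma mult_op_sym:
  assumes "m \<in> Linf \<Omega>"
  shows "blinfun_apply (mult_op m) X \<bullet> Y = X \<bullet> blinfun_apply (mult_op m) Y"
proof -
  have inner_rep: "cls g \<bullet> Z = cls g \<bullet> cls (rep_l2 Z)" if "sq_on g" for g and Z :: "('a, real) l2"
  proof -
    have "cls g \<bullet> Z = abs_l2 (\<lambda>x. indicator \<Omega> x *\<^sub>R g x) \<bullet> abs_l2 (rep_l2 Z)" by (simp add: cls_def)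
    also have "\<dots> = (LINT x|lebesgue. (indicator \<Omega> x *\<^sub>R g x) \<bullet> rep_l2 Z x)"
      using that by (intro abs_l2_inner) (auto simp: sq_on_def square_integrable_rep)
    also have "\<dots> = (LINT x|lebesgue. indicator \<Omega> x *\<^sub>R (g x \<bullet> rep_l2 Z x))"
      by (simp add: mult.assoc)
    also have "\<dots> = cls g \<bullet> cls (rep_l2 Z)"
      using that by (simp add: cls_inner sq_on_rep integral_restrict_space)
    finally show ?thesis .
  qed
  have "blinfun_apply (mult_op m) X \<bullet> Y = (LINT x|lebesgue_on \<Omega>. (m x * rep_l2 X x) \<bullet> rep_l2 Y x)"
    unfolding mult_op_apply[OF assms]
    by (subst inner_rep) (simp_all add: cls_inner sq_on_mult sq_on_rep assms)
  also have "\<dots> = (LINT x|lebesgue_on \<Omega>. (m x * rep_l2 Y x) \<bullet> rep_l2 X x)"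
    by (simp add: ac_simps)
  also have "\<dots> = blinfun_apply (mult_op m) Y \<bullet> X"
    unfolding mult_op_apply[OF assms]
    by (subst inner_rep) (simp_all add: cls_inner sq_on_mult sq_on_rep assms)
  finally show ?thesis by (simp add: inner_commute)
qed

lemma mult_op_lower:
  assumes m: "m \<in> Linf \<Omega>" and lower: "AE x in lebesgue_on \<Omega>. c \<le> m x" and f: "sq_on f"
  shows "c * (norm (cls f))\<^sup>2 \<le> blinfun_apply (mult_op m) (cls f) \<bullet> cls f"
proof -
  have "c * (norm (cls f))\<^sup>2 = (LINT x|lebesgue_on \<Omega>. c * (f x \<bullet> f x))"
    using f by (simp add: power2_norm_eq_inner cls_inner)
  also have "\<dots> \<le> (LINT x|lebesgue_on \<Omega>. (m x * f x) \<bullet> f x)"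
  proof (rule integral_mono_AE)
    show "integrable (lebesgue_on \<Omega>) (\<lambda>x. c * (f x \<bullet> f x))"
      using integrable_inner_on[OF f f] by simp
    show "integrable (lebesgue_on \<Omega>) (\<lambda>x. (m x * f x) \<bullet> f x)"
      by (rule integrable_inner_on[OF sq_on_mult[OF m f] f])
    show "AE x in lebesgue_on \<Omega>. c * (f x \<bullet> f x) \<le> (m x * f x) \<bullet> f x"
      using lower by eventually_elim (simp add: mult.assoc mult_right_mono)
  qed
  also have "\<dots> = blinfun_apply (mult_op m) (cls f) \<bullet> cls f"
    using m f by (simp add: mult_op_cls cls_inner sq_on_mult)
  finally show ?thesis .
qed

text \<open>
  A bounded map that is additive up to null sets respects equality almost everywhere, because it sends a
  function of norm zero to one of norm zero. Hence it acts on classes.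
\<close>
lemma L2_operator_lift:
  assumes T: "bounded_linear_L2 \<Omega> (L2 \<Omega>) (L2_norm \<Omega>) T"
  obtains t where "bounded_linear t" "\<And>f. sq_on f \<Longrightarrow> sq_on (T f)" "\<And>f. sq_on f \<Longrightarrow> cls (T f) = t (cls f)"
    "\<And>X. t X = cls (T (rep_l2 X))"
proof -
  have TL2: "sq_on (T f)" if "sq_on f" for f using T that by (simp add: bounded_linear_L2_def L2_iff)
  obtain M where M: "\<And>f. sq_on f \<Longrightarrow> norm (cls (T f)) \<le> M * norm (cls f)"
    using T unfolding bounded_linear_L2_def by (metis L2_iff norm_cls)
  have add: "cls (T (\<lambda>y. f y + g y)) = cls (T f) + cls (T g)" if fg: "sq_on f" "sq_on g" for f g
  proof -
    have "AE x in lebesgue_on \<Omega>. T (\<lambda>y. f y + g y) x = T f x + T g x"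
      using T fg by (simp add: bounded_linear_L2_def L2_iff)
    then have "cls (T (\<lambda>y. f y + g y)) = cls (\<lambda>x. T f x + T g x)"
      using fg by (subst cls_eq_iff) (auto intro: TL2 sq_on_add)
    then show ?thesis using fg by (simp add: cls_add TL2)
  qed
  have scale: "cls (T (\<lambda>y. c * f y)) = c *\<^sub>R cls (T f)" if f: "sq_on f" for f c
  proof -
    have cf: "sq_on (\<lambda>y. c * f y)" using sq_on_scaleR[OF f, of c] by simp
    have "AE x in lebesgue_on \<Omega>. T (\<lambda>y. c * f y) x = c *\<^sub>R T f x"
      using T f by (simp add: bounded_linear_L2_def L2_iff)
    then have "cls (T (\<lambda>y. c * f y)) = cls (\<lambda>x. c *\<^sub>R T f x)"
      using f cf by (subst cls_eq_iff) (auto intro: TL2 sq_on_scaleR simp del: real_scaleR_def)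
    then show ?thesis using f by (simp only: cls_scaleR TL2)
  qed
  have cong: "cls (T f) = cls (T g)" if f: "sq_on f" and g: "sq_on g" and eq: "cls f = cls g" for f g
  proof -
    have d: "sq_on (\<lambda>y. f y - g y)" using f g by (rule sq_on_diff)
    have "norm (cls (T (\<lambda>y. f y - g y))) \<le> M * norm (cls (\<lambda>y. f y - g y))" by (rule M[OF d])
    then have "cls (T (\<lambda>y. f y - g y)) = 0" using eq by (simp add: cls_diff f g)
    then show ?thesis using add[OF g d] by simp
  qed
  define t where "t X = cls (T (rep_l2 X))" for X
  have t: "cls (T f) = t (cls f)" if "sq_on f" for f
    unfolding t_def using that by (intro cong sq_on_rep) (simp_all add: cls_rep_cls)
  have "bounded_linear t"
  proof (rule bounded_linear_intro[where K = "\<bar>M\<bar>"])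
    interpret P: bounded_linear "\<lambda>X :: ('a, real) l2. cls (rep_l2 X)" by (rule bounded_linear_cls_rep)
    fix X Y :: "('a, real) l2" and c :: real
    have "cls (T (rep_l2 (X + Y))) = cls (T (\<lambda>y. rep_l2 X y + rep_l2 Y y))"
      by (intro cong sq_on_rep sq_on_add) (simp add: P.add cls_add sq_on_rep)
    then show "t (X + Y) = t X + t Y" by (simp add: t_def add sq_on_rep)
    have "sq_on (\<lambda>y. c * rep_l2 X y)" using sq_on_scaleR[OF sq_on_rep[of X], of c] by simp
    then have "cls (T (rep_l2 (c *\<^sub>R X))) = cls (T (\<lambda>y. c * rep_l2 X y))"
      using cls_scaleR[OF sq_on_rep[of X], of c] by (intro cong sq_on_rep) (simp_all add: P.scaleR)
    then show "t (c *\<^sub>R X) = c *\<^sub>R t X" by (simp add: t_def scale sq_on_rep)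
    have "norm (t X) \<le> M * norm (cls (rep_l2 X))" unfolding t_def by (rule M[OF sq_on_rep])
    also have "\<dots> \<le> \<bar>M\<bar> * norm X" by (intro mult_mono cls_rep_norm) auto
    finally show "norm (t X) \<le> norm X * \<bar>M\<bar>" by (simp add: mult.commute)
  qed
  then show ?thesis using that TL2 t t_def by blast
qed

section \<open>Weak gradients and Sobolev spaces\<close>

lemma sq_on_bounded:
  fixes f :: "'a \<Rightarrow> 'b::euclidean_space"
  assumes "f \<in> borel_measurable (lebesgue_on \<Omega>)" "\<And>x. x \<in> \<Omega> \<Longrightarrow> norm (f x) \<le> K"
  shows "sq_on f"
  unfolding sq_on_iff
proof
  have "\<Omega> \<in> lmeasurable" using bounded_\<Omega> open_\<Omega> by (simp add: lmeasurable_open)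
  then interpret finite_measure "lebesgue_on \<Omega>" by (rule finite_measure_lebesgue_on)
  show "integrable (lebesgue_on \<Omega>) (\<lambda>x. (norm (f x))\<^sup>2)"
    by (rule integrable_const_bound[where B = "K\<^sup>2"])
      (use assms in \<open>auto intro!: AE_I2 power_mono simp: space_restrict_space\<close>)
qed (rule assms)

lemma bounded_on_closure:
  fixes f :: "'a \<Rightarrow> 'b::euclidean_space"
  assumes "continuous_on (closure \<Omega>) f"
  obtains K where "\<And>x. x \<in> \<Omega> \<Longrightarrow> norm (f x) \<le> K"
proof -
  have "compact (closure \<Omega>)" using bounded_\<Omega> by (simp add: compact_closure)
  then have "bounded (f ` closure \<Omega>)" using assms compact_continuous_image compact_imp_bounded by blast
  then show ?thesis using that closure_subset by (force simp: bounded_iff)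
qed

lemma measurable_on_continuous:
  fixes f :: "'a \<Rightarrow> 'b::euclidean_space"
  shows "continuous_on \<Omega> f \<Longrightarrow> f \<in> borel_measurable (lebesgue_on \<Omega>)"
  by (rule continuous_imp_measurable_on_sets_lebesgue) auto

lemma sq_on_continuous:
  fixes f :: "'a \<Rightarrow> 'b::euclidean_space"
  assumes "continuous_on (closure \<Omega>) f"
  shows "sq_on f"
proof -
  obtain K where "\<And>x. x \<in> \<Omega> \<Longrightarrow> norm (f x) \<le> K" using bounded_on_closure[OF assms] by blast
  moreover have "continuous_on \<Omega> f" using assms closure_subset by (rule continuous_on_subset)
  ultimately show ?thesis by (intro sq_on_bounded measurable_on_continuous)
qed

lemma sq_on_components: "sq_on g \<longleftrightarrow> (\<forall>i\<in>Basis. sq_on (\<lambda>x. g x \<bullet> i))" for g :: "'a \<Rightarrow> 'a"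
proof
  assume g: "sq_on g"
  show "\<forall>i\<in>Basis. sq_on (\<lambda>x. g x \<bullet> i)"
  proof
    fix i :: 'a assume i: "i \<in> Basis"
    show "sq_on (\<lambda>x. g x \<bullet> i)"
      unfolding sq_on_def
    proof (rule square_integrable_bound[where c = 1])
      show "square_integrable (\<lambda>x. indicator \<Omega> x *\<^sub>R g x)" using g by (simp add: sq_on_def)
      have "(\<lambda>x. g x \<bullet> i) \<in> borel_measurable (lebesgue_on \<Omega>)" using g by (auto simp: sq_on_iff)
      then show "(\<lambda>x. indicator \<Omega> x *\<^sub>R (g x \<bullet> i)) \<in> borel_measurable lebesgue"
        by (simp add: measurable_on_iff)
      show "AE x in lebesgue. norm (indicator \<Omega> x *\<^sub>R (g x \<bullet> i)) \<le> 1 * norm (indicator \<Omega> x *\<^sub>R g x)"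
        using i by (auto simp: indicator_def Basis_le_norm)
    qed
  qed
next
  assume g: "\<forall>i\<in>Basis. sq_on (\<lambda>x. g x \<bullet> i)"
  then have "g \<in> borel_measurable (lebesgue_on \<Omega>)"
    by (subst borel_measurable_euclidean_space) (simp add: sq_on_iff)
  moreover have "integrable (lebesgue_on \<Omega>) (\<lambda>x. \<Sum>i\<in>Basis. (norm (g x \<bullet> i))\<^sup>2)"
    using g by (intro Bochner_Integration.integrable_sum) (simp add: sq_on_iff)
  moreover have "(norm (g x))\<^sup>2 = (\<Sum>i\<in>Basis. (norm (g x \<bullet> i))\<^sup>2)" for x
    unfolding power2_norm_eq_inner euclidean_inner[of "g x" "g x"]
    by (intro sum.cong) (auto simp: power2_eq_square)
  ultimately show "sq_on g" by (simp add: sq_on_iff)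
qed

lemma test_has_derivative: "\<eta> \<in> test_functions \<Omega> \<Longrightarrow> (\<eta> has_derivative frechet_derivative \<eta> (at x)) (at x)"
  using Ck_Suc_has_derivative[of 0 \<eta> x] unfolding test_functions_def by blast

lemma test_continuous: "\<eta> \<in> test_functions \<Omega> \<Longrightarrow> continuous_on UNIV \<eta>"
  unfolding test_functions_def using Ck.simps(1) by blast

lemma test_derivative_continuous:
  assumes "\<eta> \<in> test_functions \<Omega>" "i \<in> Basis"
  shows "continuous_on UNIV (\<lambda>x. frechet_derivative \<eta> (at x) i)"
proof -
  have "Ck (Suc 0) \<eta>" using assms unfolding test_functions_def by blast
  then show ?thesis using assms(2) by simp
qed

lemma sq_on_test:
  assumes "\<eta> \<in> test_functions \<Omega>" "i \<in> Basis"
  shows "sq_on \<eta>" "sq_on (\<lambda>x. frechet_derivative \<eta> (at x) i)" "sq_on (\<lambda>x. \<eta> x *\<^sub>R i)"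
proof -
  have c: "continuous_on (closure \<Omega>) \<eta>"
    using test_continuous[OF assms(1)] continuous_on_subset by blast
  then show "sq_on \<eta>" by (rule sq_on_continuous)
  show "sq_on (\<lambda>x. \<eta> x *\<^sub>R i)" using c by (intro sq_on_continuous continuous_intros)
  show "sq_on (\<lambda>x. frechet_derivative \<eta> (at x) i)"
    using test_derivative_continuous[OF assms] continuous_on_subset by (intro sq_on_continuous) blast
qed

text \<open>
  On classes supported in \<open>\<Omega>\<close> this is the graph of the weak gradient. The defining identities are
  inner products with fixed elements, so they describe a closed subspace.
\<close>
definition weak_pairs :: "(('a, real) l2 \<times> ('a, 'a) l2) set" where
  "weak_pairs = {Z. \<forall>i\<in>Basis. \<forall>\<eta>\<in>test_functions \<Omega>.
     fst Z \<bullet> cls (\<lambda>x. frechet_derivative \<eta> (at x) i) + snd Z \<bullet> cls (\<lambda>x. \<eta> x *\<^sub>R i) = 0}"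

lemma is_weak_gradient_iff:
  assumes u: "sq_on u"
  shows "is_weak_gradient \<Omega> u g \<longleftrightarrow> sq_on g \<and> (cls u, cls g) \<in> weak_pairs"
proof -
  have "(LINT x|lebesgue_on \<Omega>. u x * frechet_derivative \<eta> (at x) i) = - (LINT x|lebesgue_on \<Omega>. (g x \<bullet> i) * \<eta> x)
    \<longleftrightarrow> cls u \<bullet> cls (\<lambda>x. frechet_derivative \<eta> (at x) i) + cls g \<bullet> cls (\<lambda>x. \<eta> x *\<^sub>R i) = 0"
    if "\<eta> \<in> test_functions \<Omega>" "i \<in> Basis" "sq_on g" for \<eta> i
    using u sq_on_test[OF that(1,2)] that(3) by (simp add: cls_inner mult.commute eq_neg_iff_add_eq_0)
  then show ?thesis
    unfolding is_weak_gradient_def weak_pairs_def L2_iff sq_on_components[of g]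
    by (auto simp: sq_on_components[of g])
qed

lemma weak_pairs_closed: "closed weak_pairs"
proof -
  have "weak_pairs = (\<Inter>i\<in>Basis. \<Inter>\<eta>\<in>test_functions \<Omega>. {Z. fst Z \<bullet> cls (\<lambda>x. frechet_derivative \<eta> (at x) i) +
      snd Z \<bullet> cls (\<lambda>x. \<eta> x *\<^sub>R i) = 0})"
    by (auto simp: weak_pairs_def)
  also have "closed \<dots>"
    by (intro closed_INT ballI closed_Collect_eq continuous_intros)
  finally show ?thesis .
qed

lemma weak_pairs_subspace: "subspace weak_pairs"
  unfolding subspace_def weak_pairs_def
  by (auto simp: inner_add_left algebra_simps simp flip: distrib_left)

text \<open>
  Weak gradients are unique. As \<open>weak_gradient\<close> is an arbitrary choice among the weak gradients, the
  linearity of \<open>H1_pair\<close> rests on this.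
\<close>
lemma weak_pairs_zero:
  assumes q: "sq_on q" and 0: "(0, cls q) \<in> weak_pairs"
  shows "cls q = 0"
proof -
  have "AE x in lebesgue. x \<in> \<Omega> \<longrightarrow> q x \<bullet> i = 0" if i: "i \<in> Basis" for i
  proof -
    define f where "f x = indicator \<Omega> x *\<^sub>R (q x \<bullet> i)" for x
    have "sq_on (\<lambda>x. i)" by (intro sq_on_continuous continuous_intros)
    then have "integrable lebesgue f"
      using integrable_inner_on[OF q] by (simp add: f_def[abs_def] integrable_restrict_space)
    then have "AE x in lebesgue. x \<in> \<Omega> \<longrightarrow> f x = 0"
    proof (rule AE_zero_of_test_integrals_zero[OF open_\<Omega>])
      fix \<eta> assume \<eta>: "\<eta> \<in> test_functions \<Omega>"
      have "(LINT x|lebesgue. f x * \<eta> x) = (LINT x|lebesgue_on \<Omega>. q x \<bullet> (\<eta> x *\<^sub>R i))"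
        by (simp add: integral_restrict_space f_def ac_simps)
      also have "\<dots> = cls q \<bullet> cls (\<lambda>x. \<eta> x *\<^sub>R i)" using q sq_on_test[OF \<eta> i] by (simp add: cls_inner)
      also have "\<dots> = 0" using 0 \<eta> i by (simp add: weak_pairs_def)
      finally show "(LINT x|lebesgue. f x * \<eta> x) = 0" .
    qed
    then show ?thesis by eventually_elim (simp add: f_def)
  qed
  then have "AE x in lebesgue. \<forall>i\<in>Basis. x \<in> \<Omega> \<longrightarrow> q x \<bullet> i = 0"
    by (subst AE_finite_all) auto
  then have "AE x in lebesgue_on \<Omega>. q x = 0"
    unfolding AE_on_iff by eventually_elim (auto simp: euclidean_eq_iff[of "q _"])
  then have "cls q = cls (\<lambda>x. 0)"
    using q by (subst cls_eq_iff) (auto intro: sq_on_continuous)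
  also have "\<dots> = 0" using cls_scaleR[OF q, of 0] by simp
  finally show ?thesis .
qed

definition H1_pair :: "('a \<Rightarrow> real) \<Rightarrow> ('a, real) l2 \<times> ('a, 'a) l2" where
  "H1_pair u = (cls u, cls (weak_gradient \<Omega> u))"

lemma H1_D:
  assumes "u \<in> H1 \<Omega>"
  shows "sq_on u" "sq_on (weak_gradient \<Omega> u)" "H1_pair u \<in> weak_pairs"
proof -
  show u: "sq_on u" using assms by (simp add: H1_def L2_iff)
  have "is_weak_gradient \<Omega> u (weak_gradient \<Omega> u)"
    using assms someI[of "is_weak_gradient \<Omega> u"] unfolding H1_def weak_gradient_def by blast
  then show "sq_on (weak_gradient \<Omega> u)" "H1_pair u \<in> weak_pairs"
    by (auto simp: is_weak_gradient_iff[OF u] H1_pair_def)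
qed

lemma H1_I:
  assumes "sq_on u" "sq_on g" "(cls u, cls g) \<in> weak_pairs"
  shows "u \<in> H1 \<Omega>" "H1_pair u = (cls u, cls g)"
proof -
  show u: "u \<in> H1 \<Omega>" using assms is_weak_gradient_iff[OF assms(1)] by (auto simp: H1_def L2_iff)
  note w = H1_D[OF u]
  have "(cls u, cls (weak_gradient \<Omega> u)) - (cls u, cls g) \<in> weak_pairs"
    using subspace_diff[OF weak_pairs_subspace w(3) assms(3)] by (simp only: H1_pair_def)
  then have "(0, cls (\<lambda>x. weak_gradient \<Omega> u x - g x)) \<in> weak_pairs"
    using w assms by (simp add: cls_diff)
  then have "cls (\<lambda>x. weak_gradient \<Omega> u x - g x) = 0"
    using w assms by (intro weak_pairs_zero sq_on_diff)
  then show "H1_pair u = (cls u, cls g)" using w assms by (simp add: H1_pair_def cls_diff)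
qed

lemma H1_pair_linear_combination:
  assumes u: "u \<in> H1 \<Omega>" and v: "v \<in> H1 \<Omega>"
  shows "(\<lambda>x. a * u x + b * v x) \<in> H1 \<Omega>" "H1_pair (\<lambda>x. a * u x + b * v x) = a *\<^sub>R H1_pair u + b *\<^sub>R H1_pair v"
proof -
  let ?g = "\<lambda>x. a *\<^sub>R weak_gradient \<Omega> u x + b *\<^sub>R weak_gradient \<Omega> v x"
  note u' = H1_D[OF u] and v' = H1_D[OF v]
  have s: "sq_on (\<lambda>x. a *\<^sub>R u x + b *\<^sub>R v x)" "sq_on ?g"
    by (intro sq_on_add sq_on_scaleR u' v')+
  have "(cls (\<lambda>x. a *\<^sub>R u x + b *\<^sub>R v x), cls ?g) = a *\<^sub>R H1_pair u + b *\<^sub>R H1_pair v"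
    using u' v' by (simp only: cls_add sq_on_scaleR cls_scaleR H1_pair_def) simp
  moreover have "a *\<^sub>R H1_pair u + b *\<^sub>R H1_pair v \<in> weak_pairs"
    using u' v' weak_pairs_subspace by (simp add: subspace_add subspace_scale)
  ultimately show "(\<lambda>x. a * u x + b * v x) \<in> H1 \<Omega>" "H1_pair (\<lambda>x. a * u x + b * v x) = a *\<^sub>R H1_pair u + b *\<^sub>R H1_pair v"
    using H1_I[OF s] by simp_all
qed

lemma H1_pair_diff:
  assumes "u \<in> H1 \<Omega>" "v \<in> H1 \<Omega>"
  shows "(\<lambda>x. u x - v x) \<in> H1 \<Omega>" "H1_pair (\<lambda>x. u x - v x) = H1_pair u - H1_pair v"
  using H1_pair_linear_combination[OF assms, of 1 "-1"] by simp_all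

lemma H1_norm_eq:
  assumes "u \<in> H1 \<Omega>"
  shows "H1_norm \<Omega> u = norm (H1_pair u)"
proof -
  note u = H1_D[OF assms]
  have "(L2_norm \<Omega> u)\<^sup>2 = (norm (cls u))\<^sup>2" using u by (simp add: norm_cls L2_iff)
  moreover have "(LINT x|lebesgue_on \<Omega>. (norm (weak_gradient \<Omega> u x))\<^sup>2) = (norm (cls (weak_gradient \<Omega> u)))\<^sup>2"
    using u by (simp add: norm_cls_eq)
  ultimately show ?thesis by (simp add: H1_norm_def H1_pair_def norm_Pair)
qed

text \<open>
  The product of \<open>u\<close> with a test function, extended by zero, is differentiable on the whole space, because
  the test function vanishes near every point outside \<open>\<Omega>\<close>. Its partial derivatives have integral zero.
\<close>
lemma C1_weak_gradient:
  assumes u: "continuous_on (closure \<Omega>) u"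
    and der: "\<And>x. x \<in> \<Omega> \<Longrightarrow> (u has_derivative (\<lambda>h. G x \<bullet> h)) (at x)"
    and G: "continuous_on \<Omega> G" "\<And>x. x \<in> \<Omega> \<Longrightarrow> norm (G x) \<le> K"
  shows "u \<in> H1 \<Omega>" "H1_pair u = (cls u, cls G)"
proof -
  have su: "sq_on u" using u by (rule sq_on_continuous)
  have sG: "sq_on G" using G by (intro sq_on_bounded measurable_on_continuous) auto
  obtain Ku where Ku: "\<And>x. x \<in> \<Omega> \<Longrightarrow> norm (u x) \<le> Ku" using bounded_on_closure[OF u] by blast
  have "cls u \<bullet> cls (\<lambda>x. frechet_derivative \<eta> (at x) i) + cls G \<bullet> cls (\<lambda>x. \<eta> x *\<^sub>R i) = 0"
    if i: "i \<in> Basis" and \<eta>: "\<eta> \<in> test_functions \<Omega>" for i \<eta>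
  proof -
    let ?\<eta>' = "\<lambda>x. frechet_derivative \<eta> (at x)"
    have supp: "closure {x. \<eta> x \<noteq> 0} \<subseteq> \<Omega>" using \<eta> by (simp add: test_functions_def)
    have cl: "continuous_on (closure \<Omega>) \<eta>" "continuous_on (closure \<Omega>) (\<lambda>x. ?\<eta>' x i)"
      using test_continuous[OF \<eta>] test_derivative_continuous[OF \<eta> i] continuous_on_subset by blast+
    obtain K1 where K1: "\<And>x. x \<in> \<Omega> \<Longrightarrow> norm (\<eta> x) \<le> K1" using bounded_on_closure[OF cl(1)] by blast
    obtain K2 where K2: "\<And>x. x \<in> \<Omega> \<Longrightarrow> norm (?\<eta>' x i) \<le> K2" using bounded_on_closure[OF cl(2)] by blast
    define f where "f x = (if x \<in> \<Omega> then u x * \<eta> x else 0)" for x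
    define D where "D x h = (if x \<in> \<Omega> then u x * ?\<eta>' x h + (G x \<bullet> h) * \<eta> x else 0)" for x h
    have fD: "(f has_derivative D x) (at x)" for x
    proof (cases "x \<in> \<Omega>")
      case True
      have "((\<lambda>x. u x * \<eta> x) has_derivative D x) (at x)"
        using has_derivative_mult[OF der[OF True] test_has_derivative[OF \<eta>, of x]] True
        by (simp add: D_def[abs_def])
      then show ?thesis
        by (rule has_derivative_transform_within_open[OF _ open_\<Omega> True]) (simp add: f_def)
    next
      case False
      have "((\<lambda>x. 0) has_derivative D x) (at x)" using False by (simp add: D_def[abs_def])
      moreover have "open (- closure {x. \<eta> x \<noteq> 0})" by (intro open_Compl closed_closure)
      moreover have "x \<in> - closure {x. \<eta> x \<noteq> 0}" using False supp by blast
      ultimately show ?thesis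
      proof (rule has_derivative_transform_within_open)
        fix y assume "y \<in> - closure {x. \<eta> x \<noteq> 0}"
        then have "\<eta> y = 0" using closure_subset[of "{x. \<eta> x \<noteq> 0}"] by auto
        then show "0 = f y" by (simp add: f_def)
      qed
    qed
    have "\<bar>D x i\<bar> \<le> \<bar>Ku\<bar> * \<bar>K2\<bar> + \<bar>K\<bar> * \<bar>K1\<bar>" for x
    proof (cases "x \<in> \<Omega>")
      case True
      have "\<bar>G x \<bullet> i\<bar> \<le> norm (G x)" using i by (rule Basis_le_norm)
      then have "\<bar>G x \<bullet> i\<bar> \<le> \<bar>K\<bar>" using G(2)[OF True] by linarith
      moreover have "\<bar>u x\<bar> \<le> \<bar>Ku\<bar>" "\<bar>?\<eta>' x i\<bar> \<le> \<bar>K2\<bar>" "\<bar>\<eta> x\<bar> \<le> \<bar>K1\<bar>"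
        using Ku[OF True] K1[OF True] K2[OF True] by simp_all
      ultimately have "\<bar>u x * ?\<eta>' x i\<bar> + \<bar>(G x \<bullet> i) * \<eta> x\<bar> \<le> \<bar>Ku\<bar> * \<bar>K2\<bar> + \<bar>K\<bar> * \<bar>K1\<bar>"
        unfolding abs_mult by (intro add_mono mult_mono) auto
      moreover have "D x i = u x * ?\<eta>' x i + (G x \<bullet> i) * \<eta> x" using True by (simp add: D_def)
      ultimately show ?thesis using abs_triangle_ineq[of "u x * ?\<eta>' x i" "(G x \<bullet> i) * \<eta> x"] by linarith
    qed (simp add: D_def)
    moreover have "bounded {x. f x \<noteq> 0}"
      by (rule bounded_subset[OF bounded_\<Omega>]) (auto simp: f_def split: if_splits)
    ultimately have "(LINT x|lebesgue. D x i) = 0"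
      using fD integral_directional_derivative_zero by blast
    moreover have "(LINT x|lebesgue. D x i) = (LINT x|lebesgue_on \<Omega>. u x \<bullet> ?\<eta>' x i + G x \<bullet> (\<eta> x *\<^sub>R i))"
      unfolding integral_restrict_space[of \<Omega> lebesgue, simplified]
      by (intro Bochner_Integration.integral_cong) (auto simp: D_def indicator_def mult.commute)
    moreover have "\<dots> = cls u \<bullet> cls (\<lambda>x. ?\<eta>' x i) + cls G \<bullet> cls (\<lambda>x. \<eta> x *\<^sub>R i)"
      using su sG sq_on_test[OF \<eta> i]
      by (simp only: cls_inner Bochner_Integration.integral_add integrable_inner_on)
    ultimately show ?thesis by simp
  qed
  then have "(cls u, cls G) \<in> weak_pairs" by (simp add: weak_pairs_def)
  from H1_I[OF su sG this] show "u \<in> H1 \<Omega>" "H1_pair u = (cls u, cls G)" .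
qed

lemma test_H1:
  assumes \<eta>: "\<eta> \<in> test_functions \<Omega>"
  shows "\<eta> \<in> H1 \<Omega>"
proof -
  define G where "G x = (\<Sum>i\<in>Basis. frechet_derivative \<eta> (at x) i *\<^sub>R i)" for x
  have cG: "continuous_on UNIV G"
    unfolding G_def using test_derivative_continuous[OF \<eta>] by (intro continuous_intros)
  have "frechet_derivative \<eta> (at x) h = G x \<bullet> h" for x h
  proof -
    interpret linear "frechet_derivative \<eta> (at x)"
      using test_has_derivative[OF \<eta>] by (rule has_derivative_linear)
    have "frechet_derivative \<eta> (at x) h = frechet_derivative \<eta> (at x) (\<Sum>i\<in>Basis. (h \<bullet> i) *\<^sub>R i)"
      by (simp add: euclidean_representation)
    also have "\<dots> = G x \<bullet> h" by (simp add: G_def sum scale inner_sum_left inner_commute[of h] mult.commute)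
    finally show ?thesis .
  qed
  then have der: "(\<eta> has_derivative (\<lambda>h. G x \<bullet> h)) (at x)" for x
    using test_has_derivative[OF \<eta>, of x] by (metis (no_types, lifting) ext)
  obtain K where K: "\<And>x. x \<in> \<Omega> \<Longrightarrow> norm (G x) \<le> K"
    using bounded_on_closure[OF continuous_on_subset[OF cG subset_UNIV]] by blast
  show ?thesis
    by (rule C1_weak_gradient(1)[OF continuous_on_subset[OF test_continuous[OF \<eta>] subset_UNIV]
          der continuous_on_subset[OF cG subset_UNIV] K])
qed

lemma test_functions_linear_combination:
  assumes \<eta>: "\<eta> \<in> test_functions \<Omega>" and \<zeta>: "\<zeta> \<in> test_functions \<Omega>"
  shows "(\<lambda>x. a * \<eta> x + b * \<zeta> x) \<in> test_functions \<Omega>"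
proof -
  let ?f = "\<lambda>x. a * \<eta> x + b * \<zeta> x"
  let ?S = "closure {x. \<eta> x \<noteq> 0} \<union> closure {x. \<zeta> x \<noteq> 0}"
  have "{x. ?f x \<noteq> 0} \<subseteq> {x. \<eta> x \<noteq> 0} \<union> {x. \<zeta> x \<noteq> 0}" by auto
  also have "\<dots> \<subseteq> ?S" by (intro Un_mono closure_subset)
  finally have sub: "closure {x. ?f x \<noteq> 0} \<subseteq> ?S" by (intro closure_minimal) auto
  have S: "compact ?S" "?S \<subseteq> \<Omega>" using \<eta> \<zeta> by (auto simp: test_functions_def)
  have "?S \<inter> closure {x. ?f x \<noteq> 0} = closure {x. ?f x \<noteq> 0}" using sub by (rule Int_absorb1)
  then have "compact (closure {x. ?f x \<noteq> 0})"
    using compact_Int_closed[OF S(1) closed_closure[of "{x. ?f x \<noteq> 0}"]] by (simp only:)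
  moreover have "Ck k ?f" for k
    using \<eta> \<zeta> by (intro Ck_add Ck_mult Ck_const) (auto simp: test_functions_def)
  ultimately show ?thesis using sub S by (auto simp: test_functions_def)
qed

definition H10_pairs :: "(('a, real) l2 \<times> ('a, 'a) l2) set" where
  "H10_pairs = closure (H1_pair ` test_functions \<Omega>)"

lemma closed_H10_pairs: "closed H10_pairs"
  by (simp add: H10_pairs_def)

lemma subspace_H10_pairs: "subspace H10_pairs"
proof -
  have comb: "a *\<^sub>R Z + b *\<^sub>R Z' \<in> H10_pairs" if Z: "Z \<in> H10_pairs" "Z' \<in> H10_pairs" for a b Z Z'
  proof -
    obtain X X' where X: "\<And>n. X n \<in> H1_pair ` test_functions \<Omega>" "X \<longlonglongrightarrow> Z"
      and X': "\<And>n. X' n \<in> H1_pair ` test_functions \<Omega>" "X' \<longlonglongrightarrow> Z'"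
      using Z unfolding H10_pairs_def closure_sequential by blast
    have "a *\<^sub>R X n + b *\<^sub>R X' n \<in> H1_pair ` test_functions \<Omega>" for n
    proof -
      obtain \<eta> \<zeta> where \<eta>: "\<eta> \<in> test_functions \<Omega>" "X n = H1_pair \<eta>" and \<zeta>: "\<zeta> \<in> test_functions \<Omega>" "X' n = H1_pair \<zeta>"
        using X(1)[of n] X'(1)[of n] by blast
      then have "a *\<^sub>R X n + b *\<^sub>R X' n = H1_pair (\<lambda>x. a * \<eta> x + b * \<zeta> x)"
        by (simp add: H1_pair_linear_combination test_H1)
      then show ?thesis using test_functions_linear_combination[OF \<eta>(1) \<zeta>(1)] by blast
    qed
    moreover have "(\<lambda>n. a *\<^sub>R X n + b *\<^sub>R X' n) \<longlonglongrightarrow> a *\<^sub>R Z + b *\<^sub>R Z'"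
      by (intro tendsto_intros X X')
    ultimately show ?thesis unfolding H10_pairs_def closure_sequential
      by (intro exI[of _ "\<lambda>n. a *\<^sub>R X n + b *\<^sub>R X' n"] conjI allI)
  qed
  have "(\<lambda>x. 0) \<in> test_functions \<Omega>" by (auto simp: test_functions_def Ck_const)
  then have "H1_pair (\<lambda>x. 0) \<in> H10_pairs" unfolding H10_pairs_def by (intro subsetD[OF closure_subset] imageI)
  from comb[OF this this, of 0 0] have zero: "0 \<in> H10_pairs" by simp
  show ?thesis
    unfolding subspace_def
  proof (intro conjI ballI allI zero)
    show "Z + Z' \<in> H10_pairs" if "Z \<in> H10_pairs" "Z' \<in> H10_pairs" for Z Z'
      using comb[OF that, of 1 1] by simp
    show "c *\<^sub>R Z \<in> H10_pairs" if "Z \<in> H10_pairs" for c Z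
      using comb[OF that that, of c 0] by simp
  qed
qed

lemma H10_iff: "u \<in> H10 \<Omega> \<longleftrightarrow> u \<in> H1 \<Omega> \<and> H1_pair u \<in> H10_pairs"
proof -
  have "(\<lambda>n. H1_norm \<Omega> (\<lambda>x. \<eta> n x - u x)) \<longlonglongrightarrow> 0 \<longleftrightarrow> (\<lambda>n. H1_pair (\<eta> n)) \<longlonglongrightarrow> H1_pair u"
    if "u \<in> H1 \<Omega>" "\<And>n. \<eta> n \<in> test_functions \<Omega>" for \<eta> :: "nat \<Rightarrow> 'a \<Rightarrow> real"
    using that by (simp add: H1_norm_eq H1_pair_diff test_H1 tendsto_norm_zero_iff LIM_zero_iff)
  moreover have "H1_pair u \<in> H10_pairs \<longleftrightarrow>
      (\<exists>\<eta> :: nat \<Rightarrow> 'a \<Rightarrow> real. (\<forall>n. \<eta> n \<in> test_functions \<Omega>) \<and> (\<lambda>n. H1_pair (\<eta> n)) \<longlonglongrightarrow> H1_pair u)"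
  proof
    assume "H1_pair u \<in> H10_pairs"
    then obtain X where X: "\<And>n. X n \<in> H1_pair ` test_functions \<Omega>" "X \<longlonglongrightarrow> H1_pair u"
      unfolding H10_pairs_def closure_sequential by blast
    then have "\<forall>n. \<exists>\<eta>. \<eta> \<in> test_functions \<Omega> \<and> X n = H1_pair \<eta>" by blast
    then obtain \<eta> where \<eta>: "\<forall>n. \<eta> n \<in> test_functions \<Omega> \<and> X n = H1_pair (\<eta> n)"
      by (auto dest!: choice)
    then have "X = (\<lambda>n. H1_pair (\<eta> n))" by auto
    then show "\<exists>\<eta> :: nat \<Rightarrow> 'a \<Rightarrow> real. (\<forall>n. \<eta> n \<in> test_functions \<Omega>) \<and> (\<lambda>n. H1_pair (\<eta> n)) \<longlonglongrightarrow> H1_pair u"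
      using X(2) \<eta> by blast
  next
    assume "\<exists>\<eta> :: nat \<Rightarrow> 'a \<Rightarrow> real. (\<forall>n. \<eta> n \<in> test_functions \<Omega>) \<and> (\<lambda>n. H1_pair (\<eta> n)) \<longlonglongrightarrow> H1_pair u"
    then obtain \<eta> :: "nat \<Rightarrow> 'a \<Rightarrow> real"
      where "\<forall>n. \<eta> n \<in> test_functions \<Omega>" "(\<lambda>n. H1_pair (\<eta> n)) \<longlonglongrightarrow> H1_pair u" by blast
    then show "H1_pair u \<in> H10_pairs"
      unfolding H10_pairs_def closure_sequential
      by (intro exI[of _ "\<lambda>n. H1_pair (\<eta> n)"]) auto
  qed
  ultimately show ?thesis unfolding H10_def by blast
qed

text \<open>
  The closure of the test functions stays inside the graph of the weak gradient and inside the classes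
  supported in \<open>\<Omega>\<close>, so that its elements again come from functions in \<open>H\<^sup>1\<^sub>0(\<Omega>)\<close>.
\<close>
lemma H10_pairs_weak_pairs:
  assumes "Z \<in> H10_pairs"
  shows "Z \<in> weak_pairs" "cls (rep_l2 (fst Z)) = fst Z" "cls (rep_l2 (snd Z)) = snd Z"
proof -
  let ?C = "weak_pairs \<inter> {Z. cls (rep_l2 (fst Z)) = fst Z} \<inter> {Z. cls (rep_l2 (snd Z)) = snd Z}"
  have "closed {Z :: ('a, real) l2 \<times> ('a, 'a) l2. cls (rep_l2 (fst Z)) = fst Z}"
    by (intro closed_Collect_eq bounded_linear.continuous_on[OF bounded_linear_cls_rep] continuous_intros)
  moreover have "closed {Z :: ('a, real) l2 \<times> ('a, 'a) l2. cls (rep_l2 (snd Z)) = snd Z}"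
    by (intro closed_Collect_eq bounded_linear.continuous_on[OF bounded_linear_cls_rep] continuous_intros)
  ultimately have "closed ?C" using weak_pairs_closed by blast
  moreover have "H1_pair ` test_functions \<Omega> \<subseteq> ?C"
    using H1_D[OF test_H1] by (auto simp: H1_pair_def cls_rep_cls)
  ultimately have "H10_pairs \<subseteq> ?C" unfolding H10_pairs_def by (intro closure_minimal)
  then show "Z \<in> weak_pairs" "cls (rep_l2 (fst Z)) = fst Z" "cls (rep_l2 (snd Z)) = snd Z"
    using assms by auto
qed

lemma H1_pair_surj:
  assumes "Z \<in> weak_pairs" "cls (rep_l2 (fst Z)) = fst Z" "cls (rep_l2 (snd Z)) = snd Z"
  obtains u where "u \<in> H1 \<Omega>" "H1_pair u = Z"
proof -
  have "(cls (rep_l2 (fst Z)), cls (rep_l2 (snd Z))) \<in> weak_pairs" using assms by simp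
  from H1_I[OF sq_on_rep sq_on_rep this] that[of "rep_l2 (fst Z)"] assms show ?thesis by simp
qed

text \<open>
  Hoelder continuity makes the gradient continuous, and bounded since \<open>\<Omega>\<close> is bounded.
\<close>
lemma C1_holder_H1:
  assumes \<alpha>: "\<alpha> > 0" and \<phi>: "C1_holder \<alpha> \<Omega> \<phi>"
  shows "\<phi> \<in> H1 \<Omega>"
proof -
  obtain G M where cont: "continuous_on (closure \<Omega>) \<phi>"
    and der: "\<And>x. x \<in> \<Omega> \<Longrightarrow> (\<phi> has_derivative (\<lambda>h. G x \<bullet> h)) (at x)"
    and M: "\<And>x y. x \<in> \<Omega> \<Longrightarrow> y \<in> \<Omega> \<Longrightarrow> norm (G x - G y) \<le> M * norm (x - y) powr \<alpha>"
    using \<phi> unfolding C1_holder_def by metis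
  have "continuous_on \<Omega> G"
    unfolding continuous_on_def
  proof
    fix x assume x: "x \<in> \<Omega>"
    have "((\<lambda>y. norm (y - x)) \<longlongrightarrow> norm (x - x)) (at x within \<Omega>)" by (intro tendsto_intros)
    then have "((\<lambda>y. M * norm (y - x) powr \<alpha>) \<longlongrightarrow> M * 0) (at x within \<Omega>)"
      using \<alpha> by (intro tendsto_mult tendsto_const tendsto_zero_powrI[where b = \<alpha>]) auto
    then have lim: "((\<lambda>y. M * norm (y - x) powr \<alpha>) \<longlongrightarrow> 0) (at x within \<Omega>)" by simp
    have "\<forall>\<^sub>F y in at x within \<Omega>. norm (G y - G x) \<le> M * norm (y - x) powr \<alpha>"
      using M[OF _ x] by (auto simp: eventually_at_filter)
    then have "((\<lambda>y. G y - G x) \<longlongrightarrow> 0) (at x within \<Omega>)" using lim by (rule Lim_null_comparison)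
    then show "(G \<longlongrightarrow> G x) (at x within \<Omega>)" by (rule LIM_zero_cancel)
  qed
  moreover obtain K where "\<And>x. x \<in> \<Omega> \<Longrightarrow> norm (G x) \<le> K"
  proof -
    obtain x0 where x0: "x0 \<in> \<Omega>" using nonempty_\<Omega> by blast
    obtain R where R: "\<And>x. x \<in> \<Omega> \<Longrightarrow> norm (x - x0) \<le> R"
      using bounded_\<Omega> by (metis bounded_any_center dist_norm norm_minus_commute)
    have "norm (G x) \<le> norm (G x0) + \<bar>M\<bar> * R powr \<alpha>" if x: "x \<in> \<Omega>" for x
    proof -
      have "norm (x - x0) powr \<alpha> \<le> R powr \<alpha>" using R[OF x] \<alpha> by (intro powr_mono2) auto
      then have "M * norm (x - x0) powr \<alpha> \<le> \<bar>M\<bar> * R powr \<alpha>" by (intro mult_mono) auto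
      then show ?thesis using M[OF x x0] norm_triangle_ineq2[of "G x" "G x0"] by linarith
    qed
    then show ?thesis using that by blast
  qed
  ultimately show ?thesis by (intro C1_weak_gradient(1)[OF cont der])
qed

end

section \<open>The boundary value problem\<close>

locale boundary_problem = bounded_open_set \<Omega> for \<Omega> :: "'a::euclidean_space set" +
  fixes \<phi> :: "'a \<Rightarrow> real"
  assumes \<phi>_H1: "\<phi> \<in> H1 \<Omega>"
begin

sublocale dirichlet_form H10_pairs "H1_pair \<phi>"
  by unfold_locales (rule subspace_H10_pairs, rule closed_H10_pairs)

text \<open>
  Links the integrals that define a weak solution with the abstract form, for which existence and uniqueness
  are known.
\<close>
lemma weak_form_eq_energy:
  assumes \<mu>: "\<mu> \<in> Linf \<Omega>" and u: "u \<in> H1 \<Omega>" and v: "v \<in> H1 \<Omega>"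
  shows "(LINT x|lebesgue_on \<Omega>. weak_gradient \<Omega> u x \<bullet> weak_gradient \<Omega> v x + \<mu> x * u x * v x) =
    energy (mult_op \<mu>) (H1_pair u) (H1_pair v)"
proof -
  note u' = H1_D[OF u] and v' = H1_D[OF v]
  note mu = sq_on_mult[OF \<mu> u'(1)]
  have "(LINT x|lebesgue_on \<Omega>. weak_gradient \<Omega> u x \<bullet> weak_gradient \<Omega> v x + (\<mu> x * u x) \<bullet> v x) =
      cls (weak_gradient \<Omega> u) \<bullet> cls (weak_gradient \<Omega> v) + cls (\<lambda>x. \<mu> x * u x) \<bullet> cls v"
    using u' v' mu by (simp only: Bochner_Integration.integral_add integrable_inner_on cls_inner)
  then show ?thesis
    using u' \<mu> by (simp add: energy_def H1_pair_def mult_op_cls inner_prod_def)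
qed

lemma is_weak_solution_iff:
  assumes \<mu>: "\<mu> \<in> Linf \<Omega>"
  shows "is_weak_solution \<Omega> \<phi> \<mu> u \<longleftrightarrow>
    u \<in> H1 \<Omega> \<and> H1_pair u - H1_pair \<phi> \<in> H10_pairs \<and> (\<forall>Z\<in>H10_pairs. energy (mult_op \<mu>) (H1_pair u) Z = 0)"
proof (cases "u \<in> H1 \<Omega>")
  case True
  have "(\<lambda>x. u x - \<phi> x) \<in> H10 \<Omega> \<longleftrightarrow> H1_pair u - H1_pair \<phi> \<in> H10_pairs"
    using H1_pair_diff[OF True \<phi>_H1] by (simp add: H10_iff)
  moreover have "(\<forall>v\<in>H10 \<Omega>. (LINT x|lebesgue_on \<Omega>.
      weak_gradient \<Omega> u x \<bullet> weak_gradient \<Omega> v x + \<mu> x * u x * v x) = 0) \<longleftrightarrow>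
      (\<forall>Z\<in>H10_pairs. energy (mult_op \<mu>) (H1_pair u) Z = 0)" (is "?L = ?R")
  proof
    assume L: ?L
    show ?R
    proof
      fix Z assume Z: "Z \<in> H10_pairs"
      obtain v where v: "v \<in> H1 \<Omega>" "H1_pair v = Z" using H1_pair_surj[OF H10_pairs_weak_pairs[OF Z]] .
      then show "energy (mult_op \<mu>) (H1_pair u) Z = 0"
        using L Z weak_form_eq_energy[OF \<mu> True v(1)] by (simp add: H10_iff)
    qed
  next
    assume ?R
    then show ?L using weak_form_eq_energy[OF \<mu> True] by (simp add: H10_iff)
  qed
  ultimately show ?thesis using True by (simp add: is_weak_solution_def)
qed (simp add: is_weak_solution_def)

text \<open>
  The gradient term controls the second component, the lower bound on \<open>\<mu>\<close> the first.
\<close>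
lemma coercive_mult_op:
  assumes \<mu>: "\<mu> \<in> Linf \<Omega>" "AE x in lebesgue_on \<Omega>. c \<le> \<mu> x"
  shows "coercive (min 1 c) (mult_op \<mu>)"
  unfolding coercive_def
proof (intro conjI allI ballI mult_op_sym \<mu>)
  fix z assume z: "z \<in> H10_pairs"
  have "c * (norm (fst z))\<^sup>2 \<le> blinfun_apply (mult_op \<mu>) (fst z) \<bullet> fst z"
    using mult_op_lower[OF \<mu> sq_on_rep, of "fst z"] H10_pairs_weak_pairs(2)[OF z] by simp
  moreover have "min 1 c * (norm (fst z))\<^sup>2 \<le> c * (norm (fst z))\<^sup>2" by (intro mult_right_mono) auto
  moreover have "min 1 c * (norm (snd z))\<^sup>2 \<le> 1 * (norm (snd z))\<^sup>2" by (intro mult_right_mono) auto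
  moreover have "(norm z)\<^sup>2 = (norm (fst z))\<^sup>2 + (norm (snd z))\<^sup>2"
    by (cases z) (simp add: norm_Pair)
  ultimately show "min 1 c * (norm z)\<^sup>2 \<le> energy (mult_op \<mu>) z z"
    by (simp add: energy_def inner_prod_def power2_norm_eq_inner distrib_left)
qed

context
  fixes \<mu> c
  assumes \<mu>: "\<mu> \<in> Linf \<Omega>" "AE x in lebesgue_on \<Omega>. c \<le> \<mu> x" and c: "c > 0"
begin

lemma is_weak_solution_iff_state:
  "is_weak_solution \<Omega> \<phi> \<mu> u \<longleftrightarrow> u \<in> H1 \<Omega> \<and> H1_pair u = state (mult_op \<mu>)"
proof -
  have co: "coercive (min 1 c) (mult_op \<mu>)" "min 1 c > 0" using coercive_mult_op[OF \<mu>] c by auto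
  show ?thesis
    unfolding is_weak_solution_iff[OF \<mu>(1)]
    using state_eqI[OF co, of "H1_pair u"] state_diff_in[OF co] energy_state[OF co] by metis
qed

lemma weak_solution_exists: "\<exists>u. is_weak_solution \<Omega> \<phi> \<mu> u"
proof -
  have co: "coercive (min 1 c) (mult_op \<mu>)" "min 1 c > 0" using coercive_mult_op[OF \<mu>] c by auto
  obtain w where w: "w \<in> H1 \<Omega>" "H1_pair w = state (mult_op \<mu>) - H1_pair \<phi>"
    using H1_pair_surj[OF H10_pairs_weak_pairs[OF state_diff_in[OF co]]] .
  then have "(\<lambda>x. 1 * w x + 1 * \<phi> x) \<in> H1 \<Omega>" "H1_pair (\<lambda>x. 1 * w x + 1 * \<phi> x) = state (mult_op \<mu>)"
    using H1_pair_linear_combination[OF w(1) \<phi>_H1, of 1 1] by simp_all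
  then show ?thesis using is_weak_solution_iff_state by blast
qed

lemma weak_solution_unique:
  assumes "is_weak_solution \<Omega> \<phi> \<mu> u" "is_weak_solution \<Omega> \<phi> \<mu> v"
  shows "AE x in lebesgue_on \<Omega>. v x = u x"
proof -
  have uv: "u \<in> H1 \<Omega>" "v \<in> H1 \<Omega>" and "H1_pair v = H1_pair u"
    using assms by (simp_all add: is_weak_solution_iff_state)
  then have "cls v = cls u" by (simp add: H1_pair_def)
  with uv show ?thesis using H1_D(1) by (simp add: cls_eq_iff)
qed

lemma data_map_eq_data_op:
  "sq_on (data_map \<Omega> \<phi> \<mu>)" "cls (data_map \<Omega> \<phi> \<mu>) = data_op (mult_op \<mu>)"
proof -
  have "is_weak_solution \<Omega> \<phi> \<mu> (weak_solution \<Omega> \<phi> \<mu>)"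
    unfolding weak_solution_def using weak_solution_exists by (rule someI_ex)
  then have u: "weak_solution \<Omega> \<phi> \<mu> \<in> H1 \<Omega>" "H1_pair (weak_solution \<Omega> \<phi> \<mu>) = state (mult_op \<mu>)"
    by (simp_all add: is_weak_solution_iff_state)
  note s = H1_D(1)[OF u(1)]
  show "sq_on (data_map \<Omega> \<phi> \<mu>)" unfolding data_map_def by (rule sq_on_mult[OF \<mu>(1) s])
  have "fst (H1_pair u) = cls u" for u by (simp add: H1_pair_def)
  from this[of "weak_solution \<Omega> \<phi> \<mu>"] have "fst (state (mult_op \<mu>)) = cls (weak_solution \<Omega> \<phi> \<mu>)"
    unfolding u(2) .
  then show "cls (data_map \<Omega> \<phi> \<mu>) = data_op (mult_op \<mu>)"
    unfolding data_map_def data_op_def using mult_op_cls[OF \<mu>(1) s] by simp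
qed

end

end

section \<open>The data map and its derivative\<close>

locale data_problem = boundary_problem \<Omega> \<phi> for \<Omega> :: "'a::euclidean_space set" and \<phi> +
  fixes W :: "('a \<Rightarrow> real) set"
  assumes W: "finite_dim_subspace_Linf \<Omega> W"
begin

lemma W_Linf: "h \<in> W \<Longrightarrow> h \<in> Linf \<Omega>"
  using W by (auto simp: finite_dim_subspace_Linf_def)

lemma W_add: "h \<in> W \<Longrightarrow> k \<in> W \<Longrightarrow> (\<lambda>x. h x + k x) \<in> W"
proof -
  assume hk: "h \<in> W" "k \<in> W"
  obtain B where B: "W = {f \<in> Linf \<Omega>. \<exists>c. AE x in lebesgue_on \<Omega>. f x = (\<Sum>b\<in>B. c b * b x)}"
    using W by (auto simp: finite_dim_subspace_Linf_def)
  obtain c d where c: "AE x in lebesgue_on \<Omega>. h x = (\<Sum>b\<in>B. c b * b x)"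
    and d: "AE x in lebesgue_on \<Omega>. k x = (\<Sum>b\<in>B. d b * b x)" using hk B by auto
  have "AE x in lebesgue_on \<Omega>. h x + k x = (\<Sum>b\<in>B. (c b + d b) * b x)"
    using c d by eventually_elim (simp add: sum.distrib distrib_right)
  then show "(\<lambda>x. h x + k x) \<in> W" using hk unfolding B by (auto intro: Linf_add)
qed

lemma W_scale: "h \<in> W \<Longrightarrow> (\<lambda>x. a * h x) \<in> W"
proof -
  assume h: "h \<in> W"
  obtain B where B: "W = {f \<in> Linf \<Omega>. \<exists>c. AE x in lebesgue_on \<Omega>. f x = (\<Sum>b\<in>B. c b * b x)}"
    using W by (auto simp: finite_dim_subspace_Linf_def)
  obtain c where c: "AE x in lebesgue_on \<Omega>. h x = (\<Sum>b\<in>B. c b * b x)" using h B by auto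
  have "AE x in lebesgue_on \<Omega>. a * h x = (\<Sum>b\<in>B. (a * c b) * b x)"
    using c by eventually_elim (simp add: sum_distrib_left mult.assoc)
  then show "(\<lambda>x. a * h x) \<in> W" using h unfolding B by (auto intro: Linf_scale)
qed

lemma W_finite_span:
  obtains S where "finite S" "\<And>h. h \<in> W \<Longrightarrow> mult_op h \<in> span S"
proof -
  obtain B where B: "finite B" "B \<subseteq> Linf \<Omega>"
    "W = {f \<in> Linf \<Omega>. \<exists>c. AE x in lebesgue_on \<Omega>. f x = (\<Sum>b\<in>B. c b * b x)}"
    using W by (auto simp: finite_dim_subspace_Linf_def)
  have "mult_op h \<in> span (mult_op ` B)" if h: "h \<in> W" for h
  proof -
    obtain c where "AE x in lebesgue_on \<Omega>. h x = (\<Sum>b\<in>B. c b * b x)" using h B(3) by auto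
    then have "mult_op h = (\<Sum>b\<in>B. c b *\<^sub>R mult_op b)"
      using B W_Linf[OF h] by (intro mult_op_linear_combination) auto
    then show ?thesis by (simp only:) (intro span_sum span_scale span_base imageI)
  qed
  then show ?thesis using that[of "mult_op ` B"] B(1) by blast
qed

abbreviation "A \<equiv> admissible_A \<Omega> W"

abbreviation "F \<equiv> data_map \<Omega> \<phi>"

abbreviation "F' \<equiv> frechet_derivative_Linf_L2 \<Omega> W A F"

abbreviation "has_F' \<equiv> has_frechet_derivative_Linf_L2 \<Omega> W A F"

lemma admissible_A_lower:
  assumes "\<mu> \<in> A"
  obtains c where "c > 0" "AE x in lebesgue_on \<Omega>. c \<le> \<mu> x"
proof -
  obtain l where l: "l > 0" and b: "AE x in lebesgue_on \<Omega>. inverse l < \<mu> x \<and> \<mu> x < l"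
    using assms by (auto simp: admissible_A_def)
  have "AE x in lebesgue_on \<Omega>. inverse l \<le> \<mu> x" using b by eventually_elim auto
  then show ?thesis using that[of "inverse l"] l by simp
qed

lemma admissible_A_W: "\<mu> \<in> A \<Longrightarrow> \<mu> \<in> W"
  by (simp add: admissible_A_def)

lemma admissible_A_coercive: "\<mu> \<in> A \<Longrightarrow> \<exists>c>0. coercive c (mult_op \<mu>)"
proof -
  assume \<mu>: "\<mu> \<in> A"
  obtain c where c: "c > 0" "AE x in lebesgue_on \<Omega>. c \<le> \<mu> x" by (rule admissible_A_lower[OF \<mu>])
  then show "\<exists>c>0. coercive c (mult_op \<mu>)"
    using coercive_mult_op[OF W_Linf[OF admissible_A_W[OF \<mu>]] c(2)] by (intro exI[of _ "min 1 c"]) simp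
qed

lemma data_map_A:
  assumes "\<mu> \<in> A"
  shows "sq_on (F \<mu>)" "cls (F \<mu>) = data_op (mult_op \<mu>)"
  using admissible_A_lower[OF assms] data_map_eq_data_op[OF W_Linf[OF admissible_A_W[OF assms]]] by metis+

lemma cls_rep_data_op':
  assumes \<xi>: "\<xi> \<in> A" and h: "h \<in> W"
  shows "cls (rep_l2 (data_op' (mult_op \<xi>) (mult_op h))) = data_op' (mult_op \<xi>) (mult_op h)"
proof -
  interpret P: bounded_linear "\<lambda>X :: ('a, real) l2. cls (rep_l2 X)" by (rule bounded_linear_cls_rep)
  have "cls (rep_l2 (blinfun_apply (mult_op m) X)) = blinfun_apply (mult_op m) X" if "m \<in> Linf \<Omega>" for m X
    unfolding mult_op_apply[OF that] by (rule cls_rep_cls[OF sq_on_mult[OF that sq_on_rep]])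
  then show ?thesis
    unfolding data_op'_def P.diff using W_Linf[OF h] W_Linf[OF admissible_A_W[OF \<xi>]] by simp
qed

text \<open>
  Differentiability of \<open>data_op\<close> in operator norm suffices, because \<open>mult_op\<close> is linear on \<open>W\<close> and its
  operator norm is at most the norm in \<open>L\<^sup>\<infinity>(\<Omega>)\<close>.
\<close>
lemma has_frechet_derivative_data_map:
  assumes \<xi>: "\<xi> \<in> A"
  shows "has_F' \<xi> (\<lambda>h. rep_l2 (data_op' (mult_op \<xi>) (mult_op h)))"
proof -
  let ?m = "mult_op \<xi>"
  let ?D = "\<lambda>h. rep_l2 (data_op' ?m (mult_op h))"
  obtain c where c: "c > 0" "coercive c ?m" using admissible_A_coercive[OF \<xi>] by blast
  interpret D: bounded_linear "data_op' ?m" by (rule bounded_linear_data_op'[OF c(2,1)])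
  have \<xi>W: "\<xi> \<in> W" by (rule admissible_A_W[OF \<xi>])
  have clsD: "cls (?D h) = data_op' ?m (mult_op h)" if "h \<in> W" for h by (rule cls_rep_data_op'[OF \<xi> that])
  have AE: "AE x in lebesgue_on \<Omega>. ?D h x = g x" if "h \<in> W" "sq_on g" "cls g = data_op' ?m (mult_op h)" for h g
  proof -
    have "cls (?D h) = cls g" using clsD[OF that(1)] that(3) by simp
    then show ?thesis unfolding cls_eq_iff[OF sq_on_rep that(2)] .
  qed
  obtain M where M: "M \<ge> 0" "\<And>k. norm (data_op' ?m k) \<le> norm k * M" using D.nonneg_bounded by blast
  have "bounded_linear_L2 \<Omega> W (Linf_norm \<Omega>) ?D"
    unfolding bounded_linear_L2_def
  proof (intro conjI ballI allI)
    show "?D h \<in> L2 \<Omega>" for h by (simp add: L2_iff sq_on_rep)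
    show "AE x in lebesgue_on \<Omega>. ?D (\<lambda>y. f y + g y) x = ?D f x + ?D g x" if "f \<in> W" "g \<in> W" for f g
    proof (intro AE W_add sq_on_add sq_on_rep that)
      show "cls (\<lambda>x. ?D f x + ?D g x) = data_op' ?m (mult_op (\<lambda>y. f y + g y))"
        unfolding cls_add[OF sq_on_rep sq_on_rep] clsD[OF that(1)] clsD[OF that(2)]
          mult_op_add[OF that[THEN W_Linf]] D.add ..
    qed
    show "AE x in lebesgue_on \<Omega>. ?D (\<lambda>y. a * f y) x = a * ?D f x" if f: "f \<in> W" for a f
      using AE[OF W_scale[OF f, of a] sq_on_scaleR[OF sq_on_rep[of "data_op' ?m (mult_op f)"], of a]] cls_scaleR[OF sq_on_rep[of "data_op' ?m (mult_op f)"], of a]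
        f by (simp add: clsD mult_op_scale W_Linf D.scaleR)
    have "L2_norm \<Omega> (?D f) \<le> M * Linf_norm \<Omega> f" if f: "f \<in> W" for f
    proof -
      have "L2_norm \<Omega> (?D f) = norm (data_op' ?m (mult_op f))"
        using clsD[OF f] by (simp add: norm_cls[symmetric] L2_iff sq_on_rep)
      also have "\<dots> \<le> norm (mult_op f) * M" by (rule M)
      also have "\<dots> \<le> Linf_norm \<Omega> f * M" using norm_mult_op[OF W_Linf[OF f]] M(1) by (rule mult_right_mono)
      finally show ?thesis by (simp add: mult.commute)
    qed
    then show "\<exists>M. \<forall>f\<in>W. L2_norm \<Omega> (?D f) \<le> M * Linf_norm \<Omega> f" by blast
  qed
  moreover have "\<exists>\<delta>>0. \<forall>h\<in>W. Linf_norm \<Omega> h < \<delta> \<and> (\<lambda>x. \<xi> x + h x) \<in> A \<longrightarrow>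
      L2_norm \<Omega> (\<lambda>x. F (\<lambda>y. \<xi> y + h y) x - F \<xi> x - ?D h x) \<le> e * Linf_norm \<Omega> h" if e: "e > 0" for e
  proof -
    obtain d where d: "d > 0" "\<And>y. \<exists>c>0. coercive c y \<Longrightarrow> norm (y - ?m) < d \<Longrightarrow>
        norm (data_op y - data_op ?m - data_op' ?m (y - ?m)) \<le> e * norm (y - ?m)"
      using data_op_has_derivative[OF c(2,1)] e unfolding has_derivative_within_alt by blast
    have "L2_norm \<Omega> (\<lambda>x. F (\<lambda>y. \<xi> y + h y) x - F \<xi> x - ?D h x) \<le> e * Linf_norm \<Omega> h"
      if h: "h \<in> W" "Linf_norm \<Omega> h < d" "(\<lambda>x. \<xi> x + h x) \<in> A" for h
    proof -
      have m: "mult_op (\<lambda>x. \<xi> x + h x) = ?m + mult_op h" using h \<xi>W by (simp add: mult_op_add W_Linf)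
      note s = data_map_A[OF h(3)] data_map_A[OF \<xi>]
      have "L2_norm \<Omega> (\<lambda>x. F (\<lambda>y. \<xi> y + h y) x - F \<xi> x - ?D h x) =
          norm (cls (\<lambda>x. F (\<lambda>y. \<xi> y + h y) x - F \<xi> x - ?D h x))"
        using s by (intro norm_cls[symmetric]) (auto simp: L2_iff intro: sq_on_diff sq_on_rep)
      also have "\<dots> = norm (data_op (?m + mult_op h) - data_op ?m - data_op' ?m (mult_op h))"
        using s h(1) by (simp add: cls_diff sq_on_diff sq_on_rep clsD m)
      also have "\<dots> \<le> e * norm (mult_op h)"
        using d(2)[of "?m + mult_op h"] admissible_A_coercive[OF h(3)] norm_mult_op[OF W_Linf[OF h(1)]] h(2) m by simp
      also have "\<dots> \<le> e * Linf_norm \<Omega> h" using e norm_mult_op[OF W_Linf[OF h(1)]] by simp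
      finally show ?thesis .
    qed
    then show ?thesis using d(1) by blast
  qed
  ultimately show ?thesis by (simp add: has_frechet_derivative_Linf_L2_def)
qed

lemma admissible_A_open:
  assumes \<xi>: "\<xi> \<in> A" and h: "h \<in> W"
  obtains s where "s > 0" "\<And>t. 0 < t \<Longrightarrow> t < s \<Longrightarrow> (\<lambda>x. \<xi> x + t * h x) \<in> A"
proof -
  obtain l where l: "l > 0" and b: "AE x in lebesgue_on \<Omega>. inverse l < \<xi> x \<and> \<xi> x < l"
    using \<xi> by (auto simp: admissible_A_def)
  define H where "H = Linf_norm \<Omega> h + 1"
  have H: "H > 0" "AE x in lebesgue_on \<Omega>. \<bar>h x\<bar> \<le> H"
    using Linf_bounds[OF W_Linf[OF h]] by (auto simp: H_def elim: eventually_mono)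
  \<comment> \<open>Steps below \<open>s\<close> keep the values between \<open>inverse (2 * l)\<close> and \<open>2 * l\<close>.\<close>
  define s where "s = min (inverse l / 2) l / H"
  have "s > 0" using l H by (simp add: s_def)
  moreover have "(\<lambda>x. \<xi> x + t * h x) \<in> A" if t: "0 < t" "t < s" for t
  proof -
    have tH: "t * H < inverse l / 2" "t * H < l" using t H by (auto simp: s_def pos_less_divide_eq)
    have "AE x in lebesgue_on \<Omega>. inverse (2 * l) < \<xi> x + t * h x \<and> \<xi> x + t * h x < 2 * l"
      using b H(2)
    proof eventually_elim
      case (elim x)
      have "\<bar>t * h x\<bar> \<le> t * H" using t elim by (simp add: abs_mult)
      then have "t * h x \<le> t * H" "- (t * h x) \<le> t * H" by linarith+
      moreover have "inverse (2 * l) = inverse l / 2" by (simp add: field_simps)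
      ultimately show ?case using tH elim by linarith
    qed
    moreover have "(\<lambda>x. \<xi> x + t * h x) \<in> W" using admissible_A_W[OF \<xi>] h by (intro W_add W_scale)
    ultimately show ?thesis using l by (auto simp: admissible_A_def intro!: exI[of _ "2 * l"])
  qed
  ultimately show ?thesis using that by blast
qed

text \<open>
  The set \<open>A\<close> is open in \<open>W\<close>, so \<open>\<xi> + t h\<close> stays in \<open>A\<close> for small \<open>t > 0\<close>, and both values
  at \<open>h\<close> are the limit of the same difference quotients. This makes the chosen derivative equal to the explicit one.
\<close>
lemma frechet_derivative_unique:
  assumes \<xi>: "\<xi> \<in> A" and h: "h \<in> W"
    and D: "has_F' \<xi> D"
    and E: "has_F' \<xi> E"
  shows "cls (D h) = cls (E h)"
proof -
  have sq: "sq_on (G k)" if "has_F' \<xi> G" "k \<in> W" for G k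
    using that by (simp add: has_frechet_derivative_Linf_L2_def bounded_linear_L2_def L2_iff)
  have scale: "cls (G (\<lambda>x. t * h x)) = t *\<^sub>R cls (G h)" if G: "has_F' \<xi> G" for G t
  proof -
    have "AE x in lebesgue_on \<Omega>. G (\<lambda>x. t * h x) x = t *\<^sub>R G h x"
      using G h by (simp add: has_frechet_derivative_Linf_L2_def bounded_linear_L2_def)
    then have "cls (G (\<lambda>x. t * h x)) = cls (\<lambda>x. t *\<^sub>R G h x)"
      by (subst cls_eq_iff) (auto intro: sq[OF G] W_scale h sq_on_scaleR simp del: real_scaleR_def)
    then show ?thesis by (simp only: cls_scaleR sq[OF G h])
  qed
  obtain s where s: "s > 0" "\<And>t. 0 < t \<Longrightarrow> t < s \<Longrightarrow> (\<lambda>x. \<xi> x + t * h x) \<in> A"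
    by (rule admissible_A_open[OF \<xi> h]) (rule that)
  let ?H = "Linf_norm \<Omega> h"
  have H: "?H \<ge> 0" by (rule Linf_bounds(2)[OF W_Linf[OF h]])
  have rem: "\<exists>\<delta>>0. \<forall>t. 0 < t \<and> t < \<delta> \<longrightarrow>
      norm (cls (F (\<lambda>y. \<xi> y + t * h y)) - cls (F \<xi>) - t *\<^sub>R cls (G h)) \<le> e * (t * ?H)"
    if G: "has_F' \<xi> G" and e: "e > 0" for G e
  proof -
    obtain \<delta> where \<delta>: "\<delta> > 0" "\<And>k. k \<in> W \<Longrightarrow> Linf_norm \<Omega> k < \<delta> \<Longrightarrow> (\<lambda>x. \<xi> x + k x) \<in> A \<Longrightarrow>
        L2_norm \<Omega> (\<lambda>x. F (\<lambda>y. \<xi> y + k y) x - F \<xi> x - G k x) \<le> e * Linf_norm \<Omega> k"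
      using G e unfolding has_frechet_derivative_Linf_L2_def by blast
    have "norm (cls (F (\<lambda>y. \<xi> y + t * h y)) - cls (F \<xi>) - t *\<^sub>R cls (G h)) \<le> e * (t * ?H)"
      if t: "0 < t" "t < min s (\<delta> / (?H + 1))" for t
    proof -
      let ?k = "\<lambda>x. t * h x"
      have kW: "?k \<in> W" by (rule W_scale[OF h])
      have kn: "Linf_norm \<Omega> ?k \<le> t * ?H" using Linf_scale(2)[OF W_Linf[OF h], of t] t by simp
      have "t * (?H + 1) < \<delta>" using t H by (simp add: pos_less_divide_eq)
      then have "Linf_norm \<Omega> ?k < \<delta>" using kn t by (simp add: distrib_left)
      moreover have kA: "(\<lambda>x. \<xi> x + ?k x) \<in> A" using s(2) t by simp
      ultimately have "L2_norm \<Omega> (\<lambda>x. F (\<lambda>y. \<xi> y + ?k y) x - F \<xi> x - G ?k x) \<le> e * Linf_norm \<Omega> ?k"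
        by (intro \<delta>(2) kW)
      moreover have "L2_norm \<Omega> (\<lambda>x. F (\<lambda>y. \<xi> y + ?k y) x - F \<xi> x - G ?k x) =
          norm (cls (F (\<lambda>y. \<xi> y + t * h y)) - cls (F \<xi>) - t *\<^sub>R cls (G h))"
        using data_map_A(1)[OF kA] data_map_A(1)[OF \<xi>] sq[OF G kW]
        by (simp add: norm_cls[symmetric] L2_iff sq_on_diff cls_diff scale[OF G])
      moreover have "e * Linf_norm \<Omega> ?k \<le> e * (t * ?H)" using e kn by simp
      ultimately show ?thesis by linarith
    qed
    moreover have "min s (\<delta> / (?H + 1)) > 0" using s(1) \<delta>(1) H by simp
    ultimately show ?thesis by blast
  qed
  have bound: "norm (cls (D h) - cls (E h)) \<le> 2 * e * ?H" if e: "e > 0" for e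
  proof -
    obtain \<delta>1 where \<delta>1: "\<delta>1 > 0" "\<And>t. 0 < t \<Longrightarrow> t < \<delta>1 \<Longrightarrow>
      norm (cls (F (\<lambda>y. \<xi> y + t * h y)) - cls (F \<xi>) - t *\<^sub>R cls (D h)) \<le> e * (t * ?H)"
      using rem[OF D e] by blast
    obtain \<delta>2 where \<delta>2: "\<delta>2 > 0" "\<And>t. 0 < t \<Longrightarrow> t < \<delta>2 \<Longrightarrow>
      norm (cls (F (\<lambda>y. \<xi> y + t * h y)) - cls (F \<xi>) - t *\<^sub>R cls (E h)) \<le> e * (t * ?H)"
      using rem[OF E e] by blast
    obtain t where t: "0 < t" "t < \<delta>1" "t < \<delta>2" using field_lbound_gt_zero[OF \<delta>1(1) \<delta>2(1)] by blast
    let ?R = "cls (F (\<lambda>y. \<xi> y + t * h y)) - cls (F \<xi>)"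
    have "t *\<^sub>R (cls (D h) - cls (E h)) = (?R - t *\<^sub>R cls (E h)) - (?R - t *\<^sub>R cls (D h))"
      by (simp add: scaleR_diff_right)
    then have "norm (t *\<^sub>R (cls (D h) - cls (E h))) \<le> norm (?R - t *\<^sub>R cls (E h)) + norm (?R - t *\<^sub>R cls (D h))"
      by (simp only: norm_triangle_ineq4)
    also have "\<dots> \<le> e * (t * ?H) + e * (t * ?H)"
      using \<delta>1(2)[OF t(1,2)] \<delta>2(2)[OF t(1,3)] by (intro add_mono)
    also have "\<dots> = t * (2 * e * ?H)" by (simp add: algebra_simps)
    finally have "\<bar>t\<bar> * norm (cls (D h) - cls (E h)) \<le> t * (2 * e * ?H)" by (simp only: norm_scaleR)
    then show ?thesis using t(1) by simp
  qed
  have *: "norm (cls (D h) - cls (E h)) \<le> 0 + e'" if "e' > 0" for e'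
  proof -
    have "0 < e' / (2 * (?H + 1))" using that H by simp
    then have "norm (cls (D h) - cls (E h)) \<le> 2 * (e' / (2 * (?H + 1))) * ?H" by (rule bound)
    also have "\<dots> = e' * (?H / (?H + 1))" using H by (simp add: field_simps)
    also have "\<dots> \<le> e' * 1" using that H by (intro mult_left_mono) auto
    finally show ?thesis by simp
  qed
  have "norm (cls (D h) - cls (E h)) \<le> 0" by (rule field_le_epsilon) (rule *)
  then show ?thesis by simp
qed

lemma frechet_derivative_data_map:
  assumes \<xi>: "\<xi> \<in> A" and h: "h \<in> W"
  shows "sq_on (F' \<xi> h)"
    and "cls (F' \<xi> h) = data_op' (mult_op \<xi>) (mult_op h)"
proof -
  note D = has_frechet_derivative_data_map[OF \<xi>]
  then have E: "has_F' \<xi> (F' \<xi>)"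
    unfolding frechet_derivative_Linf_L2_def
    by (rule someI[where P = "has_F' \<xi>"])
  then show "sq_on (F' \<xi> h)"
    using h by (simp add: has_frechet_derivative_Linf_L2_def bounded_linear_L2_def L2_iff)
  show "cls (F' \<xi> h) = data_op' (mult_op \<xi>) (mult_op h)"
    using frechet_derivative_unique[OF \<xi> h E D] cls_rep_data_op'[OF \<xi> h] by simp
qed

lemma admissible_K_A:
  assumes "\<Lambda> > 0" "\<xi> \<in> admissible_K \<Omega> W \<Lambda>"
  shows "\<xi> \<in> A"
proof -
  have b: "AE x in lebesgue_on \<Omega>. inverse \<Lambda> \<le> \<xi> x \<and> \<xi> x \<le> \<Lambda>" and W: "\<xi> \<in> W"
    using assms by (auto simp: admissible_K_def)
  have inv: "inverse (\<Lambda> + 1) < inverse \<Lambda>" using assms(1) by simp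
  have "AE x in lebesgue_on \<Omega>. inverse (\<Lambda> + 1) < \<xi> x \<and> \<xi> x < \<Lambda> + 1"
    using b
  proof eventually_elim
    case (elim x)
    then show ?case using inv by linarith
  qed
  then show ?thesis using W assms(1) by (auto simp: admissible_A_def intro!: exI[of _ "\<Lambda> + 1"])
qed

lemma admissible_K_bounds:
  assumes "\<Lambda> > 0" "\<xi> \<in> admissible_K \<Omega> W \<Lambda>"
  shows "coercive (min 1 (inverse \<Lambda>)) (mult_op \<xi>)" "norm (mult_op \<xi>) \<le> \<Lambda>"
proof -
  have b: "AE x in lebesgue_on \<Omega>. inverse \<Lambda> \<le> \<xi> x \<and> \<xi> x \<le> \<Lambda>" and W: "\<xi> \<in> W"
    using assms by (auto simp: admissible_K_def)
  have Li: "\<xi> \<in> Linf \<Omega>" by (rule W_Linf[OF W])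
  have "AE x in lebesgue_on \<Omega>. inverse \<Lambda> \<le> \<xi> x" using b by eventually_elim auto
  then show "coercive (min 1 (inverse \<Lambda>)) (mult_op \<xi>)" by (rule coercive_mult_op[OF Li])
  have "AE x in lebesgue_on \<Omega>. \<bar>\<xi> x\<bar> \<le> \<Lambda>"
    using b
  proof eventually_elim
    case (elim x)
    moreover have "inverse \<Lambda> > 0" using assms(1) by simp
    ultimately show ?case by linarith
  qed
  then have "Linf_norm \<Omega> \<xi> \<le> \<Lambda>" using Li by (intro Linf_I) (auto simp: Linf_def)
  then show "norm (mult_op \<xi>) \<le> \<Lambda>" using norm_mult_op[OF Li] by linarith
qed

section \<open>The projected data\<close>

text \<open>
  Replaces the chosen derivative inside \<open>sup_defect\<close> by the explicit formula \<open>data_op'\<close>, and \<open>T\<close> by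
  its action \<open>t\<close> on classes.
\<close>
lemma sup_defect_le_iff:
  assumes \<Lambda>: "\<Lambda> > 0"
    and T: "\<And>f. sq_on f \<Longrightarrow> sq_on (T f)" "\<And>f. sq_on f \<Longrightarrow> cls (T f) = t (cls f)"
  shows "sup_defect \<Omega> \<phi> W \<Lambda> T \<le> ereal \<beta> \<longleftrightarrow>
    (\<forall>\<xi>\<in>admissible_K \<Omega> W \<Lambda>. \<forall>h\<in>W. Linf_norm \<Omega> h \<le> 1 \<longrightarrow>
      norm (data_op' (mult_op \<xi>) (mult_op h) - t (data_op' (mult_op \<xi>) (mult_op h))) \<le> \<beta>)"
proof -
  have "L2_norm \<Omega> (\<lambda>x. F' \<xi> h x - T (F' \<xi> h) x) =
      norm (data_op' (mult_op \<xi>) (mult_op h) - t (data_op' (mult_op \<xi>) (mult_op h)))"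
    if "\<xi> \<in> admissible_K \<Omega> W \<Lambda>" "h \<in> W" for \<xi> h
  proof -
    have \<xi>: "\<xi> \<in> A" using admissible_K_A[OF \<Lambda>] that by blast
    note d = frechet_derivative_data_map[OF \<xi> that(2)]
    show ?thesis
      using d T by (simp add: norm_cls[symmetric] L2_iff sq_on_diff cls_diff)
  qed
  then show ?thesis
    by (auto simp: sup_defect_def op_norm_Linf_L2_def Let_def SUP_le_iff)
qed

text \<open>
  If the bound failed for all \<open>N\<close>, then the failing coefficients and directions would have subsequences
  convergent in operator norm. The derivatives converge along them, and the operators \<open>t N\<close>, which are
  uniformly bounded and tend pointwise to the identity on classes supported in \<open>\<Omega>\<close>, would have
  a defect tending to zero there.
\<close>
lemma defect_eventually_small:
  fixes t :: "nat \<Rightarrow> ('a, real) l2 \<Rightarrow> ('a, real) l2"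
  assumes \<Lambda>: "\<Lambda> > 0" and \<beta>: "\<beta> > 0"
    and t: "\<And>N. bounded_linear (t N)" "\<And>X. (\<lambda>N. t N X) \<longlonglongrightarrow> cls (rep_l2 X)"
  shows "\<exists>N. \<forall>\<xi>\<in>admissible_K \<Omega> W \<Lambda>. \<forall>h\<in>W. Linf_norm \<Omega> h \<le> 1 \<longrightarrow>
      norm (data_op' (mult_op \<xi>) (mult_op h) - t N (data_op' (mult_op \<xi>) (mult_op h))) \<le> \<beta>"
proof (rule ccontr)
  assume "\<not> ?thesis"
  then have "\<forall>N. \<exists>\<xi> h. \<xi> \<in> admissible_K \<Omega> W \<Lambda> \<and> h \<in> W \<and> Linf_norm \<Omega> h \<le> 1 \<and>
      norm (data_op' (mult_op \<xi>) (mult_op h) - t N (data_op' (mult_op \<xi>) (mult_op h))) > \<beta>"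
    by (force simp: not_le)
  then obtain \<xi> h where \<xi>: "\<And>N. \<xi> N \<in> admissible_K \<Omega> W \<Lambda>" and h: "\<And>N. h N \<in> W" "\<And>N. Linf_norm \<Omega> (h N) \<le> 1"
    and big: "\<And>N. norm (data_op' (mult_op (\<xi> N)) (mult_op (h N)) - t N (data_op' (mult_op (\<xi> N)) (mult_op (h N)))) > \<beta>"
    by metis
  obtain S where S: "finite S" "\<And>h. h \<in> W \<Longrightarrow> mult_op h \<in> span S" by (rule W_finite_span) (rule that)
  have \<xi>W: "\<xi> N \<in> W" for N using \<xi> by (simp add: admissible_K_def)
  have kb: "norm (mult_op (h N)) \<le> 1" for N using norm_mult_op[OF W_Linf[OF h(1)]] h(2) order_trans by blast
  obtain m r1 where r1: "strict_mono (r1 :: nat \<Rightarrow> nat)" "((\<lambda>N. mult_op (\<xi> N)) \<circ> r1) \<longlonglongrightarrow> m"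
    by (rule bounded_sequence_in_finite_span[where x = "\<lambda>N. mult_op (\<xi> N)",
          OF S(1) S(2)[OF \<xi>W] admissible_K_bounds(2)[OF \<Lambda> \<xi>]]) (rule that)
  obtain k r2 where r2: "strict_mono (r2 :: nat \<Rightarrow> nat)" "((\<lambda>N. mult_op (h (r1 N))) \<circ> r2) \<longlonglongrightarrow> k"
    by (rule bounded_sequence_in_finite_span[where x = "\<lambda>N. mult_op (h (r1 N))",
          OF S(1) S(2)[OF h(1)] kb]) (rule that)
  define r where "r = r1 \<circ> r2"
  have r: "strict_mono r" unfolding r_def using r1 r2 by (simp add: strict_mono_o)
  have lm: "(\<lambda>N. mult_op (\<xi> (r N))) \<longlonglongrightarrow> m"
    using LIMSEQ_subseq_LIMSEQ[OF r1(2) r2(1)] by (simp add: r_def o_def)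
  have lk: "(\<lambda>N. mult_op (h (r N))) \<longlonglongrightarrow> k" using r2(2) by (simp add: r_def o_def)
  define s where "s N = data_op' (mult_op (\<xi> (r N))) (mult_op (h (r N)))" for N
  have cpos: "min 1 (inverse \<Lambda>) > 0" using \<Lambda> by simp
  have s: "s \<longlonglongrightarrow> data_op' m k"
    unfolding s_def by (rule data_op'_tendsto[OF admissible_K_bounds(1)[OF \<Lambda> \<xi>] cpos lm lk])
  have "cls (rep_l2 (data_op' m k)) = data_op' m k"
  proof -
    have "s N \<in> {X. cls (rep_l2 X) = X}" for N
      unfolding s_def using cls_rep_data_op'[OF admissible_K_A[OF \<Lambda> \<xi>] h(1)] by simp
    then have "data_op' m k \<in> {X. cls (rep_l2 X) = X}"
      using closed_sequentially[OF closed_cls_fixed _ s] by blast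
    then show ?thesis by simp
  qed
  then have lt: "(\<lambda>N. t (r N) (data_op' m k)) \<longlonglongrightarrow> data_op' m k"
    using LIMSEQ_subseq_LIMSEQ[OF t(2)[of "data_op' m k"] r] by (simp add: o_def)
  have ptw: "\<exists>K. \<forall>N. norm (t N X) \<le> K" for X
    using convergent_imp_Bseq[OF convergentI[OF t(2)[of X]]] by (auto simp: Bseq_def)
  obtain K where K: "\<And>N X. norm (t N X) \<le> K * norm X"
    by (rule uniform_boundedness[where T = t, OF t(1) ptw]) (rule that)
  have "\<beta> \<le> norm (s N - data_op' m k) + norm (data_op' m k - t (r N) (data_op' m k)) + K * norm (s N - data_op' m k)" for N
  proof -
    interpret t: bounded_linear "t (r N)" by (rule t)
    have "\<beta> \<le> norm (s N - t (r N) (s N))" using big[of "r N"] by (simp add: s_def)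
    also have "s N - t (r N) (s N) = (s N - data_op' m k) + (data_op' m k - t (r N) (data_op' m k)) - t (r N) (s N - data_op' m k)"
      by (simp add: t.diff)
    also have "norm \<dots> \<le> norm (s N - data_op' m k) + norm (data_op' m k - t (r N) (data_op' m k)) + norm (t (r N) (s N - data_op' m k))"
      by (intro order_trans[OF norm_triangle_ineq4] add_right_mono norm_triangle_ineq)
    also have "\<dots> \<le> norm (s N - data_op' m k) + norm (data_op' m k - t (r N) (data_op' m k)) + K * norm (s N - data_op' m k)"
      by (intro add_left_mono K)
    finally show ?thesis .
  qed
  moreover have "(\<lambda>N. norm (s N - data_op' m k) + norm (data_op' m k - t (r N) (data_op' m k)) + K * norm (s N - data_op' m k))
      \<longlonglongrightarrow> norm (data_op' m k - data_op' m k) + norm (data_op' m k - data_op' m k) + K * norm (data_op' m k - data_op' m k)"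
    by (intro tendsto_intros s lt)
  ultimately have "\<beta> \<le> norm (data_op' m k - data_op' m k) + norm (data_op' m k - data_op' m k) + K * norm (data_op' m k - data_op' m k)"
    by (intro LIMSEQ_le_const) auto
  then show False using \<beta> by simp
qed

text \<open>
  On the segment \<open>\<mu>\<^sub>2 + s (\<mu>\<^sub>1 - \<mu>\<^sub>2)\<close>, which lies in the convex set \<open>K\<close>, the derivative of
  \<open>data_op - t data_op\<close> is at most \<open>\<parallel>\<mu>\<^sub>1 - \<mu>\<^sub>2\<parallel>\<^sub>\<infinity> / (2 C)\<close>. The mean value inequality and the
  stability estimate leave half of \<open>\<parallel>\<mu>\<^sub>1 - \<mu>\<^sub>2\<parallel>\<^sub>\<infinity>\<close> on the right-hand side.
\<close>
lemma stability_from_defect: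
  assumes \<Lambda>: "\<Lambda> > 0" and C: "C > 0" and t: "bounded_linear t"
    and \<mu>1: "\<mu>1 \<in> admissible_K \<Omega> W \<Lambda>" and \<mu>2: "\<mu>2 \<in> admissible_K \<Omega> W \<Lambda>"
    and stab: "Linf_norm \<Omega> (\<lambda>x. \<mu>1 x - \<mu>2 x) \<le> C * norm (data_op (mult_op \<mu>1) - data_op (mult_op \<mu>2))"
    and defect: "\<And>\<xi> h. \<xi> \<in> admissible_K \<Omega> W \<Lambda> \<Longrightarrow> h \<in> W \<Longrightarrow> Linf_norm \<Omega> h \<le> 1 \<Longrightarrow>
      norm (data_op' (mult_op \<xi>) (mult_op h) - t (data_op' (mult_op \<xi>) (mult_op h))) \<le> 1 / (2 * C)"
  shows "Linf_norm \<Omega> (\<lambda>x. \<mu>1 x - \<mu>2 x) \<le> 2 * C * norm (t (data_op (mult_op \<mu>1)) - t (data_op (mult_op \<mu>2)))"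
proof -
  interpret t: bounded_linear t by (rule t)
  define h where "h = (\<lambda>x. \<mu>1 x - \<mu>2 x)"
  define \<xi> where "\<xi> s = (\<lambda>x. \<mu>2 x + s * h x)" for s
  have W12: "\<mu>1 \<in> W" "\<mu>2 \<in> W" using \<mu>1 \<mu>2 by (auto simp: admissible_K_def)
  have hW: "h \<in> W" using W_add[OF W12(1) W_scale[OF W12(2), of "-1"]] by (simp add: h_def)
  let ?H = "Linf_norm \<Omega> h"
  have H: "?H \<ge> 0" by (rule Linf_bounds(2)[OF W_Linf[OF hW]])
  have \<xi>K: "\<xi> s \<in> admissible_K \<Omega> W \<Lambda>" if s: "s \<in> {0..1}" for s
  proof -
    have "AE x in lebesgue_on \<Omega>. inverse \<Lambda> \<le> \<mu>1 x \<and> \<mu>1 x \<le> \<Lambda>" "AE x in lebesgue_on \<Omega>. inverse \<Lambda> \<le> \<mu>2 x \<and> \<mu>2 x \<le> \<Lambda>"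
      using \<mu>1 \<mu>2 by (auto simp: admissible_K_def)
    then have "AE x in lebesgue_on \<Omega>. inverse \<Lambda> \<le> \<xi> s x \<and> \<xi> s x \<le> \<Lambda>"
    proof eventually_elim
      case (elim x)
      have "\<xi> s x = (1 - s) *\<^sub>R \<mu>2 x + s *\<^sub>R \<mu>1 x" by (simp add: \<xi>_def h_def algebra_simps)
      moreover have "(1 - s) *\<^sub>R \<mu>2 x + s *\<^sub>R \<mu>1 x \<in> {inverse \<Lambda>..\<Lambda>}"
        using elim s by (intro convexD) auto
      ultimately show ?case by simp
    qed
    moreover have "\<xi> s \<in> W" unfolding \<xi>_def by (intro W_add W_scale W12 hW)
    ultimately show ?thesis by (simp add: admissible_K_def)
  qed
  define m where "m s = mult_op \<mu>2 + s *\<^sub>R mult_op h" for s :: real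
  have m\<xi>: "mult_op (\<xi> s) = m s" for s
    using W_Linf[OF W12(2)] W_Linf[OF hW] by (simp add: \<xi>_def m_def mult_op_add mult_op_scale Linf_scale)
  define G where "G s = data_op (m s) - t (data_op (m s))" for s
  define D where "D s = data_op' (m s) (mult_op h) - t (data_op' (m s) (mult_op h))" for s
  have cpos: "min 1 (inverse \<Lambda>) > 0" using \<Lambda> by simp
  have co: "coercive (min 1 (inverse \<Lambda>)) (m s)" if "s \<in> {0..1}" for s
    using admissible_K_bounds(1)[OF \<Lambda> \<xi>K[OF that]] by (simp add: m\<xi>)
  have der: "(G has_derivative (\<lambda>a. a *\<^sub>R D s)) (at s within {0..1})" if s: "s \<in> {0..1}" for s
  proof -
    interpret d: bounded_linear "data_op' (m s)" by (rule bounded_linear_data_op'[OF co[OF s] cpos])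
    have "(m has_derivative (\<lambda>a. a *\<^sub>R mult_op h)) (at s within {0..1})"
      unfolding m_def by (auto intro!: derivative_eq_intros)
    moreover have "(data_op has_derivative data_op' (m s)) (at (m s) within m ` {0..1})"
      by (rule has_derivative_subset[OF data_op_has_derivative[OF co[OF s] cpos]]) (use co cpos in blast)
    ultimately have o: "((\<lambda>s. data_op (m s)) has_derivative (\<lambda>a. data_op' (m s) (a *\<^sub>R mult_op h))) (at s within {0..1})"
      by (rule has_derivative_in_compose)
    have "(G has_derivative (\<lambda>a. data_op' (m s) (a *\<^sub>R mult_op h) - t (data_op' (m s) (a *\<^sub>R mult_op h)))) (at s within {0..1})"
      unfolding G_def by (intro has_derivative_diff o t.has_derivative)
    then show ?thesis by (simp add: D_def d.scaleR t.scaleR scaleR_diff_right)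
  qed
  have Db: "norm (D s) \<le> ?H / (2 * C)" if s: "s \<in> {0..1}" for s
  proof -
    interpret d: bounded_linear "data_op' (m s)" by (rule bounded_linear_data_op'[OF co[OF s] cpos])
    have scaled: "norm (a *\<^sub>R D s) \<le> 1 / (2 * C)" if a: "a \<ge> 0" "a * ?H \<le> 1" for a
    proof -
      have "Linf_norm \<Omega> (\<lambda>x. a * h x) \<le> 1" using Linf_scale(2)[OF W_Linf[OF hW], of a] a by simp
      from defect[OF \<xi>K[OF s] W_scale[OF hW] this]
      show ?thesis
        using W_Linf[OF hW] by (simp add: m\<xi> mult_op_scale d.scaleR t.scaleR D_def scaleR_diff_right)
    qed
    show ?thesis
    proof (cases "?H = 0")
      case True
      have "norm (mult_op h) \<le> 0" using norm_mult_op[OF W_Linf[OF hW]] True by simp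
      then show ?thesis using True by (simp add: D_def d.zero t.zero)
    next
      case False
      then have "?H > 0" using H by simp
      with scaled[of "1 / ?H"] show ?thesis using C by (simp add: field_simps)
    qed
  qed
  have "norm (G 1 - G 0) \<le> (?H / (2 * C)) * norm (1 - 0 :: real)"
  proof (rule differentiable_bound[where f' = "\<lambda>s a. a *\<^sub>R D s" and S = "{0..1}"])
    show "onorm (\<lambda>a. a *\<^sub>R D s) \<le> ?H / (2 * C)" if "s \<in> {0..1}" for s
    proof (rule onorm_le)
      show "norm (a *\<^sub>R D s) \<le> ?H / (2 * C) * norm a" for a
        using mult_right_mono[OF Db[OF that] abs_ge_zero[of a]]
        by (simp only: norm_scaleR real_norm_def mult.commute[of "\<bar>a\<bar>"])
    qed
  qed (use der in auto)
  moreover have "m 1 = mult_op \<mu>1" "m 0 = mult_op \<mu>2"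
    unfolding m\<xi>[symmetric] \<xi>_def h_def by simp_all
  ultimately have G: "norm (data_op (mult_op \<mu>1) - data_op (mult_op \<mu>2) - t (data_op (mult_op \<mu>1) - data_op (mult_op \<mu>2))) \<le> ?H / (2 * C)"
    by (simp add: G_def t.diff algebra_simps)
  let ?d = "data_op (mult_op \<mu>1) - data_op (mult_op \<mu>2)"
  have "norm ?d \<le> norm (t ?d) + norm (?d - t ?d)"
    using norm_triangle_ineq[of "t ?d" "?d - t ?d"] by simp
  then have "C * norm ?d \<le> C * (norm (t ?d) + ?H / (2 * C))" using G C by (intro mult_left_mono) auto
  also have "\<dots> = C * norm (t ?d) + ?H / 2" using C by (simp add: field_simps)
  finally have "?H \<le> C * norm (t ?d) + ?H / 2" using stab by (simp add: h_def)
  then show ?thesis by (simp add: h_def t.diff)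
qed

end

theorem theorem9:
  fixes \<Omega> :: "(real ^ 'd) set"
    and \<phi> :: "real ^ 'd \<Rightarrow> real"
    and W :: "(real ^ 'd \<Rightarrow> real) set"
    and Q :: "nat \<Rightarrow> (real ^ 'd \<Rightarrow> real) \<Rightarrow> (real ^ 'd \<Rightarrow> real)"
    and \<alpha> \<Lambda> C :: real
  assumes "0 < \<alpha>" and "\<alpha> < 1"
    and "bounded \<Omega>" and "C1_holder_domain \<alpha> \<Omega>"
    and "C1_holder \<alpha> \<Omega> \<phi>" and "(INF x\<in>closure \<Omega>. \<phi> x) > 0"
    and "finite_dim_subspace_Linf \<Omega> W"
    and "\<Lambda> > 0"
    and "\<And>N. bounded_linear_L2 \<Omega> (L2 \<Omega>) (L2_norm \<Omega>) (Q N)"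
    and "\<And>N. selfadjoint_L2 \<Omega> (Q N)"
    and "\<And>f. f \<in> L2 \<Omega> \<Longrightarrow> (\<lambda>N. L2_norm \<Omega> (\<lambda>x. Q N f x - f x)) \<longlonglongrightarrow> 0"
    and "C > 0"
    and "\<And>\<mu>1 \<mu>2. \<mu>1 \<in> admissible_K \<Omega> W \<Lambda> \<Longrightarrow> \<mu>2 \<in> admissible_K \<Omega> W \<Lambda> \<Longrightarrow>
           Linf_norm \<Omega> (\<lambda>x. \<mu>1 x - \<mu>2 x)
             \<le> C * L2_norm \<Omega> (\<lambda>x. data_map \<Omega> \<phi> \<mu>1 x - data_map \<Omega> \<phi> \<mu>2 x)"
  shows "(\<forall>\<mu>\<in>admissible_A \<Omega> W. \<exists>u. is_weak_solution \<Omega> \<phi> \<mu> u \<and>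
           (\<forall>v. is_weak_solution \<Omega> \<phi> \<mu> v \<longrightarrow> (AE x in lebesgue_on \<Omega>. v x = u x))) \<and>
         (\<forall>\<xi>\<in>admissible_A \<Omega> W. \<exists>D.
           has_frechet_derivative_Linf_L2 \<Omega> W (admissible_A \<Omega> W) (data_map \<Omega> \<phi>) \<xi> D) \<and>
         (\<exists>N. sup_defect \<Omega> \<phi> W \<Lambda> (Q N) \<le> ereal (1 / (2 * C))) \<and>
         (\<forall>N. sup_defect \<Omega> \<phi> W \<Lambda> (Q N) \<le> ereal (1 / (2 * C)) \<longrightarrow>
           (\<forall>\<mu>1\<in>admissible_K \<Omega> W \<Lambda>. \<forall>\<mu>2\<in>admissible_K \<Omega> W \<Lambda>.
              Linf_norm \<Omega> (\<lambda>x. \<mu>1 x - \<mu>2 x)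
                \<le> 2 * C * L2_norm \<Omega> (\<lambda>x. Q N (data_map \<Omega> \<phi> \<mu>1) x - Q N (data_map \<Omega> \<phi> \<mu>2) x)))"
proof -
  interpret bounded_open_set \<Omega>
    using assms(3,4) by unfold_locales (auto simp: C1_holder_domain_def)
  interpret data_problem \<Omega> \<phi> W
    using C1_holder_H1[OF assms(1,5)] assms(7) by unfold_locales
  have "\<forall>N. \<exists>t. bounded_linear t \<and> (\<forall>f. sq_on f \<longrightarrow> sq_on (Q N f)) \<and> (\<forall>f. sq_on f \<longrightarrow> cls (Q N f) = t (cls f)) \<and>
      (\<forall>X. t X = cls (Q N (rep_l2 X)))"
    using L2_operator_lift[OF assms(9)] by metis
  then obtain t where t: "\<And>N. bounded_linear (t N)" "\<And>N f. sq_on f \<Longrightarrow> sq_on (Q N f)"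
    "\<And>N f. sq_on f \<Longrightarrow> cls (Q N f) = t N (cls f)" "\<And>N X. t N X = cls (Q N (rep_l2 X))" by metis
  have t_lim: "(\<lambda>N. t N X) \<longlonglongrightarrow> cls (rep_l2 X)" for X
  proof -
    have "norm (t N X - cls (rep_l2 X)) = L2_norm \<Omega> (\<lambda>x. Q N (rep_l2 X) x - rep_l2 X x)" for N
      by (simp add: t(4) norm_cls[symmetric] L2_iff sq_on_diff cls_diff t(2) sq_on_rep)
    moreover have "(\<lambda>N. L2_norm \<Omega> (\<lambda>x. Q N (rep_l2 X) x - rep_l2 X x)) \<longlonglongrightarrow> 0"
      by (rule assms(11)) (simp add: L2_iff sq_on_rep)
    ultimately have "(\<lambda>N. norm (t N X - cls (rep_l2 X))) \<longlonglongrightarrow> 0" by (simp only:)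
    then have "(\<lambda>N. t N X - cls (rep_l2 X)) \<longlonglongrightarrow> 0" by (rule tendsto_norm_zero_cancel)
    then show ?thesis by (rule LIM_zero_cancel)
  qed
  have sup: "sup_defect \<Omega> \<phi> W \<Lambda> (Q N) \<le> ereal (1 / (2 * C)) \<longleftrightarrow>
    (\<forall>\<xi>\<in>admissible_K \<Omega> W \<Lambda>. \<forall>h\<in>W. Linf_norm \<Omega> h \<le> 1 \<longrightarrow>
      norm (data_op' (mult_op \<xi>) (mult_op h) - t N (data_op' (mult_op \<xi>) (mult_op h))) \<le> 1 / (2 * C))" for N
    by (rule sup_defect_le_iff[where T = "Q N" and t = "t N", OF assms(8) t(2) t(3)])
  show ?thesis
  proof (intro conjI ballI allI impI)
    fix \<mu> assume \<mu>: "\<mu> \<in> admissible_A \<Omega> W"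
    obtain c where c: "c > 0" "AE x in lebesgue_on \<Omega>. c \<le> \<mu> x" by (rule admissible_A_lower[OF \<mu>])
    note \<mu>' = W_Linf[OF admissible_A_W[OF \<mu>]] c(2,1)
    show "\<exists>u. is_weak_solution \<Omega> \<phi> \<mu> u \<and> (\<forall>v. is_weak_solution \<Omega> \<phi> \<mu> v \<longrightarrow> (AE x in lebesgue_on \<Omega>. v x = u x))"
      using weak_solution_exists[OF \<mu>'] weak_solution_unique[OF \<mu>'] by blast
  next
    fix \<xi> assume "\<xi> \<in> admissible_A \<Omega> W"
    then show "\<exists>D. has_frechet_derivative_Linf_L2 \<Omega> W (admissible_A \<Omega> W) (data_map \<Omega> \<phi>) \<xi> D"
      using has_frechet_derivative_data_map by blast
  next
    show "\<exists>N. sup_defect \<Omega> \<phi> W \<Lambda> (Q N) \<le> ereal (1 / (2 * C))"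
      unfolding sup using assms(8,12) t(1) t_lim by (intro defect_eventually_small) auto
  next
    fix N \<mu>1 \<mu>2
    assume N: "sup_defect \<Omega> \<phi> W \<Lambda> (Q N) \<le> ereal (1 / (2 * C))"
      and \<mu>: "\<mu>1 \<in> admissible_K \<Omega> W \<Lambda>" "\<mu>2 \<in> admissible_K \<Omega> W \<Lambda>"
    note F = data_map_A[OF admissible_K_A[OF assms(8) \<mu>(1)]] data_map_A[OF admissible_K_A[OF assms(8) \<mu>(2)]]
    have "Linf_norm \<Omega> (\<lambda>x. \<mu>1 x - \<mu>2 x) \<le> C * norm (data_op (mult_op \<mu>1) - data_op (mult_op \<mu>2))"
      using assms(13)[OF \<mu>] F by (simp add: norm_cls[symmetric] L2_iff sq_on_diff cls_diff)
    then have "Linf_norm \<Omega> (\<lambda>x. \<mu>1 x - \<mu>2 x) \<le> 2 * C * norm (t N (data_op (mult_op \<mu>1)) - t N (data_op (mult_op \<mu>2)))"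
      using N unfolding sup by (intro stability_from_defect[OF assms(8,12) t(1) \<mu>]) auto
    then show "Linf_norm \<Omega> (\<lambda>x. \<mu>1 x - \<mu>2 x)
        \<le> 2 * C * L2_norm \<Omega> (\<lambda>x. Q N (data_map \<Omega> \<phi> \<mu>1) x - Q N (data_map \<Omega> \<phi> \<mu>2) x)"
      using F by (simp add: norm_cls[symmetric] L2_iff sq_on_diff cls_diff t)
  qed
qed

end
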